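(* Let $X$ be an open subset of $\mathbb{C}^n$. Then $V_X=E_{\mathcal{B}_{\mathbb{P}^n}^X}I$ on $\mathbb{C}^n$; that is, for every $z\in\mathbb{C}^n$, $$V_X(z)=\inf\{I(f): f\in\mathcal{B}_{\mathbb{P}^n}^X,\ f(0)=z\}.$$
   Context: Notation: $\mathbb{D}$ is the open unit disc in $\mathbb{C}$, and $\mathbb{T}$ is the unit circle with normalized arc length measure $\sigma$; a subset of $\mathbb{T}$ is conull if its complement is $\sigma$-null. $\mathbb{C}^n$ is viewed as the subset of complex projective space $\mathbb{P}^n$, with projective coordinates $[z_0,\dots,z_n]$, where $z_0\neq 0$. Let $\mathbb{C}_*^{n+1}=\mathbb{C}^{n+1}\setminus\{0\}$ and let $\pi:\mathbb{C}_*^{n+1}\to\mathbb{P}^n$ be the projection. An analytic disc in a complex manifold $Y$ is a holomorphic map $\mathbb{D}\to Y$. A holomorphic lifting of an analytic disc $f$ in $\mathbb{P}^n$ is a holomorphic map $\tilde f:\mathbb{D}\to\mathbb{C}_*^{n+1}$ with $\pi\circ\tilde f=f$; it is bounded if its components are bounded. For a bounded holomorphic $\tilde f$, $\tilde f^*$ denotes its nontangential boundary map, defined almost everywhere on $\mathbb{T}$. The Siciak-Zahariuta extremal function: the Lelong class $\mathcal{L}$ is the set of plurisubharmonic functions $u$ on $\mathbb{C}^n$ such that $u-\log^+\|\cdot\|$ is bounded above on $\mathbb{C}^n$ ($\|\cdot\|$ is the Euclidean norm). For $X\subset\mathbb{C}^n$, $V_X(z)=\sup\{u(z): u\in\mathcal{L},\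 u|_X\leq 0\}$ for $z\in\mathbb{C}^n$. The class $\mathcal{B}_{\mathbb{P}^n}^X$: the set of all analytic discs $f$ in $\mathbb{P}^n$ with $f(0)\in\mathbb{C}^n$ that have a bounded holomorphic lifting $\tilde f:\mathbb{D}\to\mathbb{C}_*^{n+1}$ such that the boundary map $f^*=\pi\circ\tilde f^*$ takes a conull subset of $\mathbb{T}$ into $X$. The functional $I$: for an analytic disc $f$ in $\mathbb{P}^n$ with $f(0)\in\mathbb{C}^n$ that has a bounded holomorphic lifting, $$I(f)=-\max_{\tilde f}\log|g(0)|\in[0,\infty),$$ where $\tilde f$ runs through all bounded holomorphic liftings of $f$ and $g$ is the inner factor (in the inner-outer factorization) of the zeroth component of $\tilde f$; the maximum is attained. The envelope of a functional $H:\mathcal{A}\to[-\infty,\infty]$ on a class $\mathcal{A}$ of analytic discs is $E_{\mathcal{A}}H(y)=\inf\{H(f): f\in\mathcal{A},\ f(0)=y\}$, with $\inf\varnothing=\infty$. *)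

theory Defs
  imports "HOL-Analysis.Analysis"
begin

section \<open>Complex projective space\<close>

text \<open>
  Homogeneous coordinates are indexed by a finite type \<open>'m\<close>. The space \<open>\<P>\<^sup>n\<close> containing
  \<open>\<complex>\<^sup>n = complex ^ 'n\<close> is \<open>'n option proj\<close>; the index \<open>None\<close> carries the zeroth coordinate.
\<close>

definition proj_rel :: "complex ^ 'm \<Rightarrow> complex ^ 'm \<Rightarrow> bool" where
  "proj_rel v w \<longleftrightarrow> v \<noteq> 0 \<and> w \<noteq> 0 \<and> (\<exists>c. c \<noteq> 0 \<and> w = c *s v)"

text \<open>
  \<open>proj_of\<close> is the projection \<open>\<pi>\<close>. As a total function it also has an unspecified value at
  the zero vector, so it is only ever applied under a guard excluding zero.
\<close>

quotient_type 'm proj = "complex ^ 'm" / partial: proj_rel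
  morphisms rep_proj proj_of
proof (rule part_equivpI)
  show "\<exists>v :: complex ^ 'm. proj_rel v v"
    by (rule exI[of _ "vec 1"])
      (auto simp: proj_rel_def vec_eq_iff intro!: exI[of _ 1])
  show "symp (proj_rel :: complex ^ 'm \<Rightarrow> _)"
  proof (rule sympI)
    fix v w :: "complex ^ 'm"
    assume "proj_rel v w"
    then obtain c where "v \<noteq> 0" "w \<noteq> 0" "c \<noteq> 0" "w = c *s v"
      by (auto simp: proj_rel_def)
    then show "proj_rel w v"
      by (auto simp: proj_rel_def vec_eq_iff intro!: exI[of _ "inverse c"])
  qed
  show "transp (proj_rel :: complex ^ 'm \<Rightarrow> _)"
  proof (rule transpI)
    fix u v w :: "complex ^ 'm"
    assume "proj_rel u v" "proj_rel v w"
    then obtain c d where "u \<noteq> 0" "w \<noteq> 0" "c \<noteq> 0" "v = c *s u" "d \<noteq> 0" "w = d *s v"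
      by (auto simp: proj_rel_def)
    then show "proj_rel u w"
      unfolding proj_rel_def
      by (intro conjI exI[of _ "d * c"]) (auto simp: vec_eq_iff mult.assoc)
  qed
qed

text \<open>The standard chart \<open>{z\<^sub>i \<noteq> 0}\<close> with its coordinates \<open>z\<^sub>j / z\<^sub>i\<close>.\<close>

lift_definition in_chart :: "'m :: finite \<Rightarrow> 'm proj \<Rightarrow> bool" is
  "\<lambda>i v. v $ i \<noteq> 0"
  by (auto simp: proj_rel_def)

lift_definition chart_coord :: "'m :: finite \<Rightarrow> 'm \<Rightarrow> 'm proj \<Rightarrow> complex" is
  "\<lambda>i j v. v $ j / v $ i"
  by (auto simp: proj_rel_def)

definition affine_embed :: "complex ^ 'n \<Rightarrow> 'n option proj" where
  "affine_embed z = proj_of (\<chi> i. case i of None \<Rightarrow> 1 | Some j \<Rightarrow> z $ j)"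


section \<open>Analytic discs and liftings\<close>

text \<open>
  Discs and liftings are total functions on \<open>complex\<close>; everything below depends only on their
  restrictions to \<open>ball 0 1\<close>.
\<close>

definition analytic_disc :: "(complex \<Rightarrow> 'm :: finite proj) \<Rightarrow> bool" where
  "analytic_disc f \<longleftrightarrow>
     (\<forall>w \<in> ball 0 1. \<exists>i U. open U \<and> w \<in> U \<and> U \<subseteq> ball 0 1 \<and>
        (\<forall>z \<in> U. in_chart i (f z)) \<and>
        (\<forall>j. (\<lambda>z. chart_coord i j (f z)) holomorphic_on U))"

definition bounded_lifting ::
    "(complex \<Rightarrow> complex ^ 'm) \<Rightarrow> (complex \<Rightarrow> 'm :: finite proj) \<Rightarrow> bool" where
  "bounded_lifting F f \<longleftrightarrow>
     (\<forall>i. (\<lambda>z. F z $ i) holomorphic_on ball 0 1) \<and>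
     (\<forall>i. bounded ((\<lambda>z. F z $ i) ` ball 0 1)) \<and>
     (\<forall>z \<in> ball 0 1. F z \<noteq> 0 \<and> proj_of (F z) = f z)"


section \<open>The unit circle and nontangential limits\<close>

text \<open>
  Normalized arc length, as a Borel measure on \<open>complex\<close> concentrated on the unit circle.
\<close>

definition arc_measure :: "complex measure" where
  "arc_measure = distr (uniform_measure lborel {0..2 * pi}) borel cis"

lemma measurable_cis [measurable]: "cis \<in> borel_measurable borel"
  by (intro borel_measurable_continuous_onI continuous_intros)

lemma emeasure_arc_measure_UNIV: "emeasure arc_measure UNIV = 1"
proof -
  have "emeasure arc_measure UNIV =
      emeasure (uniform_measure lborel {0..2 * pi}) (UNIV :: real set)"
    unfolding arc_measure_def by (subst emeasure_distr) auto
  also have "\<dots> = 1"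
    by (simp add: divide_ennreal)
  finally show ?thesis .
qed

lemma AE_arc_measure_sphere: "AE \<zeta> in arc_measure. \<zeta> \<in> sphere 0 1"
  unfolding arc_measure_def by (subst AE_distr_iff) auto

definition stolz :: "real \<Rightarrow> complex \<Rightarrow> complex set" where
  "stolz \<alpha> \<zeta> = {z \<in> ball 0 1. dist z \<zeta> < \<alpha> * (1 - norm z)}"

definition has_nt_limit :: "(complex \<Rightarrow> 'a :: topological_space) \<Rightarrow> complex \<Rightarrow> 'a \<Rightarrow> bool" where
  "has_nt_limit F \<zeta> w \<longleftrightarrow> (\<forall>\<alpha> > 1. (F \<longlongrightarrow> w) (at \<zeta> within stolz \<alpha> \<zeta>))"


section \<open>Inner and outer functions\<close>

definition inner_function :: "(complex \<Rightarrow> complex) \<Rightarrow> bool" where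
  "inner_function g \<longleftrightarrow>
     g holomorphic_on ball 0 1 \<and> (\<forall>z \<in> ball 0 1. norm (g z) \<le> 1) \<and>
     (AE \<zeta> in arc_measure. \<exists>w. has_nt_limit g \<zeta> w \<and> norm w = 1)"

text \<open>Here \<open>k\<close> is \<open>log \<phi>\<close> for the positive function \<open>\<phi>\<close>, the boundary modulus of \<open>h\<close>.\<close>

definition outer_function :: "(complex \<Rightarrow> complex) \<Rightarrow> bool" where
  "outer_function h \<longleftrightarrow>
     (\<exists>c k. norm c = 1 \<and> integrable arc_measure (k :: complex \<Rightarrow> real) \<and>
       (\<forall>z \<in> ball 0 1.
          h z = c * exp (\<integral>\<zeta>. (\<zeta> + z) / (\<zeta> - z) * of_real (k \<zeta>) \<partial>arc_measure)))"

definition inner_factor :: "(complex \<Rightarrow> complex) \<Rightarrow> (complex \<Rightarrow> complex) \<Rightarrow> bool" where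
  "inner_factor g F \<longleftrightarrow>
     inner_function g \<and> (\<exists>h. outer_function h \<and> (\<forall>z \<in> ball 0 1. F z = g z * h z))"


section \<open>The Siciak-Zahariuta extremal function\<close>

text \<open>
  Integral of an extended real function, as the difference of the integrals of its positive
  part \<open>e2ennreal (u x)\<close> and negative part \<open>e2ennreal (- u x)\<close>. It is used only for functions
  bounded above on a probability space, where the first integral is finite.
\<close>

definition ereal_integral :: "'a measure \<Rightarrow> ('a \<Rightarrow> ereal) \<Rightarrow> ereal" where
  "ereal_integral M u =
     enn2ereal (\<integral>\<^sup>+ x. e2ennreal (u x) \<partial>M) - enn2ereal (\<integral>\<^sup>+ x. e2ennreal (- u x) \<partial>M)"

text \<open>
  Plurisubharmonic functions on all of \<open>\<complex>\<^sup>n\<close>, with values in \<open>[-\<infinity>, \<infinity>)\<close>. The radius of the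
  circle in the sub-mean value inequality is absorbed into the direction \<open>b\<close>.
\<close>

definition plurisubharmonic :: "(complex ^ 'n \<Rightarrow> ereal) \<Rightarrow> bool" where
  "plurisubharmonic u \<longleftrightarrow>
     (\<forall>z. u z < \<infinity>) \<and>
     (\<forall>c. open {z. u z < c}) \<and>
     (\<forall>a b. u a \<le> ereal_integral arc_measure (\<lambda>\<zeta>. u (a + \<zeta> *s b)))"

definition lelong_class :: "(complex ^ 'n \<Rightarrow> ereal) set" where
  "lelong_class =
     {u. plurisubharmonic u \<and>
         (\<exists>C :: real. \<forall>z. u z \<le> ereal (ln (max 1 (norm z)) + C))}"

definition siciak_extremal :: "(complex ^ 'n) set \<Rightarrow> complex ^ 'n \<Rightarrow> ereal" where
  "siciak_extremal X z = (SUP u \<in> {u \<in> lelong_class. \<forall>x \<in> X. u x \<le> 0}. u z)"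


section \<open>The disc functional and its envelope\<close>

text \<open>
  The boundary map of \<open>F\<close> is composed with \<open>\<pi>\<close> only where it exists and is nonzero, which is
  required almost everywhere.
\<close>

definition disc_class :: "(complex ^ 'n) set \<Rightarrow> (complex \<Rightarrow> 'n option proj) set" where
  "disc_class X =
     {f. analytic_disc f \<and> f 0 \<in> range affine_embed \<and>
         (\<exists>F. bounded_lifting F f \<and>
            (AE \<zeta> in arc_measure.
               \<exists>w. has_nt_limit F \<zeta> w \<and> w \<noteq> 0 \<and> proj_of w \<in> affine_embed ` X))}"

text \<open>
  The supremum is a maximum when \<open>f\<close> has a bounded lifting and \<open>f 0\<close> lies in \<open>\<complex>\<^sup>n\<close>. The latter
  also makes \<open>g 0\<close> nonzero, so that the convention \<open>ln 0 = 0\<close> plays no role.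
\<close>

definition disc_functional :: "(complex \<Rightarrow> 'n :: finite option proj) \<Rightarrow> ereal" where
  "disc_functional f =
     - Sup {ereal (ln (norm (g 0))) | F g.
              bounded_lifting F f \<and> inner_factor g (\<lambda>z. F z $ None)}"

definition envelope ::
    "(complex \<Rightarrow> 'y) set \<Rightarrow> ((complex \<Rightarrow> 'y) \<Rightarrow> ereal) \<Rightarrow> 'y \<Rightarrow> ereal" where
  "envelope A H y = (INF f \<in> {f \<in> A. f 0 = y}. H f)"

end

theory Submission
  imports Defs "HOL-Complex_Analysis.Cauchy_Integral_Formula" "HOL-Computational_Algebra.Polynomial"
begin

text \<open>
  If \<open>u\<close> is in the Lelong class and \<open>F = (F\<^sub>0, F')\<close> is a bounded lifting, then
  \<open>u (F' / F\<^sub>0) + ln (norm F\<^sub>0)\<close> is subharmonic and bounded above on the disc. If \<open>u \<le> 0\<close> on \<open>X\<close>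
  and the boundary values lie over \<open>X\<close>, its value at \<open>0\<close> is at most the mean of \<open>ln (norm F\<^sub>0)\<close> over
  the circle, which is \<open>ln (norm (h 0))\<close> for the outer factor \<open>h\<close> of \<open>F\<^sub>0\<close>. Hence \<open>u\<close> is at most the
  disc functional.

  Conversely, let \<open>V\<close> be the union of a small ball about \<open>0\<close> in \<open>\<complex>\<^sup>n\<^sup>+\<^sup>1\<close> and the set of all \<open>w\<close>
  over \<open>X\<close> with \<open>norm w\<^sub>0 < 1\<close>. The set of centres of entire discs with boundary in \<open>V\<close> is open and
  circled, and by a gluing argument of Poletsky type its logarithmic gauge at \<open>(1, z)\<close> is, as a
  function of \<open>z\<close>, a Lelong function that is nonpositive on \<open>X\<close>. Thus \<open>s > V\<^sub>X z\<close> gives an entire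
  disc centred at \<open>exp (- s) (1, z)\<close> with boundary in \<open>V\<close>. Adding a suitable outer function with
  jumps moves its whole boundary, up to a null set, over \<open>X\<close>, and its zeroth component has modulus
  less than \<open>1\<close> on the circle, so that the disc functional is at most \<open>s\<close>.
\<close>

section \<open>Means over the unit circle\<close>

text \<open>\<open>plurisubharmonic\<close> speaks of affine circles only, so subharmonicity along a
  holomorphic disc has to be obtained from a maximum principle. A further obstacle in the first half
  is that the supremum in the functional runs over all bounded liftings \<open>F\<close>, while only
  some lifting \<open>G\<close> is known to have boundary values over \<open>X\<close>. The position
  over \<open>X\<close> is therefore read off from \<open>G\<close>, the size and the factorization
  from \<open>F\<close>; inside the disc the two have the same affine part.

  In the second half the ball in \<open>V\<close> has two tasks: it makes the gauge finite with
  logarithmic growth, and it receives the bad parts of the boundary at a small cost at the centre.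
  The bound 1 on the zeroth coordinate makes the outer factor at most 1 in modulus at 0, so that the
  factor \<open>exp (- s)\<close> at the centre is passed on to the inner factor.\<close>

definition circ :: "real measure" where
  "circ = uniform_measure lborel {0..2*pi}"

text \<open>Pulled back to the angle, a function that is continuous on the circle is measurable
  whatever its values elsewhere; against \<open>arc_measure\<close> it would have to be Borel on the
  whole plane.\<close>

definition circle_mean :: "(complex \<Rightarrow> 'b::{banach,second_countable_topology}) \<Rightarrow> 'b" where
  "circle_mean f = (\<integral>t. f (cis t) \<partial>circ)"

lemma arc_measure_circ: "arc_measure = distr circ borel cis"
  by (simp add: arc_measure_def circ_def)

lemma sets_circ [measurable_cong, simp]: "sets circ = sets borel"
  by (simp add: circ_def)

lemma space_circ [simp]: "space circ = UNIV"
  by (simp add: circ_def)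

lemma sets_arc_measure [measurable_cong, simp]: "sets arc_measure = sets borel"
  by (simp add: arc_measure_def)

lemma space_arc_measure [simp]: "space arc_measure = UNIV"
  by (simp add: arc_measure_def)

lemma emeasure_circ_UNIV: "emeasure circ UNIV = 1"
  by (simp add: circ_def divide_ennreal)

interpretation circ: finite_measure circ
  by (rule finite_measureI) (simp add: emeasure_circ_UNIV)

interpretation arc: finite_measure arc_measure
  by (rule finite_measureI) (simp add: emeasure_arc_measure_UNIV)

lemma measure_circ_UNIV [simp]: "measure circ UNIV = 1"
  by (simp add: measure_def emeasure_circ_UNIV)

lemma measure_arc_UNIV [simp]: "measure arc_measure UNIV = 1"
  by (simp add: measure_def emeasure_arc_measure_UNIV)

lemma measurable_cis_circ [measurable]: "cis \<in> measurable circ borel"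
  by (subst measurable_cong_sets[OF sets_circ refl]) (rule measurable_cis)

lemma continuous_on_compose_cis:
  assumes "continuous_on (sphere 0 1) f"
  shows "continuous_on A (\<lambda>t. f (cis t))"
  by (rule continuous_on_compose2[OF assms]) (auto intro!: continuous_intros)

lemma measurable_compose_cis:
  fixes f :: "complex \<Rightarrow> 'b::topological_space"
  assumes "continuous_on (sphere 0 1) f"
  shows "(\<lambda>t. f (cis t)) \<in> borel_measurable circ"
  by (subst measurable_cong_sets[OF sets_circ refl])
     (intro borel_measurable_continuous_onI continuous_on_compose_cis assms)

lemma integrable_circ:
  fixes f :: "complex \<Rightarrow> 'b::{banach,second_countable_topology}"
  assumes "continuous_on (sphere 0 1) f"
  shows "integrable circ (\<lambda>t. f (cis t))"
proof -
  have "bounded (f ` sphere 0 1)"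
    by (intro compact_imp_bounded compact_continuous_image assms) simp
  then obtain B where "\<And>x. x \<in> sphere 0 1 \<Longrightarrow> norm (f x) \<le> B"
    by (meson bounded_iff imageI)
  then show ?thesis
    by (intro circ.integrable_const_bound[of _ B] measurable_compose_cis assms) auto
qed

lemma circle_mean_const [simp]: "circle_mean (\<lambda>_. c) = c"
  by (simp add: circle_mean_def)

lemma circle_mean_cong:
  "(\<And>z. norm z = 1 \<Longrightarrow> f z = g z) \<Longrightarrow> circle_mean f = circle_mean g"
  by (simp add: circle_mean_def)

lemma circle_mean_add:
  "continuous_on (sphere 0 1) f \<Longrightarrow> continuous_on (sphere 0 1) g \<Longrightarrow>
   circle_mean (\<lambda>z. f z + g z) = circle_mean f + circle_mean g"
  unfolding circle_mean_def by (intro Bochner_Integration.integral_add integrable_circ)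

lemma circle_mean_diff:
  "continuous_on (sphere 0 1) f \<Longrightarrow> continuous_on (sphere 0 1) g \<Longrightarrow>
   circle_mean (\<lambda>z. f z - g z) = circle_mean f - circle_mean g"
  unfolding circle_mean_def by (intro Bochner_Integration.integral_diff integrable_circ)

lemma circle_mean_mono:
  fixes f g :: "complex \<Rightarrow> real"
  shows "continuous_on (sphere 0 1) f \<Longrightarrow> continuous_on (sphere 0 1) g \<Longrightarrow>
   (\<And>z. norm z = 1 \<Longrightarrow> f z \<le> g z) \<Longrightarrow> circle_mean f \<le> circle_mean g"
  unfolding circle_mean_def by (intro integral_mono integrable_circ) auto

lemma circle_mean_Re:
  "continuous_on (sphere 0 1) f \<Longrightarrow> circle_mean (\<lambda>z. Re (f z)) = Re (circle_mean f)"
  unfolding circle_mean_def by (intro integral_Re integrable_circ)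

lemma integral_arc_measure:
  fixes f :: "complex \<Rightarrow> 'b::{banach,second_countable_topology}"
  assumes "f \<in> borel_measurable borel"
  shows "integral\<^sup>L arc_measure f = circle_mean f"
  unfolding circle_mean_def arc_measure_circ by (rule integral_distr) (use assms in auto)

lemma circle_mean_eq_integral:
  fixes f :: "complex \<Rightarrow> 'b::euclidean_space"
  assumes "continuous_on (sphere 0 1) f"
  shows "circle_mean f = (1 / (2*pi)) *\<^sub>R integral {0..2*pi} (\<lambda>t. f (cis t))"
proof -
  have "circ = density lborel (\<lambda>x. ennreal (indicator {0..2*pi} x / (2*pi)))"
    unfolding circ_def uniform_measure_def
    by (intro density_cong)
       (auto simp: divide_ennreal simp flip: ennreal_1 split: split_indicator)
  then have "circle_mean f = (\<integral>t. (indicator {0..2*pi} t / (2*pi)) *\<^sub>R f (cis t) \<partial>lborel)"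
    unfolding circle_mean_def \<open>circ = _\<close>
    by (subst integral_density)
       (auto intro!: borel_measurable_continuous_onI continuous_on_compose_cis assms)
  also have "\<dots> = (1 / (2*pi)) *\<^sub>R (LINT t:{0..2*pi}|lborel. f (cis t))"
    unfolding set_lebesgue_integral_def by (subst integral_scaleR_right[symmetric]) (simp add: field_simps)
  also have "(LINT t:{0..2*pi}|lborel. f (cis t)) = integral {0..2*pi} (\<lambda>t. f (cis t))"
    unfolding set_integrable_def
    by (intro set_borel_integral_eq_integral borel_integrable_atLeastAtMost' continuous_on_compose_cis assms)
  finally show ?thesis .
qed

text \<open>The extra factor \<open>\<zeta>\<close> comes from the change from
  \<open>d\<zeta>\<close> to the angle: \<open>d\<zeta> = \<i> * \<zeta> * dt\<close>.\<close>

theorem circle_mean_Cauchy: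
  assumes "continuous_on (cball 0 1) f" "f holomorphic_on ball 0 1" "norm z < 1"
  shows "circle_mean (\<lambda>\<zeta>. f \<zeta> * \<zeta> / (\<zeta> - z)) = f z"
proof -
  have "((\<lambda>u. f u / (u - z)) has_contour_integral (2 * of_real pi * \<i> * f z)) (circlepath 0 1)"
    by (rule Cauchy_integral_circlepath) (use assms in auto)
  then have "((\<lambda>t. f (0 + 1 * cis t) / (0 + 1 * cis t - z) * 1 * \<i> * cis t) has_integral (2 * of_real pi * \<i> * f z)) {0..2*pi}"
    using has_contour_integral_part_circlepath_iff[of 0 "2*pi" _ _ 0 1]
    by (simp add: circlepath_def)
  from has_integral_mult_right[OF this, of "1/\<i>"]
  have "((\<lambda>t. f (cis t) * cis t / (cis t - z)) has_integral (2 * of_real pi * f z)) {0..2*pi}"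
    by (simp add: field_simps)
  then have i: "integral {0..2*pi} (\<lambda>t. f (cis t) * cis t / (cis t - z)) = 2 * of_real pi * f z"
    by (rule integral_unique)
  have "continuous_on (sphere 0 1) (\<lambda>\<zeta>. f \<zeta> * \<zeta> / (\<zeta> - z))"
    using assms by (intro continuous_intros continuous_on_subset[OF assms(1)]) auto
  from circle_mean_eq_integral[OF this] show ?thesis
    unfolding i by (simp add: scaleR_conv_of_real)
qed

corollary circle_mean_holomorphic:
  assumes "continuous_on (cball 0 1) f" "f holomorphic_on ball 0 1"
  shows "circle_mean f = f 0"
proof -
  have "circle_mean f = circle_mean (\<lambda>\<zeta>. f \<zeta> * \<zeta> / (\<zeta> - 0))"
    by (rule circle_mean_cong) auto
  with circle_mean_Cauchy[OF assms, of 0] show ?thesis by simp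
qed

corollary circle_mean_Re_holomorphic:
  assumes "continuous_on (cball 0 1) f" "f holomorphic_on ball 0 1"
  shows "circle_mean (\<lambda>z. Re (f z)) = Re (f 0)"
  using circle_mean_holomorphic[OF assms] circle_mean_Re continuous_on_subset[OF assms(1) sphere_cball]
  by metis

section \<open>Approximation of real functions on the circle\<close>

text \<open>On the circle the conjugate of \<open>z\<close> is \<open>1 / z\<close>, so both real
  coordinates are Laurent polynomials, and these are closed under sums and products.\<close>

lemma real_polynomial_function_Laurent:
  fixes g :: "complex \<Rightarrow> real"
  assumes "real_polynomial_function g"
  shows "\<exists>Q m. \<forall>z. norm z = 1 \<longrightarrow> complex_of_real (g z) = poly Q z / z ^ m"
  using assms
proof (induction rule: real_polynomial_function.induct)
  case (linear f)
  \<comment> \<open>The coefficients arise from \<open>Re z = (z + 1 / z) / 2\<close> and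
    \<open>Im z = (z - 1 / z) / (2 * \<i>)\<close> after multiplication by \<open>z\<close>.\<close>
  show ?case
  proof (intro exI[of _ "[:f 1 / 2 + \<i> * f \<i> / 2, 0, f 1 / 2 - \<i> * f \<i> / 2:]"] exI[of _ 1] allI impI)
    fix z :: complex assume z: "norm z = 1"
    have "f z = f (Re z *\<^sub>R 1 + Im z *\<^sub>R \<i>)"
      by (rule arg_cong[of _ _ f]) (auto simp: complex_eq_iff)
    also have "\<dots> = Re z * f 1 + Im z * f \<i>"
      using linear by (simp add: linear_add linear_scale bounded_linear.linear)
    finally have fz: "f z = Re z * f 1 + Im z * f \<i>" .
    from z have nz: "z \<noteq> 0" by auto
    have "z * cnj z = 1"
      using z by (metis complex_norm_square of_real_1 power_one)
    then have 1: "1 + z * z = z * (z + cnj z)" "1 - z * z = - z * (z - cnj z)"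
      by (simp_all add: algebra_simps)
    have "poly [:f 1 / 2 + \<i> * f \<i> / 2, 0, f 1 / 2 - \<i> * f \<i> / 2:] z =
          f 1 / 2 * (1 + z * z) + \<i> * f \<i> / 2 * (1 - z * z)"
      by (simp add: field_simps)
    also have "\<dots> = z * (f 1 / 2 * (z + cnj z) - \<i> * f \<i> / 2 * (z - cnj z))"
      unfolding 1 by (simp add: field_simps)
    also have "\<dots> = complex_of_real (f z) * z"
      unfolding complex_add_cnj complex_diff_cnj fz by (simp add: field_simps)
    finally have "complex_of_real (f z) * z = poly [:f 1 / 2 + \<i> * f \<i> / 2, 0, f 1 / 2 - \<i> * f \<i> / 2:] z"
      by simp
    then show "complex_of_real (f z) = poly [:f 1 / 2 + \<i> * f \<i> / 2, 0, f 1 / 2 - \<i> * f \<i> / 2:] z / z ^ 1"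
      using nz by (simp add: field_simps)
  qed
next
  case (const c)
  show ?case by (rule exI[of _ "[:of_real c:]"], rule exI[of _ 0]) simp
next
  case (add f g)
  then obtain P m Q n where P: "\<And>z. norm z = 1 \<Longrightarrow> complex_of_real (f z) = poly P z / z ^ m"
    and Q: "\<And>z. norm z = 1 \<Longrightarrow> complex_of_real (g z) = poly Q z / z ^ n" by blast
  show ?case
  proof (intro exI[of _ "P * monom 1 n + Q * monom 1 m"] exI[of _ "m + n"] allI impI)
    fix z :: complex assume z: "norm z = 1"
    then have "z \<noteq> 0" by auto
    with P[OF z] Q[OF z]
    show "complex_of_real (f z + g z) = poly (P * monom 1 n + Q * monom 1 m) z / z ^ (m + n)"
      by (simp add: poly_monom field_simps power_add)
  qed
next
  case (mult f g)
  then obtain P m Q n where P: "\<And>z. norm z = 1 \<Longrightarrow> complex_of_real (f z) = poly P z / z ^ m"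
    and Q: "\<And>z. norm z = 1 \<Longrightarrow> complex_of_real (g z) = poly Q z / z ^ n" by blast
  show ?case
    by (rule exI[of _ "P * Q"], rule exI[of _ "m + n"]) (simp add: P Q power_add)
qed

lemma Laurent_approximation:
  fixes c :: "complex \<Rightarrow> real"
  assumes "continuous_on (sphere 0 1) c" "e > 0"
  obtains Q m where "\<And>z. norm z = 1 \<Longrightarrow> norm (poly Q z / z ^ m - of_real (c z)) < e"
proof -
  obtain g where g: "real_polynomial_function g" "\<And>x. x \<in> sphere 0 1 \<Longrightarrow> \<bar>c x - g x\<bar> < e"
    using Stone_Weierstrass_real_polynomial_function[OF compact_sphere assms] by blast
  obtain Q m where Q: "\<And>z. norm z = 1 \<Longrightarrow> complex_of_real (g z) = poly Q z / z ^ m"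
    using real_polynomial_function_Laurent[OF g(1)] by blast
  show ?thesis
  proof (rule that)
    fix z :: complex assume z: "norm z = 1"
    show "norm (poly Q z / z ^ m - of_real (c z)) < e"
      using g(2)[of z] z by (simp flip: Q of_real_diff add: abs_minus_commute)
  qed
qed

text \<open>On the circle a term with a negative power has the same real part as its conjugate,
  which has a positive power. Thus a Laurent approximation becomes a polynomial one if only real
  parts matter.\<close>

lemma Re_entire_approximation:
  fixes c :: "complex \<Rightarrow> real"
  assumes "continuous_on (sphere 0 1) c" "e > 0"
  obtains P where "P holomorphic_on UNIV" "\<And>z. norm z = 1 \<Longrightarrow> \<bar>Re (P z) - c z\<bar> < e"
proof -
  obtain Q m where Q: "\<And>z. norm z = 1 \<Longrightarrow> norm (poly Q z / z ^ m - of_real (c z)) < e"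
    using Laurent_approximation[OF assms] by metis
  define P where "P = (\<lambda>z. \<Sum>i\<le>degree Q. if m \<le> i then coeff Q i * z ^ (i - m) else cnj (coeff Q i) * z ^ (m - i))"
  have "Re (P z) = Re (poly Q z / z ^ m)" if z: "norm z = 1" for z
  proof -
    from z have nz: "z \<noteq> 0" by auto
    have cz: "cnj z = 1 / z"
      using z nz by (metis complex_norm_square nonzero_eq_divide_eq mult.commute of_real_1 power_one)
    have "Re (coeff Q i * z ^ i / z ^ m) =
          Re (if m \<le> i then coeff Q i * z ^ (i - m) else cnj (coeff Q i) * z ^ (m - i))" for i
    proof (cases "m \<le> i")
      case True
      then show ?thesis using nz by (simp add: power_diff)
    next
      case False
      then have "coeff Q i * z ^ i / z ^ m = coeff Q i * (1 / z) ^ (m - i)"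
        using nz by (simp add: power_diff field_simps)
      also have "\<dots> = cnj (cnj (coeff Q i) * z ^ (m - i))"
        by (simp add: cz)
      finally show ?thesis using False by (simp del: complex_cnj_mult complex_cnj_power)
    qed
    then show ?thesis
      by (simp add: P_def poly_altdef sum_divide_distrib)
  qed
  then have "\<bar>Re (P z) - c z\<bar> < e" if "norm z = 1" for z
    using Q[OF that] abs_Re_le_cmod[of "poly Q z / z ^ m - of_real (c z)"] that by simp
  moreover have "P holomorphic_on UNIV"
  proof -
    have "(\<lambda>z. if m \<le> i then coeff Q i * z ^ (i - m) else cnj (coeff Q i) * z ^ (m - i)) holomorphic_on UNIV" for i
      by (cases "m \<le> i") (auto intro!: holomorphic_intros)
    then show ?thesis unfolding P_def by (intro holomorphic_intros)
  qed
  ultimately show ?thesis using that by blast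
qed

section \<open>Upper semicontinuous functions and extended real integrals\<close>

text \<open>The sup-convolutions of \<open>e\<close> with \<open>m * dist\<close> are Lipschitz
  majorants. By upper semicontinuity they converge to \<open>e\<close> pointwise, and dominated
  convergence carries this over to the means.\<close>

lemma usc_continuous_majorant:
  fixes e :: "complex \<Rightarrow> real"
  assumes M: "\<And>z. norm z = 1 \<Longrightarrow> \<bar>e z\<bar> \<le> M"
    and usc: "\<And>z y. norm z = 1 \<Longrightarrow> e z < y \<Longrightarrow>
                \<exists>d>0. \<forall>w. norm w = 1 \<and> dist w z < d \<longrightarrow> e w < y"
    and "eps > 0"
  shows "integrable circ (\<lambda>t. e (cis t))"
    "\<exists>c. continuous_on UNIV c \<and> (\<forall>z. norm z = 1 \<longrightarrow> e z \<le> c z) \<and> circle_mean c \<le> circle_mean e + eps"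
proof -
  have meas: "(\<lambda>t. e (cis t)) \<in> borel_measurable circ"
  proof (rule borel_measurableI_less)
    fix y
    have "open {t. e (cis t) < y}"
    proof (subst open_dist, intro ballI)
      fix t assume "t \<in> {t. e (cis t) < y}"
      then obtain d where d: "d > 0" "\<And>w. norm w = 1 \<Longrightarrow> dist w (cis t) < d \<Longrightarrow> e w < y"
        using usc[of "cis t" y] by auto
      have "isCont cis t"
        by (rule continuous_on_interior[of UNIV]) (auto intro!: continuous_intros)
      then obtain s where "s > 0" "\<And>x. dist x t < s \<Longrightarrow> dist (cis x) (cis t) < d"
        using d(1) unfolding continuous_at_eps_delta by blast
      then show "\<exists>s>0. \<forall>x. dist x t < s \<longrightarrow> x \<in> {t. e (cis t) < y}"
        using d(2) by (intro exI[of _ s]) auto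
    qed
    then show "{t \<in> space circ. e (cis t) < y} \<in> sets circ" by simp
  qed
  show int: "integrable circ (\<lambda>t. e (cis t))"
    by (rule circ.integrable_const_bound[of _ M]) (use M meas in auto)
  define c where "c = (\<lambda>m::nat. \<lambda>\<zeta>. SUP \<eta>\<in>sphere 0 1. e \<eta> - m * dist \<zeta> \<eta>)"
  have M0: "0 \<le> M" using M[of 1] by auto
  have leM: "e \<eta> - real m * dist \<zeta> \<eta> \<le> M" if "\<eta> \<in> sphere 0 1" for m \<zeta> \<eta>
  proof -
    have "0 \<le> real m * dist \<zeta> \<eta>" by simp
    moreover have "e \<eta> \<le> M" using M[of \<eta>] that by simp
    ultimately show ?thesis by linarith
  qed
  have bdd: "bdd_above ((\<lambda>\<eta>. e \<eta> - m * dist \<zeta> \<eta>) ` sphere 0 1)" for m :: nat and \<zeta>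
    using leM by (intro bdd_aboveI[of _ M]) blast
  have ne: "sphere (0::complex) 1 \<noteq> {}" by simp
  have lip: "c m x \<le> c m y + m * dist x y" for m x y
  proof -
    have "e \<eta> - m * dist x \<eta> \<le> c m y + m * dist x y" if "\<eta> \<in> sphere 0 1" for \<eta>
    proof -
      have "e \<eta> - m * dist y \<eta> \<le> c m y"
        unfolding c_def by (rule cSUP_upper[OF that bdd])
      moreover have "real m * dist y \<eta> \<le> m * dist x \<eta> + m * dist x y"
        by (metis dist_commute dist_triangle distrib_left mult_left_mono of_nat_0_le_iff add.commute)
      ultimately show ?thesis by linarith
    qed
    then show ?thesis by (subst c_def) (rule cSUP_least[OF ne])
  qed
  have cont: "continuous_on UNIV (c m)" for m
  proof (rule lipschitz_on_continuous_on[of "real m"], rule lipschitz_onI)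
    fix x y show "dist (c m x) (c m y) \<le> m * dist x y"
      using lip[of m x y] lip[of m y x] by (auto simp: dist_real_def dist_commute abs_le_iff)
  qed auto
  have ge: "e z \<le> c m z" if "norm z = 1" for m z
    using cSUP_upper[OF _ bdd, of z m z] that by (auto simp: c_def)
  have le: "c m z \<le> M" for m z
    unfolding c_def by (intro cSUP_least[OF ne] leM)
  have lim: "(\<lambda>m. c m z) \<longlonglongrightarrow> e z" if z: "norm z = 1" for z
  proof (rule LIMSEQ_I)
    fix r :: real assume "r > 0"
    then obtain d where d: "d > 0" "\<And>w. norm w = 1 \<Longrightarrow> dist w z < d \<Longrightarrow> e w < e z + r / 2"
      using usc[OF z, of "e z + r/2"] by auto
    \<comment> \<open>From here on a point farther than \<open>d\<close> from \<open>z\<close> is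
      penalized by more than \<open>2 * M\<close>, so it cannot compete with \<open>z\<close>
      itself; nearer points are covered by semicontinuity.\<close>
    obtain m0 :: nat where m0: "2 * M / d < m0" using reals_Archimedean2 by blast
    have "c m z \<le> e z + r/2" if m: "m \<ge> m0" for m
      unfolding c_def
    proof (rule cSUP_least[OF ne])
      fix \<eta> :: complex assume eta: "\<eta> \<in> sphere 0 1"
      show "e \<eta> - m * dist z \<eta> \<le> e z + r/2"
      proof (cases "dist \<eta> z < d")
        case True
        then have "e \<eta> < e z + r/2" using d(2)[of \<eta>] eta by auto
        then show ?thesis by (smt (verit) mult_nonneg_nonneg of_nat_0_le_iff zero_le_dist)
      next
        case False
        have "2 * M < m0 * d" using m0 d(1) by (simp add: field_simps)
        also have "\<dots> \<le> m * dist z \<eta>"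
          using False m d(1) by (intro mult_mono) (auto simp: dist_commute)
        finally have "2 * M < m * dist z \<eta>" .
        moreover have "\<bar>e \<eta>\<bar> \<le> M" "\<bar>e z\<bar> \<le> M" using M z eta by auto
        ultimately show ?thesis using \<open>r > 0\<close> by linarith
      qed
    qed
    then have "norm (c m z - e z) < r" if "m \<ge> m0" for m
      using that ge[OF z, of m] \<open>r > 0\<close> by (fastforce simp: abs_less_iff)
    then show "\<exists>m0. \<forall>m\<ge>m0. norm (c m z - e z) < r" by blast
  qed
  have "(\<lambda>m. circle_mean (c m)) \<longlonglongrightarrow> circle_mean e"
    unfolding circle_mean_def
  proof (rule integral_dominated_convergence[where w = "\<lambda>_. M"])
    show "(\<lambda>t. c m (cis t)) \<in> borel_measurable circ" for m
      by (intro measurable_compose_cis continuous_on_subset[OF cont]) auto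
    show "AE x in circ. (\<lambda>m. c m (cis x)) \<longlonglongrightarrow> e (cis x)" using lim by auto
    show "AE x in circ. norm (c m (cis x)) \<le> M" for m
    proof (rule AE_I2)
      fix x show "norm (c m (cis x)) \<le> M"
        using le[of m "cis x"] ge[of "cis x" m] M[of "cis x"] by (simp add: abs_le_iff)
    qed
  qed (use meas in auto)
  then have "eventually (\<lambda>m. circle_mean (c m) < circle_mean e + eps) sequentially"
    using \<open>eps > 0\<close> by (intro order_tendstoD) auto
  then obtain m where "circle_mean (c m) < circle_mean e + eps"
    by (auto simp: eventually_sequentially)
  then show "\<exists>c. continuous_on UNIV c \<and> (\<forall>z. norm z = 1 \<longrightarrow> e z \<le> c z) \<and> circle_mean c \<le> circle_mean e + eps"
    using cont ge by (intro exI[of _ "c m"]) auto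
qed

lemma ereal_integral_arc_measure:
  assumes "u \<in> borel_measurable borel"
  shows "ereal_integral arc_measure u = ereal_integral circ (\<lambda>t. u (cis t))"
  unfolding ereal_integral_def arc_measure_circ
  by (subst (1 2) nn_integral_distr) (use assms in auto)

lemma ereal_integral_real:
  assumes "integrable M f"
  shows "ereal_integral M (\<lambda>x. ereal (f x)) = ereal (integral\<^sup>L M f)"
proof -
  let ?p = "\<integral>\<^sup>+ x. ennreal (f x) \<partial>M" and ?n = "\<integral>\<^sup>+ x. ennreal (- f x) \<partial>M"
  have fin: "?p < \<infinity>" "?n < \<infinity>"
    using assms by (auto simp: real_integrable_def less_top)
  obtain p where p: "?p = ennreal p" "p \<ge> 0" using fin(1) by (cases ?p) auto
  obtain n where n: "?n = ennreal n" "n \<ge> 0" using fin(2) by (cases ?n) auto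
  show ?thesis
    unfolding ereal_integral_def real_lebesgue_integral_def[OF assms]
    using p n by (simp add: e2ennreal_ereal enn2ereal_ennreal)
qed

lemma ereal_integral_le:
  assumes u: "u \<in> borel_measurable M" and B: "integrable M B" and le: "\<And>x. x \<in> space M \<Longrightarrow> u x \<le> ereal (B x)"
  shows "ereal_integral M u \<le> ereal (integral\<^sup>L M B)"
proof -
  let ?up = "\<integral>\<^sup>+ x. e2ennreal (u x) \<partial>M" and ?um = "\<integral>\<^sup>+ x. e2ennreal (- u x) \<partial>M"
  let ?bp = "\<integral>\<^sup>+ x. ennreal (B x) \<partial>M" and ?bm = "\<integral>\<^sup>+ x. ennreal (- B x) \<partial>M"
  have fin: "?bp < \<infinity>" "?bm < \<infinity>" using B by (auto simp: real_integrable_def less_top)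
  have [measurable]: "u \<in> borel_measurable M" "B \<in> borel_measurable M" using u B by auto
  \<comment> \<open>Positive and negative parts are compared crosswise, because the negative part of
    \<open>u\<close> may have an infinite integral and must not be subtracted.\<close>
  have "?up + ?bm = (\<integral>\<^sup>+ x. e2ennreal (u x) + ennreal (- B x) \<partial>M)"
    by (subst nn_integral_add) auto
  also have "\<dots> \<le> (\<integral>\<^sup>+ x. ennreal (B x) + e2ennreal (- u x) \<partial>M)"
  proof (rule nn_integral_mono)
    fix x assume "x \<in> space M"
    from le[OF this] show "e2ennreal (u x) + ennreal (- B x) \<le> ennreal (B x) + e2ennreal (- u x)"
    proof (cases "u x")
      case (real r)
      then have "r \<le> B x" using le[OF \<open>x \<in> space M\<close>] by simp
      then have "ennreal r + ennreal (- B x) \<le> ennreal (B x) + ennreal (- r)"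
        by (cases "0 \<le> r"; cases "0 \<le> B x")
           (auto simp: ennreal_neg simp flip: ennreal_plus intro!: ennreal_leI)
      then show ?thesis by (simp add: real e2ennreal_ereal)
    next
      case PInf then show ?thesis using le[OF \<open>x \<in> space M\<close>] by simp
    next
      case MInf then show ?thesis by simp
    qed
  qed
  also have "\<dots> = ?bp + ?um"
    by (subst nn_integral_add) auto
  finally have *: "?up + ?bm \<le> ?bp + ?um" .
  have eqB: "ereal (integral\<^sup>L M B) = enn2ereal ?bp - enn2ereal ?bm"
    using ereal_integral_real[OF B] unfolding ereal_integral_def by (simp add: e2ennreal_ereal)
  obtain bp where bp: "?bp = ennreal bp" "bp \<ge> 0" using fin(1) by (cases ?bp) auto
  obtain bm where bm: "?bm = ennreal bm" "bm \<ge> 0" using fin(2) by (cases ?bm) auto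
  have "?up \<le> ?bp"
    by (rule nn_integral_mono) (use le in \<open>auto simp flip: e2ennreal_ereal intro!: e2ennreal_mono\<close>)
  then have "?up < \<infinity>" using fin(1) by auto
  then obtain up where up: "?up = ennreal up" "up \<ge> 0" by (cases ?up) auto
  show ?thesis
  proof (cases ?um)
    case (real um)
    have "up + bm \<le> bp + um"
      using * unfolding up(1) bp(1) bm(1) real(2)
      using up(2) bp(2) bm(2) real(1) by (simp flip: ennreal_plus)
    then show ?thesis
      unfolding eqB ereal_integral_def up(1) bp(1) bm(1) real(2)
      using up(2) bp(2) bm(2) real(1) by (simp add: enn2ereal_ennreal)
  next
    case top
    then show ?thesis unfolding ereal_integral_def top up(1) using up(2) by (simp add: enn2ereal_ennreal)
  qed
qed

lemma ereal_integral_arc_measure_le: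
  assumes "u \<in> borel_measurable borel" "continuous_on (sphere 0 1) B"
    "\<And>z. norm z = 1 \<Longrightarrow> u z \<le> ereal (B z)"
  shows "ereal_integral arc_measure u \<le> ereal (circle_mean B)"
  unfolding ereal_integral_arc_measure[OF assms(1)] circle_mean_def
  by (rule ereal_integral_le) (use assms in \<open>auto intro!: integrable_circ\<close>)

section \<open>A maximum principle for plurisubharmonic functions along discs\<close>

lemma ereal_add_real_le_iff: "(x::ereal) + ereal a \<le> ereal b \<longleftrightarrow> x \<le> ereal (b - a)"
  by (cases x) auto

lemma ereal_add_real_less_iff: "(x::ereal) + ereal a < ereal b \<longleftrightarrow> x < ereal (b - a)"
  by (cases x) auto

lemma plurisubharmonic_less_infty: "plurisubharmonic u \<Longrightarrow> u z < \<infinity>"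
  and plurisubharmonic_open: "plurisubharmonic u \<Longrightarrow> open {z. u z < c}"
  and plurisubharmonic_mean:
    "plurisubharmonic u \<Longrightarrow> u a \<le> ereal_integral arc_measure (\<lambda>\<zeta>. u (a + \<zeta> *s b))"
  by (auto simp: plurisubharmonic_def)

lemma norm_vector_smult: "norm (c *s v) = norm c * norm (v :: complex ^ 'm)"
  by (simp add: norm_vec_def L2_set_def norm_mult power_mult_distrib real_sqrt_mult flip: sum_distrib_left)

lemma continuous_on_vector_scalar_mult [continuous_intros]:
  fixes g :: "'a::topological_space \<Rightarrow> complex ^ 'n"
  assumes "continuous_on A f" "continuous_on A g"
  shows "continuous_on A (\<lambda>x. f x *s g x)"
  unfolding vector_scalar_mult_def by (intro continuous_intros assms)

lemma borel_measurable_usc: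
  fixes u :: "'a::topological_space \<Rightarrow> ereal"
  assumes "\<And>c. open {z. u z < c}"
  shows "u \<in> borel_measurable borel"
  by (rule borel_measurable_ereal_iff_Iio[THEN iffD2]) (use assms in \<open>auto simp: vimage_def\<close>)

lemma plurisubharmonic_le_circle_mean:
  assumes u: "plurisubharmonic u" and B: "continuous_on (sphere 0 1) B"
    and le: "\<And>\<zeta>. norm \<zeta> = 1 \<Longrightarrow> u (a + \<zeta> *s b) \<le> ereal (B \<zeta>)"
  shows "u a \<le> ereal (circle_mean B)"
proof -
  have "(\<lambda>\<zeta>. u (a + \<zeta> *s b)) \<in> borel_measurable borel"
    by (rule measurable_compose[OF _ borel_measurable_usc[OF plurisubharmonic_open[OF u]]])
       (intro borel_measurable_continuous_onI continuous_intros)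
  from ereal_integral_arc_measure_le[OF this B le] plurisubharmonic_mean[OF u, of a b]
  show ?thesis by (meson order_trans)
qed

text \<open>If no point were maximal, every \<open>x\<close> would have a better point
  \<open>Y x\<close> and a neighbourhood on which \<open>f\<close> stays below
  \<open>f (Y x)\<close>. Among finitely many such neighbourhoods covering \<open>K\<close>, the
  best \<open>Y x\<close> lies in one of them, whose bound is then better still.\<close>

lemma usc_attains_sup:
  fixes f :: "'a::topological_space \<Rightarrow> 'b::linorder"
  assumes K: "compact K" "K \<noteq> {}"
    and usc: "\<And>x c. x \<in> K \<Longrightarrow> f x < c \<Longrightarrow> \<exists>U. open U \<and> x \<in> U \<and> (\<forall>y\<in>U \<inter> K. f y < c)"
  shows "\<exists>x\<in>K. \<forall>y\<in>K. f y \<le> f x"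
proof (rule ccontr)
  assume "\<not> ?thesis"
  then have "\<forall>x\<in>K. \<exists>y\<in>K. f x < f y" by (meson not_le)
  then obtain Y where Y: "\<And>x. x \<in> K \<Longrightarrow> Y x \<in> K" "\<And>x. x \<in> K \<Longrightarrow> f x < f (Y x)" by metis
  then have "\<forall>x\<in>K. \<exists>U. open U \<and> x \<in> U \<and> (\<forall>y\<in>U \<inter> K. f y < f (Y x))"
    using usc by blast
  then obtain U where U: "\<And>x. x \<in> K \<Longrightarrow> open (U x)" "\<And>x. x \<in> K \<Longrightarrow> x \<in> U x"
    "\<And>x y. x \<in> K \<Longrightarrow> y \<in> U x \<Longrightarrow> y \<in> K \<Longrightarrow> f y < f (Y x)" by (metis Int_iff)
  have "K \<subseteq> (\<Union>x\<in>K. U x)" using U(2) by auto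
  then obtain D where D: "D \<subseteq> K" "finite D" "K \<subseteq> (\<Union>x\<in>D. U x)"
    using compactE_image[OF K(1), of K U] U(1) by blast
  then have "D \<noteq> {}" using K(2) by auto
  then have "Max ((\<lambda>z. f (Y z)) ` D) \<in> (\<lambda>z. f (Y z)) ` D"
    using D(2) by (intro Max_in) auto
  then obtain x where x: "x \<in> D" "Max ((\<lambda>z. f (Y z)) ` D) = f (Y x)" by blast
  then have x2: "f (Y z) \<le> f (Y x)" if "z \<in> D" for z
    using that D(2) Max_ge[of "(\<lambda>z. f (Y z)) ` D" "f (Y z)"] by simp
  obtain z where "z \<in> D" "Y x \<in> U z" using D Y(1) x(1) by blast
  then have "f (Y x) < f (Y z)" using U(3) D(1) Y(1) x(1) by blast
  with x2[OF \<open>z \<in> D\<close>] show False by simp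
qed

text \<open>
  Let \<open>x\<close> move along the line with direction \<open>deriv \<phi> t0\<close> while \<open>t\<close> moves along a small circle of
  radius \<open>\<rho>\<close>. In the bound all terms that are real parts of holomorphic functions average out,
  \<open>x - \<phi> t\<close> changes only by \<open>o(\<rho>)\<close>, and \<open>\<epsilon> * (norm t)\<^sup>2\<close> gains \<open>\<epsilon> * \<rho>\<^sup>2\<close>: a contradiction.
\<close>

lemma psh_no_strict_local_max:
  fixes u :: "complex ^ 'n \<Rightarrow> ereal"
  assumes psh: "plurisubharmonic u" and R: "R > 0" and K: "K \<ge> 0" and eps: "\<epsilon> > 0"
    and \<phi>: "\<And>i. (\<lambda>t. \<phi> t $ i) holomorphic_on ball t0 R"
    and g: "g holomorphic_on ball t0 R"
    and eq: "u x0 = ereal (C - Re (g t0) - \<epsilon> * (norm t0)\<^sup>2 + K * (norm (x0 - \<phi> t0))\<^sup>2)"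
    and le: "\<And>x t. dist x x0 < R \<Longrightarrow> dist t t0 < R \<Longrightarrow>
               u x \<le> ereal (C - Re (g t) - \<epsilon> * (norm t)\<^sup>2 + K * (norm (x - \<phi> t))\<^sup>2)"
  shows False
proof -
  define N where "N = real CARD('n)"
  have N: "N > 0" by (simp add: N_def)
  \<comment> \<open>The tolerance for the linearization of \<open>\<phi>\<close> is so small that
    the squared errors of all \<open>N\<close> coordinates, weighted by \<open>K\<close>, cost less
    than the gain \<open>\<epsilon>\<close>.\<close>
  define e where "e = sqrt (\<epsilon> / (2 * (K * N + 1)))"
  have KN: "K * N + 1 > 0" using K N by (simp add: add_nonneg_pos)
  have e: "e > 0" using eps KN by (simp add: e_def)
  have e2: "K * N * e\<^sup>2 < \<epsilon>"
  proof -
    have "e\<^sup>2 = \<epsilon> / (2 * (K * N + 1))" using eps KN by (simp add: e_def)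
    then have "K * N * e\<^sup>2 = \<epsilon> * ((K * N) / (2 * (K * N + 1)))" by simp
    also have "\<dots> < \<epsilon> * 1"
      using eps KN K N by (intro mult_strict_left_mono) (auto simp: field_simps add_nonneg_pos)
    finally show ?thesis by simp
  qed
  define y where "y = (\<chi> i. deriv (\<lambda>t. \<phi> t $ i) t0)"
  define d where "d = x0 - \<phi> t0"
  \<comment> \<open>Up to sign, the remainder of first order of \<open>\<phi>\<close> at
    \<open>t0\<close>. It is holomorphic in \<open>s\<close>, so the terms linear in it average out,
    and only its square is an error.\<close>
  define q where "q = (\<lambda>i s. \<phi> t0 $ i + s * y $ i - \<phi> (t0 + s) $ i)"
  have der: "((\<lambda>t. \<phi> t $ i) has_field_derivative y $ i) (at t0)" for i
    using holomorphic_derivI[OF \<phi>, of t0 i] R by (simp add: y_def)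
  have "\<exists>r>0. \<forall>s. norm s < r \<longrightarrow> norm (q i s) \<le> e * norm s" for i
  proof -
    from der[of i, unfolded has_field_derivative_def] e
    obtain r where r: "r > 0" "\<And>t. norm (t - t0) < r \<Longrightarrow> norm (\<phi> t $ i - \<phi> t0 $ i - y $ i * (t - t0)) \<le> e * norm (t - t0)"
      unfolding has_derivative_at_alt by blast
    then show ?thesis
      using r(2)[of "t0 + s" for s]
      by (intro exI[of _ r]) (auto simp: q_def norm_minus_commute algebra_simps)
  qed
  then obtain r where r: "\<And>i. r i > 0" "\<And>i s. norm s < r i \<Longrightarrow> norm (q i s) \<le> e * norm s" by metis
  define r0 where "r0 = Min (range r)"
  have r0: "r0 > 0" "\<And>i. r0 \<le> r i" using r(1) by (auto simp: r0_def)
  \<comment> \<open>The circle of \<open>t\<close> has radius \<open>\<rho>\<close> and that of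
    \<open>x\<close> has radius \<open>\<rho> * norm y\<close>; both must stay within
    \<open>R\<close>, and \<open>\<rho>\<close> below \<open>r0\<close> as well.\<close>
  define m where "m = min (min r0 R) (R / (norm y + 1))"
  define \<rho> where "\<rho> = m / 2"
  have ny: "norm y + 1 > 0" by (simp add: add_nonneg_pos)
  then have "m > 0" using r0 R by (simp add: m_def)
  then have "\<rho> > 0" "\<rho> < m" by (simp_all add: \<rho>_def)
  then have \<rho>: "\<rho> > 0" "\<rho> < r0" "\<rho> < R" "\<rho> * (norm y + 1) < R"
    using ny by (simp_all add: m_def pos_less_divide_eq)
  have \<rho>y: "\<rho> * norm y < R" using \<rho> by (smt (verit) mult_left_mono)
  \<comment> \<open>\<open>Re \<Lambda>\<close> collects the harmonic terms of the bound on the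
    circle. What is left over is \<open>\<epsilon> * \<rho>\<^sup>2\<close> and the squares of
    \<open>q\<close>; at 0 it is exactly the value of \<open>u x0\<close>.\<close>
  define \<Lambda> where "\<Lambda> = (\<lambda>\<zeta>. of_real C - g (t0 + of_real \<rho> * \<zeta>) - of_real (\<epsilon> * (norm t0)\<^sup>2)
      - of_real (2 * \<epsilon>) * cnj t0 * of_real \<rho> * \<zeta> + of_real (K * (norm d)\<^sup>2)
      + (\<Sum>i\<in>UNIV. of_real (2 * K) * cnj (d $ i) * q i (of_real \<rho> * \<zeta>)))"
  have holb: "(\<lambda>\<zeta>. h (t0 + of_real \<rho> * \<zeta>)) holomorphic_on ball 0 (R / \<rho>)"
    if "h holomorphic_on ball t0 R" for h
  proof (rule holomorphic_on_compose_gen[OF _ that, unfolded o_def])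
    show "(\<lambda>\<zeta>. t0 + of_real \<rho> * \<zeta>) ` ball 0 (R / \<rho>) \<subseteq> ball t0 R"
      using \<rho> by (auto simp: dist_norm norm_mult field_simps)
  qed (intro holomorphic_intros)
  have hol: "\<Lambda> holomorphic_on ball 0 (R / \<rho>)"
    unfolding \<Lambda>_def q_def by (intro holomorphic_intros holb g \<phi>)
  have "1 < R / \<rho>" using \<rho> by simp
  then have sub: "cball 0 1 \<subseteq> ball (0::complex) (R / \<rho>)" by (simp add: cball_subset_ball_iff)
  have "circle_mean (\<lambda>\<zeta>. Re (\<Lambda> \<zeta>)) = Re (\<Lambda> 0)"
    by (rule circle_mean_Re_holomorphic)
       (use sub hol in \<open>auto intro!: holomorphic_on_imp_continuous_on holomorphic_on_subset[OF hol]\<close>)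
  moreover have conL: "continuous_on (sphere 0 1) (\<lambda>\<zeta>. Re (\<Lambda> \<zeta>))"
    using sub by (intro continuous_intros holomorphic_on_imp_continuous_on holomorphic_on_subset[OF hol]) auto
  ultimately have mean: "circle_mean (\<lambda>\<zeta>. Re (\<Lambda> \<zeta>) - (\<epsilon> - K * N * e\<^sup>2) * \<rho>\<^sup>2) = Re (\<Lambda> 0) - (\<epsilon> - K * N * e\<^sup>2) * \<rho>\<^sup>2"
    by (subst circle_mean_diff) (auto intro!: continuous_intros)
  have bound: "u (x0 + \<zeta> *s (of_real \<rho> *s y)) \<le> ereal (Re (\<Lambda> \<zeta>) - (\<epsilon> - K * N * e\<^sup>2) * \<rho>\<^sup>2)" if \<zeta>: "norm \<zeta> = 1" for \<zeta>
  proof -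
    define s where "s = of_real \<rho> * \<zeta>"
    have ns: "norm s = \<rho>" using \<zeta> \<rho> by (simp add: s_def norm_mult)
    have eqv: "x0 + \<zeta> *s (of_real \<rho> *s y) = x0 + s *s y"
      by (simp add: s_def vec_eq_iff mult_ac)
    have d1: "dist (x0 + s *s y) x0 < R" using \<rho>y ns by (simp add: dist_norm norm_vector_smult)
    have d2: "dist (t0 + s) t0 < R" using ns \<rho> by (simp add: dist_norm)
    have qb: "(norm (q i s))\<^sup>2 \<le> e\<^sup>2 * \<rho>\<^sup>2" for i
    proof -
      have "norm (q i s) \<le> e * \<rho>" using r(2)[of s i] ns \<rho> r0(2)[of i] by simp
      then show ?thesis using power_mono[of "norm (q i s)" "e * \<rho>" 2] by (simp add: power_mult_distrib)
    qed
    have nsq: "(norm v)\<^sup>2 = (\<Sum>i\<in>UNIV. (norm (v $ i))\<^sup>2)" for v :: "complex ^ 'n"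
      by (simp add: norm_vec_def L2_set_def sum_nonneg)
    have expand: "(norm (a + b))\<^sup>2 = (norm a)\<^sup>2 + Re (2 * cnj a * b) + (norm b)\<^sup>2" for a b :: complex
      by (simp only: cmod_power2) (simp add: power2_eq_square algebra_simps)
    have "(norm (x0 + s *s y - \<phi> (t0 + s)))\<^sup>2 = (\<Sum>i\<in>UNIV. (norm (d $ i + q i s))\<^sup>2)"
      unfolding nsq by (intro sum.cong) (auto simp: d_def q_def algebra_simps)
    also have "\<dots> = (\<Sum>i\<in>UNIV. (norm (d $ i))\<^sup>2 + Re (2 * cnj (d $ i) * q i s) + (norm (q i s))\<^sup>2)"
      by (simp only: expand)
    also have "\<dots> \<le> (\<Sum>i\<in>UNIV. (norm (d $ i))\<^sup>2 + Re (2 * cnj (d $ i) * q i s) + e\<^sup>2 * \<rho>\<^sup>2)"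
      by (intro sum_mono add_left_mono qb)
    also have "\<dots> = (norm d)\<^sup>2 + Re (\<Sum>i\<in>UNIV. 2 * cnj (d $ i) * q i s) + N * e\<^sup>2 * \<rho>\<^sup>2"
      by (simp add: sum.distrib nsq[of d] N_def)
    finally have n1: "(norm (x0 + s *s y - \<phi> (t0 + s)))\<^sup>2 \<le> (norm d)\<^sup>2 + Re (\<Sum>i\<in>UNIV. 2 * cnj (d $ i) * q i s) + N * e\<^sup>2 * \<rho>\<^sup>2" .
    have n2: "(norm (t0 + s))\<^sup>2 = (norm t0)\<^sup>2 + Re (2 * cnj t0 * s) + \<rho>\<^sup>2"
      unfolding expand ns ..
    have "u (x0 + s *s y) \<le> ereal (C - Re (g (t0 + s)) - \<epsilon> * (norm (t0 + s))\<^sup>2 + K * (norm (x0 + s *s y - \<phi> (t0 + s)))\<^sup>2)"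
      by (rule le[OF d1 d2])
    also have "\<dots> \<le> ereal (C - Re (g (t0 + s)) - \<epsilon> * ((norm t0)\<^sup>2 + Re (2 * cnj t0 * s) + \<rho>\<^sup>2)
          + K * ((norm d)\<^sup>2 + Re (\<Sum>i\<in>UNIV. 2 * cnj (d $ i) * q i s) + N * e\<^sup>2 * \<rho>\<^sup>2))"
      unfolding n2 ereal_less_eq by (intro add_left_mono mult_left_mono n1 K)
    also have "\<dots> = ereal (Re (\<Lambda> \<zeta>) - (\<epsilon> - K * N * e\<^sup>2) * \<rho>\<^sup>2)"
    proof -
      have "Re (\<Sum>i\<in>UNIV. of_real (2 * K) * cnj (d $ i) * q i s) = K * Re (\<Sum>i\<in>UNIV. 2 * cnj (d $ i) * q i s)"
        by (simp add: sum_distrib_left algebra_simps)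
      moreover have "Re (of_real (2 * \<epsilon>) * cnj t0 * of_real \<rho> * \<zeta>) = \<epsilon> * Re (2 * cnj t0 * s)"
        by (simp add: s_def algebra_simps)
      ultimately show ?thesis
        unfolding \<Lambda>_def s_def[symmetric] by (simp add: algebra_simps)
    qed
    finally show ?thesis unfolding eqv .
  qed
  have "u x0 \<le> ereal (Re (\<Lambda> 0) - (\<epsilon> - K * N * e\<^sup>2) * \<rho>\<^sup>2)"
    unfolding mean[symmetric]
    by (rule plurisubharmonic_le_circle_mean[OF psh _ bound]) (intro continuous_intros conL)
  moreover have "Re (\<Lambda> 0) = C - Re (g t0) - \<epsilon> * (norm t0)\<^sup>2 + K * (norm (x0 - \<phi> t0))\<^sup>2"
    by (simp add: \<Lambda>_def q_def d_def flip: of_real_power)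
  ultimately have "(\<epsilon> - K * N * e\<^sup>2) * \<rho>\<^sup>2 \<le> 0" unfolding eq by simp
  moreover have "(\<epsilon> - K * N * e\<^sup>2) * \<rho>\<^sup>2 > 0" using e2 \<rho> by simp
  ultimately show False by simp
qed

text \<open>
  Plurisubharmonicity is defined by means over affine circles only. The graph of \<open>\<phi>\<close> is reached by
  maximizing \<open>u x + \<kappa> t + \<epsilon> * (norm t)\<^sup>2 - K * (norm (x - \<phi> t))\<^sup>2\<close> over all \<open>x\<close> and \<open>t\<close> and letting
  \<open>K\<close> tend to infinity.
\<close>

theorem psh_maximum_principle:
  fixes u :: "complex ^ 'n \<Rightarrow> ereal"
  assumes psh: "plurisubharmonic u" and S: "compact S" "open U" "S \<subseteq> U"
    and \<phi>: "\<And>i. (\<lambda>t. \<phi> t $ i) holomorphic_on U"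
    and \<kappa>: "continuous_on S \<kappa>"
    and harm: "\<And>t. t \<in> interior S \<Longrightarrow> \<exists>r>0. \<exists>g. g holomorphic_on ball t r \<and> (\<forall>s\<in>ball t r. \<kappa> s = Re (g s))"
    and fr: "\<And>t. t \<in> frontier S \<Longrightarrow> u (\<phi> t) + ereal (\<kappa> t) \<le> ereal A"
    and t1: "t1 \<in> S"
  shows "u (\<phi> t1) + ereal (\<kappa> t1) \<le> ereal A"
proof (rule ccontr)
  assume "\<not> ?thesis"
  then have neg: "ereal A < u (\<phi> t1) + ereal (\<kappa> t1)" by simp
  then obtain v1 where v1: "u (\<phi> t1) = ereal v1"
    using plurisubharmonic_less_infty[OF psh, of "\<phi> t1"] by (cases "u (\<phi> t1)") auto
  define gap where "gap = v1 + \<kappa> t1 - A"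
  have gap: "gap > 0" using neg by (simp add: gap_def v1)
  obtain R where R: "R > 0" "\<And>t. t \<in> S \<Longrightarrow> norm t \<le> R"
    using compact_imp_bounded[OF S(1)] unfolding bounded_pos by blast
  \<comment> \<open>The strictly subharmonic perturbation may use up less than the excess at
    \<open>t1\<close>, so the frontier values remain below the value \<open>L\<close> at
    \<open>t1\<close>.\<close>
  define \<epsilon> where "\<epsilon> = gap / (R\<^sup>2 + 1)"
  have R2: "R\<^sup>2 + 1 > 0" by (simp add: add_nonneg_pos)
  have eps: "\<epsilon> > 0" "\<epsilon> * R\<^sup>2 < gap"
    using gap R2 by (auto simp: \<epsilon>_def field_simps)
  define \<kappa>' where "\<kappa>' = (\<lambda>t. \<kappa> t + \<epsilon> * (norm t)\<^sup>2)"
  define L where "L = v1 + \<kappa>' t1"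
  have fr': "u (\<phi> t) + ereal (\<kappa>' t) < ereal L" if "t \<in> frontier S" for t
  proof -
    have "t \<in> S" using that compact_imp_closed[OF S(1)] frontier_subset_closed by blast
    have "u (\<phi> t) \<le> ereal (A - \<kappa> t)" using fr[OF that] by (simp add: ereal_add_real_le_iff)
    also have "\<epsilon> * (norm t)\<^sup>2 \<le> \<epsilon> * R\<^sup>2"
      using R(2)[OF \<open>t \<in> S\<close>] eps by (intro mult_left_mono power_mono) auto
    then have "A - \<kappa> t < L - \<kappa>' t"
      using eps(2) eps(1) unfolding L_def \<kappa>'_def gap_def by (smt (verit) zero_le_power2 mult_nonneg_nonneg)
    then have "ereal (A - \<kappa> t) < ereal (L - \<kappa>' t)" by simp
    finally show ?thesis by (simp add: ereal_add_real_less_iff)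
  qed
  have \<kappa>'c: "continuous_on S \<kappa>'" unfolding \<kappa>'_def by (intro continuous_intros \<kappa>)
  have \<phi>c: "continuous_on S \<phi>"
  proof -
    have "continuous_on S (\<lambda>t. \<chi> i. \<phi> t $ i)"
      by (intro continuous_intros holomorphic_on_imp_continuous_on holomorphic_on_subset[OF \<phi> S(3)])
    then show ?thesis by simp
  qed
  obtain B where B: "\<And>t. t \<in> S \<Longrightarrow> norm (\<phi> t) \<le> B"
    using compact_imp_bounded[OF compact_continuous_image[OF \<phi>c S(1)]] unfolding bounded_iff by (metis image_eqI)
  \<comment> \<open>The maximizers will approach the graph of \<open>\<phi>\<close>, where
    \<open>norm x \<le> B\<close>; the extra 1 finally makes them interior in
    \<open>x\<close>.\<close>
  define Q where "Q = cball (0::complex ^ 'n) (B + 1) \<times> S"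
  have Qc: "compact Q" unfolding Q_def by (intro compact_Times S(1)) simp
  have Q1: "(\<phi> t, t) \<in> Q" if "t \<in> S" for t using B[OF that] that by (simp add: Q_def)
  have Qne: "Q \<noteq> {}" using Q1[OF t1] by auto
  have usc: "\<exists>V. open V \<and> p \<in> V \<and> (\<forall>q\<in>V \<inter> Q. u (fst q) + ereal (k q) < ereal c)"
    if p: "p \<in> Q" "u (fst p) + ereal (k p) < ereal c" and k: "continuous_on Q k" for p k c
  proof -
    have "u (fst p) < ereal (c - k p)" using p by (simp add: ereal_add_real_less_iff)
    then obtain d where d: "u (fst p) < ereal d" "d < c - k p"
      using ereal_dense2 by (metis less_ereal.simps(1))
    have "open {z. u (fst (z :: (complex ^ 'n) \<times> complex)) < ereal d}"
      using open_vimage[OF plurisubharmonic_open[OF psh, of "ereal d"], of fst]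
      by (simp add: vimage_def continuous_on_fst continuous_on_id)
    moreover obtain W where W: "open W" "p \<in> W" "\<And>q. q \<in> W \<Longrightarrow> q \<in> Q \<Longrightarrow> k q < c - d"
      using k p(1) d(2) unfolding continuous_on_topological
      by (metis diff_less_eq less_diff_eq lessThan_iff open_lessThan add.commute)
    moreover have "u (fst q) + ereal (k q) < ereal c" if q: "q \<in> {z. u (fst z) < ereal d} \<inter> W \<inter> Q" for q
    proof -
      from q have "u (fst q) < ereal d" "ereal d < ereal (c - k q)" using W(3)[of q] by auto
      then have "u (fst q) < ereal (c - k q)" by (rule less_trans)
      then show "u (fst q) + ereal (k q) < ereal c" by (simp add: ereal_add_real_less_iff)
    qed
    ultimately show ?thesis using d W
      by (intro exI[of _ "{z. u (fst z) < ereal d} \<inter> W"]) blast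
  qed
  have usc': "\<exists>V. open V \<and> p \<in> V \<and> (\<forall>q\<in>V \<inter> Q. u (fst q) + ereal (k q) < c)"
    if p: "p \<in> Q" "u (fst p) + ereal (k p) < c" and k: "continuous_on Q k" for p k c
  proof -
    obtain c' where "u (fst p) + ereal (k p) < ereal c'" "ereal c' \<le> c"
      using ereal_dense2[OF p(2)] by (metis order_less_imp_le)
    with usc[OF p(1) this(1) k] show ?thesis by (metis order_less_le_trans)
  qed
  define pen where "pen = (\<lambda>K::nat. \<lambda>q. \<kappa>' (snd q) - K * (norm (fst q - \<phi> (snd q)))\<^sup>2)"
  have penc: "continuous_on Q (pen K)" for K
    unfolding pen_def Q_def
    by (intro continuous_intros continuous_on_compose2[OF \<kappa>'c] continuous_on_compose2[OF \<phi>c]) auto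
  define \<Psi> where "\<Psi> = (\<lambda>K q. u (fst q) + ereal (pen K q))"
  have "\<exists>p\<in>Q. \<forall>q\<in>Q. \<Psi> K q \<le> \<Psi> K p" for K
    unfolding \<Psi>_def by (intro usc_attains_sup[OF Qc Qne] usc' penc)
  then obtain p where p: "\<And>K. p K \<in> Q" "\<And>K q. q \<in> Q \<Longrightarrow> \<Psi> K q \<le> \<Psi> K (p K)" by metis
  have pS: "snd (p K) \<in> S" for K using p(1)[of K] by (auto simp: Q_def)
  have pL: "ereal L \<le> \<Psi> K (p K)" for K
    using p(2)[OF Q1[OF t1], of K] by (simp add: \<Psi>_def pen_def v1 L_def)
  have "\<exists>p\<in>Q. \<forall>q\<in>Q. u (fst q) + ereal 0 \<le> u (fst p) + ereal 0"
    by (intro usc_attains_sup[OF Qc Qne] usc') auto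
  then obtain p0 :: "(complex ^ 'n) \<times> complex" where p0: "\<And>q. q \<in> Q \<Longrightarrow> u (fst q) \<le> u (fst p0)"
    by auto
  obtain M0 where M0: "u (fst p0) \<le> ereal M0"
    using plurisubharmonic_less_infty[OF psh, of "fst p0"] by (cases "u (fst p0)") auto
  obtain M1 where M1: "\<And>t. t \<in> S \<Longrightarrow> \<kappa>' t \<le> M1"
    using compact_imp_bounded[OF compact_continuous_image[OF \<kappa>'c S(1)]]
    unfolding bounded_iff by (metis abs_le_D1 image_eqI real_norm_def)
  \<comment> \<open>The maximum is at least \<open>L\<close> for every \<open>K\<close>, since the
    penalty vanishes at \<open>(\<phi> t1, t1)\<close>. Hence the penalty is bounded and the
    distance to the graph tends to 0.\<close>
  have dist0: "K * (norm (fst (p K) - \<phi> (snd (p K))))\<^sup>2 \<le> M0 + M1 - L" for K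
  proof -
    have "ereal (L - pen K (p K)) \<le> u (fst (p K))"
      using pL[of K] by (cases "u (fst (p K))") (auto simp: \<Psi>_def)
    also have "\<dots> \<le> ereal M0" using p0[OF p(1)] M0 by (meson order_trans)
    finally have "L - pen K (p K) \<le> M0" by simp
    then show ?thesis using M1[OF pS[of K]] unfolding pen_def by linarith
  qed
  obtain l \<sigma> where l: "l \<in> Q" "strict_mono \<sigma>" "(p \<circ> \<sigma>) \<longlonglongrightarrow> l"
    using Qc p(1) unfolding compact_def by blast
  have lS: "snd l \<in> S" using l(1) by (auto simp: Q_def)
  have plim: "(\<lambda>n. p (\<sigma> n)) \<longlonglongrightarrow> l" using l(3) by (simp add: o_def)
  have fl: "(\<lambda>n. fst (p (\<sigma> n)) - \<phi> (snd (p (\<sigma> n)))) \<longlonglongrightarrow> fst l - \<phi> (snd l)"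
  proof (intro tendsto_diff tendsto_fst plim)
    show "(\<lambda>n. \<phi> (snd (p (\<sigma> n)))) \<longlonglongrightarrow> \<phi> (snd l)"
      using continuous_on_tendsto_compose[OF \<phi>c tendsto_snd[OF plim] lS] pS by auto
  qed
  have "(\<lambda>n. (norm (fst (p (\<sigma> n)) - \<phi> (snd (p (\<sigma> n)))))\<^sup>2) \<longlonglongrightarrow> 0"
  proof (rule tendsto_sandwich[OF _ _ tendsto_const])
    show "(\<lambda>n. (M0 + M1 - L) / real n) \<longlonglongrightarrow> 0" by (rule lim_const_over_n)
    have "(norm (fst (p (\<sigma> n)) - \<phi> (snd (p (\<sigma> n)))))\<^sup>2 \<le> (M0 + M1 - L) / real n" if "n \<ge> 1" for n
    proof -
      have "real n * (norm (fst (p (\<sigma> n)) - \<phi> (snd (p (\<sigma> n)))))\<^sup>2 \<le>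
            real (\<sigma> n) * (norm (fst (p (\<sigma> n)) - \<phi> (snd (p (\<sigma> n)))))\<^sup>2"
        using seq_suble[OF l(2), of n] by (intro mult_right_mono) auto
      also have "\<dots> \<le> M0 + M1 - L" by (rule dist0)
      finally show ?thesis using that by (simp add: field_simps)
    qed
    then show "\<forall>\<^sub>F n in sequentially. (norm (fst (p (\<sigma> n)) - \<phi> (snd (p (\<sigma> n)))))\<^sup>2 \<le> (M0 + M1 - L) / real n"
      by (auto simp: eventually_sequentially intro!: exI[of _ 1])
  qed auto
  then have "fst l - \<phi> (snd l) = 0"
    using LIMSEQ_unique tendsto_power[OF tendsto_norm[OF fl], of 2] by fastforce
  then have fstl: "fst l = \<phi> (snd l)" by simp
  \<comment> \<open>The frontier hypothesis concerns graph points only. It applies to the limit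
    \<open>l\<close>, and semicontinuity spreads it to maximizers near \<open>l\<close>, where it
    contradicts \<open>pL\<close>.\<close>
  have "snd l \<notin> frontier S"
  proof
    assume "snd l \<in> frontier S"
    from fr'[OF this] have less: "u (fst l) + ereal (\<kappa>' (snd l)) < ereal L" by (simp add: fstl)
    have "continuous_on Q (\<lambda>q. \<kappa>' (snd q))"
      unfolding Q_def by (intro continuous_intros continuous_on_compose2[OF \<kappa>'c]) auto
    from usc[where k = "\<lambda>q. \<kappa>' (snd q)", OF l(1) less this] obtain V where V: "open V" "l \<in> V"
      "\<And>q. q \<in> V \<Longrightarrow> q \<in> Q \<Longrightarrow> u (fst q) + ereal (\<kappa>' (snd q)) < ereal L"
      by auto
    then obtain n where "p (\<sigma> n) \<in> V" using topological_tendstoD[OF plim V(1,2)] by (auto simp: eventually_sequentially)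
    then have "u (fst (p (\<sigma> n))) + ereal (\<kappa>' (snd (p (\<sigma> n)))) < ereal L" using V(3) p(1) by blast
    moreover have "\<Psi> (\<sigma> n) (p (\<sigma> n)) \<le> u (fst (p (\<sigma> n))) + ereal (\<kappa>' (snd (p (\<sigma> n))))"
      unfolding \<Psi>_def pen_def by (intro add_left_mono) simp
    ultimately show False using pL[of "\<sigma> n"] by (meson leD order_trans)
  qed
  then have lint: "snd l \<in> interior S"
    using lS compact_imp_closed[OF S(1)] by (simp add: frontier_def)
  have "fst l \<in> ball 0 (B + 1)" using B[OF lS] by (simp add: fstl)
  then have "l \<in> ball 0 (B + 1) \<times> interior S" using lint by (simp add: mem_Times_iff)
  then obtain n where n: "p (\<sigma> n) \<in> ball 0 (B + 1) \<times> interior S"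
    using topological_tendstoD[OF plim, of "ball 0 (B + 1) \<times> interior S"] by (auto simp: open_Times eventually_sequentially)
  define K where "K = \<sigma> n"
  define x0 where "x0 = fst (p K)"
  define t0 where "t0 = snd (p K)"
  have x0: "x0 \<in> ball 0 (B + 1)" and t0: "t0 \<in> interior S" using n by (auto simp: x0_def t0_def K_def)
  obtain r g where r: "r > 0" "g holomorphic_on ball t0 r" "\<And>s. s \<in> ball t0 r \<Longrightarrow> \<kappa> s = Re (g s)"
    using harm[OF t0] by blast
  obtain r1 where r1: "r1 > 0" "ball t0 r1 \<subseteq> interior S" using t0 open_interior open_contains_ball by blast
  obtain r2 where r2: "r2 > 0" "ball x0 r2 \<subseteq> ball 0 (B + 1)" using x0 open_ball open_contains_ball by blast
  define r' where "r' = min r (min r1 r2)"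
  have r': "r' > 0" "ball t0 r' \<subseteq> ball t0 r" "ball t0 r' \<subseteq> interior S" "ball x0 r' \<subseteq> ball 0 (B + 1)"
    using r(1) r1 r2 by (auto simp: r'_def)
  obtain C where C: "\<Psi> K (x0, t0) = ereal C"
    using pL[of K] plurisubharmonic_less_infty[OF psh, of x0]
    by (cases "u x0") (auto simp: \<Psi>_def x0_def t0_def)
  show False
  proof (rule psh_no_strict_local_max[OF psh r'(1) _ eps(1), of "real K" \<phi> t0 g x0 C])
    have "ball t0 r' \<subseteq> U" using r'(3) interior_subset S(3) by blast
    then show "(\<lambda>t. \<phi> t $ i) holomorphic_on ball t0 r'" for i
      using holomorphic_on_subset[OF \<phi>] by blast
    show "g holomorphic_on ball t0 r'" using holomorphic_on_subset[OF r(2) r'(2)] .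
    show "u x0 = ereal (C - Re (g t0) - \<epsilon> * (norm t0)\<^sup>2 + real K * (norm (x0 - \<phi> t0))\<^sup>2)"
      using C r(3)[of t0] r(1) by (cases "u x0") (auto simp: \<Psi>_def pen_def \<kappa>'_def)
    fix x t assume xt: "dist x x0 < r'" "dist t t0 < r'"
    then have "x \<in> ball x0 r'" "t \<in> ball t0 r'" by (simp_all add: dist_commute)
    then have "x \<in> cball 0 (B + 1)" "t \<in> S"
      using r'(3,4) interior_subset[of S] ball_subset_cball[of 0 "B + 1"] by blast+
    then have "(x, t) \<in> Q" by (simp add: Q_def)
    from p(2)[OF this, of K] have "\<Psi> K (x, t) \<le> ereal C" using C by (simp add: x0_def t0_def)
    then show "u x \<le> ereal (C - Re (g t) - \<epsilon> * (norm t)\<^sup>2 + real K * (norm (x - \<phi> t))\<^sup>2)"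
      using r(3)[of t] xt(2) r'(2) by (auto simp: \<Psi>_def pen_def \<kappa>'_def ereal_add_real_le_iff dist_commute subset_iff algebra_simps)
  qed simp
qed

section \<open>Herglotz integrals\<close>

lemma has_field_derivative_quadratic_bound:
  fixes f :: "complex \<Rightarrow> complex"
  assumes "e > 0" "\<And>w. norm (w - z) < e \<Longrightarrow> norm (f w - f z - D * (w - z)) \<le> C * (norm (w - z))\<^sup>2"
  shows "(f has_field_derivative D) (at z)"
  unfolding has_field_derivative_def has_derivative_at_alt
proof (intro conjI allI impI bounded_linear_mult_right)
  fix e' :: real assume e': "e' > 0"
  define r where "r = min e (e' / (\<bar>C\<bar> + 1))"
  have r: "r > 0" "r \<le> e" "r * (\<bar>C\<bar> + 1) \<le> e'"
  proof -
    have C: "\<bar>C\<bar> + 1 > 0" by simp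
    then show "r > 0" "r \<le> e" using assms(1) e' by (simp_all add: r_def)
    have "r \<le> e' / (\<bar>C\<bar> + 1)" by (simp add: r_def)
    then show "r * (\<bar>C\<bar> + 1) \<le> e'" using C by (simp add: pos_le_divide_eq)
  qed
  show "\<exists>d>0. \<forall>y. norm (y - z) < d \<longrightarrow> norm (f y - f z - D * (y - z)) \<le> e' * norm (y - z)"
  proof (intro exI[of _ r] conjI allI impI r(1))
    fix w assume w: "norm (w - z) < r"
    have "norm (f w - f z - D * (w - z)) \<le> C * (norm (w - z))\<^sup>2"
      using assms(2)[of w] w r(2) by simp
    also have "\<dots> \<le> ((\<bar>C\<bar> + 1) * norm (w - z)) * norm (w - z)"
      unfolding power2_eq_square mult.assoc by (rule mult_right_mono) auto
    also have "\<dots> \<le> e' * norm (w - z)"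
    proof (rule mult_right_mono)
      have "(\<bar>C\<bar> + 1) * norm (w - z) \<le> (\<bar>C\<bar> + 1) * r" using w by (intro mult_left_mono) auto
      then show "(\<bar>C\<bar> + 1) * norm (w - z) \<le> e'" using r(3) by (simp add: mult.commute)
    qed simp
    finally show "norm (f w - f z - D * (w - z)) \<le> e' * norm (w - z)" .
  qed
qed

lemma Re_mult_real: "Re (a * complex_of_real x) = Re a * x"
  by simp

text \<open>The exponent in \<open>outer_function\<close>; its real part is the Poisson integral of
  \<open>k\<close>. It is also evaluated at points of the circle itself, provided that they keep a
  distance from the set where \<open>k\<close> is nonzero.\<close>

definition herglotz :: "(complex \<Rightarrow> real) \<Rightarrow> complex \<Rightarrow> complex" where
  "herglotz k z = (\<integral>\<zeta>. (\<zeta> + z) / (\<zeta> - z) * of_real (k \<zeta>) \<partial>arc_measure)"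

lemma AE_arc_norm: "AE \<zeta> in arc_measure. norm \<zeta> = 1"
  using AE_arc_measure_sphere by eventually_elim simp

lemma herglotz_kernel_integrable:
  assumes k: "integrable arc_measure k" and d: "d > 0"
    and away: "AE \<zeta> in arc_measure. k \<zeta> \<noteq> 0 \<longrightarrow> d \<le> norm (\<zeta> - z)"
  shows "integrable arc_measure (\<lambda>\<zeta>. (\<zeta> + z) / (\<zeta> - z) * of_real (k \<zeta>))"
proof (rule Bochner_Integration.integrable_bound)
  show "integrable arc_measure (\<lambda>\<zeta>. (1 + norm z) / d * norm (k \<zeta>))"
    using k by auto
  have [measurable]: "k \<in> borel_measurable borel"
    using borel_measurable_integrable[OF k] by (simp cong: measurable_cong_sets)
  show "(\<lambda>\<zeta>. (\<zeta> + z) / (\<zeta> - z) * of_real (k \<zeta>)) \<in> borel_measurable arc_measure"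
    by measurable
  show "AE \<zeta> in arc_measure. norm ((\<zeta> + z) / (\<zeta> - z) * of_real (k \<zeta>)) \<le> norm ((1 + norm z) / d * norm (k \<zeta>))"
    using away AE_arc_norm
  proof eventually_elim
    case (elim \<zeta>)
    show ?case
    proof (cases "k \<zeta> = 0")
      case False
      then have "d \<le> norm (\<zeta> - z)" using elim by auto
      moreover have "norm (\<zeta> + z) \<le> 1 + norm z" using norm_triangle_ineq[of \<zeta> z] elim by simp
      ultimately have "norm (\<zeta> + z) / norm (\<zeta> - z) \<le> (1 + norm z) / d"
        using d by (intro frac_le) auto
      from mult_right_mono[OF this, of "\<bar>k \<zeta>\<bar>"] show ?thesis using d
        by (simp add: norm_mult norm_divide abs_of_nonneg)
    qed simp
  qed
qed

text \<open>Differentiation under the integral by the exact quadratic remainder of the kernel. The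
  distance \<open>2 * d\<close> leaves distance \<open>d\<close> for all points \<open>w\<close>
  near \<open>z\<close>. Since \<open>z\<close> may lie on the circle, this yields differentiability
  across arcs on which \<open>k\<close> vanishes.\<close>

lemma herglotz_has_derivative:
  assumes k: "integrable arc_measure k" and d: "d > 0"
    and away: "AE \<zeta> in arc_measure. k \<zeta> \<noteq> 0 \<longrightarrow> 2 * d \<le> norm (\<zeta> - z)"
  shows "\<exists>D. (herglotz k has_field_derivative D) (at z)"
proof -
  have [measurable]: "k \<in> borel_measurable borel"
    using borel_measurable_integrable[OF k] by (simp cong: measurable_cong_sets)
  let ?D = "\<integral>\<zeta>. 2 * \<zeta> / (\<zeta> - z)\<^sup>2 * of_real (k \<zeta>) \<partial>arc_measure"
  have away': "AE \<zeta> in arc_measure. k \<zeta> \<noteq> 0 \<longrightarrow> d \<le> norm (\<zeta> - w)" if w: "norm (w - z) < d" for w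
    using away
  proof eventually_elim
    case (elim \<zeta>)
    have "norm (\<zeta> - z) \<le> norm (\<zeta> - w) + norm (w - z)" using norm_triangle_ineq[of "\<zeta> - w" "w - z"] by simp
    with elim w show ?case by auto
  qed
  have int: "integrable arc_measure (\<lambda>\<zeta>. (\<zeta> + w) / (\<zeta> - w) * of_real (k \<zeta>))" if "norm (w - z) < d" for w
    by (rule herglotz_kernel_integrable[OF k d away'[OF that]])
  have int0: "integrable arc_measure (\<lambda>\<zeta>. (\<zeta> + z) / (\<zeta> - z) * of_real (k \<zeta>))"
    using int[of z] d by simp
  have intD: "integrable arc_measure (\<lambda>\<zeta>. 2 * \<zeta> / (\<zeta> - z)\<^sup>2 * of_real (k \<zeta>))"
  proof (rule Bochner_Integration.integrable_bound)
    show "integrable arc_measure (\<lambda>\<zeta>. 2 / d\<^sup>2 * norm (k \<zeta>))" using k by auto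
    show "(\<lambda>\<zeta>. 2 * \<zeta> / (\<zeta> - z)\<^sup>2 * of_real (k \<zeta>)) \<in> borel_measurable arc_measure" by measurable
    show "AE \<zeta> in arc_measure. norm (2 * \<zeta> / (\<zeta> - z)\<^sup>2 * of_real (k \<zeta>)) \<le> norm (2 / d\<^sup>2 * norm (k \<zeta>))"
      using away AE_arc_norm
    proof eventually_elim
      case (elim \<zeta>)
      show ?case
      proof (cases "k \<zeta> = 0")
        case False
        then have "d \<le> norm (\<zeta> - z)" using elim d by auto
        then have "d\<^sup>2 \<le> (norm (\<zeta> - z))\<^sup>2" using d by (intro power_mono) auto
        then have "2 / (norm (\<zeta> - z))\<^sup>2 \<le> 2 / d\<^sup>2" using d by (intro frac_le) auto
        from mult_right_mono[OF this, of "\<bar>k \<zeta>\<bar>"] show ?thesis using elim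
          by (simp add: norm_mult norm_divide norm_power abs_mult)
      qed simp
    qed
  qed
  have "(herglotz k has_field_derivative ?D) (at z)"
  proof (rule has_field_derivative_quadratic_bound[OF d])
    fix w assume w: "norm (w - z) < d"
    have E: "herglotz k w - herglotz k z - ?D * (w - z) =
      (\<integral>\<zeta>. ((\<zeta> + w) / (\<zeta> - w) * of_real (k \<zeta>) - (\<zeta> + z) / (\<zeta> - z) * of_real (k \<zeta>)
         - 2 * \<zeta> / (\<zeta> - z)\<^sup>2 * of_real (k \<zeta>) * (w - z)) \<partial>arc_measure)"
      by (simp only: herglotz_def Bochner_Integration.integral_diff[OF Bochner_Integration.integrable_diff[OF int[OF w] int0] integrable_mult_left[OF intD]]
          Bochner_Integration.integral_diff[OF int[OF w] int0] integral_mult_left_zero)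
    have "norm (herglotz k w - herglotz k z - ?D * (w - z)) \<le> (\<integral>\<zeta>. norm ((\<zeta> + w) / (\<zeta> - w) * of_real (k \<zeta>) - (\<zeta> + z) / (\<zeta> - z) * of_real (k \<zeta>)
         - 2 * \<zeta> / (\<zeta> - z)\<^sup>2 * of_real (k \<zeta>) * (w - z)) \<partial>arc_measure)"
      unfolding E by (rule integral_norm_bound)
    also have "\<dots> \<le> (\<integral>\<zeta>. 2 / d ^ 3 * (norm (w - z))\<^sup>2 * norm (k \<zeta>) \<partial>arc_measure)"
    proof (rule integral_mono_AE)
      show "integrable arc_measure (\<lambda>\<zeta>. norm ((\<zeta> + w) / (\<zeta> - w) * of_real (k \<zeta>) - (\<zeta> + z) / (\<zeta> - z) * of_real (k \<zeta>)
         - 2 * \<zeta> / (\<zeta> - z)\<^sup>2 * of_real (k \<zeta>) * (w - z)))"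
        by (intro integrable_norm Bochner_Integration.integrable_diff integrable_mult_left int[OF w] int0 intD)
      show "integrable arc_measure (\<lambda>\<zeta>. 2 / d ^ 3 * (norm (w - z))\<^sup>2 * norm (k \<zeta>))"
        using k by (intro integrable_mult_right integrable_norm)
      show "AE \<zeta> in arc_measure. norm ((\<zeta> + w) / (\<zeta> - w) * of_real (k \<zeta>) - (\<zeta> + z) / (\<zeta> - z) * of_real (k \<zeta>)
         - 2 * \<zeta> / (\<zeta> - z)\<^sup>2 * of_real (k \<zeta>) * (w - z)) \<le> 2 / d ^ 3 * (norm (w - z))\<^sup>2 * norm (k \<zeta>)"
        using away away'[OF w] AE_arc_norm
      proof eventually_elim
        case (elim \<zeta>)
        show ?case
        proof (cases "k \<zeta> = 0")
          case False
          then have n: "d \<le> norm (\<zeta> - z)" "d \<le> norm (\<zeta> - w)" using elim d by auto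
          then have nz: "\<zeta> - z \<noteq> 0" "\<zeta> - w \<noteq> 0" using d by auto
          then have np: "0 < norm (\<zeta> - z)" "0 < norm (\<zeta> - w)" by simp_all
          have "(\<zeta> + w) / (\<zeta> - w) * of_real (k \<zeta>) - (\<zeta> + z) / (\<zeta> - z) * of_real (k \<zeta>)
             - 2 * \<zeta> / (\<zeta> - z)\<^sup>2 * of_real (k \<zeta>) * (w - z)
             = of_real (k \<zeta>) * (2 * \<zeta> * (w - z)\<^sup>2 / ((\<zeta> - w) * (\<zeta> - z)\<^sup>2))"
            using nz by (simp add: divide_simps) (simp add: power2_eq_square algebra_simps)
          also have "norm \<dots> = \<bar>k \<zeta>\<bar> * (2 * (norm (w - z))\<^sup>2 / (norm (\<zeta> - w) * (norm (\<zeta> - z))\<^sup>2))"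
            using elim by (simp add: norm_mult norm_divide norm_power)
          also have "\<dots> \<le> \<bar>k \<zeta>\<bar> * (2 * (norm (w - z))\<^sup>2 / (d * d\<^sup>2))"
            using n d np by (intro mult_left_mono divide_left_mono mult_mono power_mono mult_pos_pos zero_less_power) auto
          also have "\<dots> = 2 / d ^ 3 * (norm (w - z))\<^sup>2 * norm (k \<zeta>)"
            by (simp add: power2_eq_square power3_eq_cube mult_ac)
          finally show ?thesis .
        qed simp
      qed
    qed
    also have "\<dots> = (2 / d ^ 3 * (\<integral>\<zeta>. norm (k \<zeta>) \<partial>arc_measure)) * (norm (w - z))\<^sup>2"
      by simp
    finally show "norm (herglotz k w - herglotz k z - ?D * (w - z)) \<le> (2 / d ^ 3 * (\<integral>\<zeta>. norm (k \<zeta>) \<partial>arc_measure)) * (norm (w - z))\<^sup>2" .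
  qed
  then show ?thesis by blast
qed

lemma herglotz_away:
  assumes "norm z < 1"
  shows "AE \<zeta> in arc_measure. k \<zeta> \<noteq> 0 \<longrightarrow> 2 * ((1 - norm z) / 2) \<le> norm (\<zeta> - z)"
  using AE_arc_norm
proof eventually_elim
  case (elim \<zeta>)
  then show ?case using norm_triangle_ineq2[of \<zeta> z] by simp
qed

lemma herglotz_holomorphic:
  assumes "integrable arc_measure k"
  shows "herglotz k holomorphic_on ball 0 1"
proof -
  have "\<exists>D. (herglotz k has_field_derivative D) (at z)" if "norm z < 1" for z
    by (rule herglotz_has_derivative[OF assms _ herglotz_away[OF that]]) (use that in simp)
  then show ?thesis
    by (subst holomorphic_on_open) auto
qed

lemma herglotz_integrable:
  assumes "integrable arc_measure k" "norm z < 1"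
  shows "integrable arc_measure (\<lambda>\<zeta>. (\<zeta> + z) / (\<zeta> - z) * of_real (k \<zeta>))"
  by (rule herglotz_kernel_integrable[OF assms(1) _ herglotz_away[OF assms(2)]]) (use assms(2) in simp)

lemma Re_herglotz_kernel:
  assumes "norm \<zeta> = 1"
  shows "Re ((\<zeta> + z) / (\<zeta> - z)) = (1 - (norm z)\<^sup>2) / (norm (\<zeta> - z))\<^sup>2"
proof -
  have "(\<zeta> + z) / (\<zeta> - z) = (\<zeta> + z) * cnj (\<zeta> - z) / of_real ((norm (\<zeta> - z))\<^sup>2)"
    by (metis complex_div_cnj of_real_power)
  moreover have "Re ((\<zeta> + z) * cnj (\<zeta> - z)) = (norm \<zeta>)\<^sup>2 - (norm z)\<^sup>2"
    unfolding cmod_power2 by (simp add: power2_eq_square algebra_simps)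
  ultimately show ?thesis using assms by simp
qed

lemma integral_herglotz_kernel:
  assumes "norm z < 1"
  shows "(\<integral>\<zeta>. (\<zeta> + z) / (\<zeta> - z) \<partial>arc_measure) = 1"
proof -
  have "(\<integral>\<zeta>. (\<zeta> + z) / (\<zeta> - z) \<partial>arc_measure) = circle_mean (\<lambda>\<zeta>. (\<zeta> + z) / (\<zeta> - z))"
    by (rule integral_arc_measure) simp
  also have "\<dots> = circle_mean (\<lambda>\<zeta>. 2 * \<zeta> / (\<zeta> - z) - 1)"
  proof (rule circle_mean_cong)
    fix \<zeta> :: complex assume "norm \<zeta> = 1"
    then have "\<zeta> - z \<noteq> 0" using assms by auto
    then show "(\<zeta> + z) / (\<zeta> - z) = 2 * \<zeta> / (\<zeta> - z) - 1" by (simp add: field_simps)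
  qed
  also have "\<dots> = circle_mean (\<lambda>\<zeta>. 2 * \<zeta> / (\<zeta> - z)) - 1"
    using assms by (subst circle_mean_diff) (auto intro!: continuous_intros)
  also have "circle_mean (\<lambda>\<zeta>. 2 * \<zeta> / (\<zeta> - z)) = 2"
    using circle_mean_Cauchy[of "\<lambda>_. 2" z] assms by simp
  finally show ?thesis by simp
qed

lemma Re_herglotz:
  assumes "integrable arc_measure k" "norm z < 1"
  shows "Re (herglotz k z) = (\<integral>\<zeta>. (1 - (norm z)\<^sup>2) / (norm (\<zeta> - z))\<^sup>2 * k \<zeta> \<partial>arc_measure)"
    "integrable arc_measure (\<lambda>\<zeta>. (1 - (norm z)\<^sup>2) / (norm (\<zeta> - z))\<^sup>2 * k \<zeta>)"
proof -
  have [measurable]: "k \<in> borel_measurable borel"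
    using borel_measurable_integrable[OF assms(1)] by (simp cong: measurable_cong_sets)
  have ae: "AE \<zeta> in arc_measure. Re ((\<zeta> + z) / (\<zeta> - z) * of_real (k \<zeta>)) =
                (1 - (norm z)\<^sup>2) / (norm (\<zeta> - z))\<^sup>2 * k \<zeta>"
    using AE_arc_norm
    by eventually_elim (simp only: Re_complex_of_real Re_mult_real Re_herglotz_kernel)
  have "Re (herglotz k z) = (\<integral>\<zeta>. Re ((\<zeta> + z) / (\<zeta> - z) * of_real (k \<zeta>)) \<partial>arc_measure)"
    unfolding herglotz_def by (rule integral_Re[symmetric]) (rule herglotz_integrable[OF assms])
  also have "\<dots> = (\<integral>\<zeta>. (1 - (norm z)\<^sup>2) / (norm (\<zeta> - z))\<^sup>2 * k \<zeta> \<partial>arc_measure)"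
    by (rule integral_cong_AE[OF _ _ ae]) measurable
  finally show "Re (herglotz k z) = (\<integral>\<zeta>. (1 - (norm z)\<^sup>2) / (norm (\<zeta> - z))\<^sup>2 * k \<zeta> \<partial>arc_measure)" .
  show "integrable arc_measure (\<lambda>\<zeta>. (1 - (norm z)\<^sup>2) / (norm (\<zeta> - z))\<^sup>2 * k \<zeta>)"
    by (rule integrable_cong_AE_imp[OF integrable_Re[OF herglotz_integrable[OF assms]] _ ae]) measurable
qed

lemma Re_herglotz_0:
  assumes "integrable arc_measure k"
  shows "Re (herglotz k 0) = integral\<^sup>L arc_measure k"
proof -
  have "AE \<zeta> in arc_measure. (1 - (norm (0::complex))\<^sup>2) / (norm (\<zeta> - 0))\<^sup>2 * k \<zeta> = k \<zeta>"
    using AE_arc_norm by eventually_elim simp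
  moreover have "(\<lambda>\<zeta>. (1 - (norm (0::complex))\<^sup>2) / (norm (\<zeta> - 0))\<^sup>2 * k \<zeta>) \<in> borel_measurable arc_measure"
    using Re_herglotz(2)[OF assms, of 0] by auto
  ultimately have "(\<integral>\<zeta>. (1 - (norm (0::complex))\<^sup>2) / (norm (\<zeta> - 0))\<^sup>2 * k \<zeta> \<partial>arc_measure) = integral\<^sup>L arc_measure k"
    using assms by (intro integral_cong_AE) auto
  then show ?thesis
    using Re_herglotz(1)[OF assms, of 0] by simp
qed

lemma nn_integral_Poisson:
  assumes "norm z < 1"
  shows "(\<integral>\<^sup>+\<zeta>. ennreal ((1 - (norm z)\<^sup>2) / (norm (\<zeta> - z))\<^sup>2) \<partial>arc_measure) = 1"
proof -
  have z2: "(norm z)\<^sup>2 \<le> 1" using assms by (simp add: power_le_one)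
  have 1: "herglotz (\<lambda>_. 1) z = 1"
    unfolding herglotz_def using integral_herglotz_kernel[OF assms] by simp
  have i: "integrable arc_measure (\<lambda>_. 1::real)" by simp
  from Re_herglotz[OF i assms] 1
  have "(\<integral>\<zeta>. (1 - (norm z)\<^sup>2) / (norm (\<zeta> - z))\<^sup>2 \<partial>arc_measure) = 1"
    "integrable arc_measure (\<lambda>\<zeta>. (1 - (norm z)\<^sup>2) / (norm (\<zeta> - z))\<^sup>2)" by simp_all
  then show ?thesis
    using z2 by (subst nn_integral_eq_integral) auto
qed

text \<open>
  The bound does not depend on \<open>r\<close>: split \<open>k\<close> at a high level and use that the Poisson kernel
  is symmetric in \<open>\<zeta>\<close> and \<open>\<eta>\<close>.
\<close>

lemma Poisson_uniformly_integrable: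
  assumes k: "integrable arc_measure k" and eps: "\<epsilon> > 0"
  obtains \<delta> where "\<delta> > 0"
    "\<And>E r. E \<in> sets borel \<Longrightarrow> measure arc_measure E \<le> \<delta> \<Longrightarrow> 0 \<le> r \<Longrightarrow> r < 1 \<Longrightarrow>
       (\<integral>\<^sup>+\<zeta>. ennreal \<bar>Re (herglotz k (of_real r * \<zeta>))\<bar> * indicator E \<zeta> \<partial>arc_measure) \<le> ennreal \<epsilon>"
proof -
  have [measurable]: "k \<in> borel_measurable borel"
    using borel_measurable_integrable[OF k] by (simp cong: measurable_cong_sets)
  \<comment> \<open>The excess of the modulus of \<open>k\<close> over the level \<open>M\<close>.
    Its integral tends to 0, and taking the Poisson integral does not increase it.\<close>
  define k2 where "k2 = (\<lambda>M::nat. \<lambda>\<zeta>. max 0 (\<bar>k \<zeta>\<bar> - M))"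
  have [measurable]: "k2 M \<in> borel_measurable borel" for M unfolding k2_def by measurable
  have "(\<lambda>M. \<integral>\<zeta>. k2 M \<zeta> \<partial>arc_measure) \<longlonglongrightarrow> (\<integral>\<zeta>. 0 \<partial>arc_measure)"
  proof (rule integral_dominated_convergence[where w = "\<lambda>\<zeta>. \<bar>k \<zeta>\<bar>"])
    show "AE \<zeta> in arc_measure. (\<lambda>M. k2 M \<zeta>) \<longlonglongrightarrow> 0"
    proof (rule AE_I2, rule tendsto_eventually)
      fix \<zeta>
      obtain M0 :: nat where "\<bar>k \<zeta>\<bar> < M0" using reals_Archimedean2 by blast
      then show "\<forall>\<^sub>F M in sequentially. k2 M \<zeta> = 0"
        unfolding eventually_sequentially k2_def by (intro exI[of _ M0]) auto
    qed
    show "AE \<zeta> in arc_measure. norm (k2 M \<zeta>) \<le> \<bar>k \<zeta>\<bar>" for M by (auto simp: k2_def)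
  qed (use k in auto)
  then have "\<forall>\<^sub>F M in sequentially. (\<integral>\<zeta>. k2 M \<zeta> \<partial>arc_measure) < \<epsilon> / 2"
    using eps by (intro order_tendstoD) auto
  then obtain M where M: "(\<integral>\<zeta>. k2 M \<zeta> \<partial>arc_measure) < \<epsilon> / 2" by (auto simp: eventually_sequentially)
  have ik2: "integrable arc_measure (k2 M)"
    by (rule Bochner_Integration.integrable_bound[OF integrable_abs[OF k]]) (auto simp: k2_def)
  have nk2: "(\<integral>\<^sup>+\<zeta>. ennreal (k2 M \<zeta>) \<partial>arc_measure) \<le> ennreal (\<epsilon> / 2)"
    using M by (subst nn_integral_eq_integral[OF ik2]) (auto simp: k2_def intro!: ennreal_leI)
  show ?thesis
  \<comment> \<open>The part of \<open>k\<close> below the level contributes at most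
    \<open>M * measure arc_measure E\<close>, hence at most half of \<open>\<epsilon>\<close>; the
    summand 1 takes care of \<open>M = 0\<close>.\<close>
  proof (rule that[of "\<epsilon> / (2 * (M + 1))"])
    show "\<epsilon> / (2 * (M + 1)) > 0" using eps by simp
    fix E :: "complex set" and r :: real
    assume E[measurable]: "E \<in> sets borel" and mE: "measure arc_measure E \<le> \<epsilon> / (2 * (M + 1))" and r: "0 \<le> r" "r < 1"
    define p where "p = (\<lambda>\<zeta> \<eta> :: complex. (1 - r\<^sup>2) / (norm (\<eta> - of_real r * \<zeta>))\<^sup>2)"
    have [measurable]: "(\<lambda>(\<zeta>, \<eta>). p \<zeta> \<eta>) \<in> borel_measurable (borel \<Otimes>\<^sub>M borel)"
      unfolding p_def borel_prod split_beta
      by (intro borel_measurable_divide borel_measurable_continuous_onI continuous_intros)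
    have r2: "r\<^sup>2 \<le> 1" using r by (simp add: power_le_one)
    then have p0: "p \<zeta> \<eta> \<ge> 0" for \<zeta> \<eta> by (simp add: p_def)
    have sym: "p \<zeta> \<eta> = p \<eta> \<zeta>" if "norm \<zeta> = 1" "norm \<eta> = 1" for \<zeta> \<eta>
    proof -
      have "(norm (\<eta> - of_real r * \<zeta>))\<^sup>2 = (norm \<eta>)\<^sup>2 + r\<^sup>2 * (norm \<zeta>)\<^sup>2 - 2 * r * (Re \<eta> * Re \<zeta> + Im \<eta> * Im \<zeta>)" for \<zeta> \<eta>
        unfolding cmod_power2 by (simp add: power2_eq_square algebra_simps)
      then show ?thesis using that by (simp add: p_def mult.commute)
    qed
    have int1: "(\<integral>\<^sup>+\<eta>. ennreal (p \<zeta> \<eta>) \<partial>arc_measure) = 1" if "norm \<zeta> = 1" for \<zeta>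
      using nn_integral_Poisson[of "of_real r * \<zeta>"] r that by (simp add: p_def norm_mult)
    have "(\<integral>\<^sup>+\<zeta>. ennreal \<bar>Re (herglotz k (of_real r * \<zeta>))\<bar> * indicator E \<zeta> \<partial>arc_measure)
      \<le> (\<integral>\<^sup>+\<zeta>. ennreal M * indicator E \<zeta> + (\<integral>\<^sup>+\<eta>. ennreal (p \<zeta> \<eta>) * ennreal (k2 M \<eta>) \<partial>arc_measure) \<partial>arc_measure)"
    proof (rule nn_integral_mono_AE)
      show "AE \<zeta> in arc_measure. ennreal \<bar>Re (herglotz k (of_real r * \<zeta>))\<bar> * indicator E \<zeta> \<le>
         ennreal M * indicator E \<zeta> + (\<integral>\<^sup>+\<eta>. ennreal (p \<zeta> \<eta>) * ennreal (k2 M \<eta>) \<partial>arc_measure)"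
        using AE_arc_norm
      proof eventually_elim
        case (elim \<zeta>)
        have rz: "norm (of_real r * \<zeta>) < 1" using elim r by (simp add: norm_mult)
        have pe: "(1 - (norm (of_real r * \<zeta>))\<^sup>2) / (norm (\<eta> - of_real r * \<zeta>))\<^sup>2 = p \<zeta> \<eta>" for \<eta>
          using elim by (simp add: p_def norm_mult power_mult_distrib)
        note H = Re_herglotz[OF k rz, unfolded pe]
        have "ennreal \<bar>Re (herglotz k (of_real r * \<zeta>))\<bar> \<le> ennreal (\<integral>\<eta>. norm (p \<zeta> \<eta> * k \<eta>) \<partial>arc_measure)"
          unfolding H(1) using integral_norm_bound[of arc_measure "\<lambda>\<eta>. p \<zeta> \<eta> * k \<eta>"] by (intro ennreal_leI) simp
        also have "\<dots> = (\<integral>\<^sup>+\<eta>. ennreal (norm (p \<zeta> \<eta> * k \<eta>)) \<partial>arc_measure)"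
          by (rule nn_integral_eq_integral[symmetric]) (use H(2) in auto)
        also have "\<dots> \<le> (\<integral>\<^sup>+\<eta>. ennreal M * ennreal (p \<zeta> \<eta>) + ennreal (p \<zeta> \<eta>) * ennreal (k2 M \<eta>) \<partial>arc_measure)"
        proof (rule nn_integral_mono)
          fix \<eta>
          have "\<bar>k \<eta>\<bar> \<le> M + k2 M \<eta>" by (simp add: k2_def)
          from mult_left_mono[OF this p0[of \<zeta> \<eta>]]
          have "norm (p \<zeta> \<eta> * k \<eta>) \<le> M * p \<zeta> \<eta> + p \<zeta> \<eta> * k2 M \<eta>"
            using p0[of \<zeta> \<eta>] by (simp add: abs_mult algebra_simps)
          then show "ennreal (norm (p \<zeta> \<eta> * k \<eta>)) \<le> ennreal M * ennreal (p \<zeta> \<eta>) + ennreal (p \<zeta> \<eta>) * ennreal (k2 M \<eta>)"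
            using p0[of \<zeta> \<eta>]
            by (simp add: k2_def ennreal_leI flip: ennreal_mult ennreal_plus)
        qed
        also have "\<dots> = ennreal M * (\<integral>\<^sup>+\<eta>. ennreal (p \<zeta> \<eta>) \<partial>arc_measure) + (\<integral>\<^sup>+\<eta>. ennreal (p \<zeta> \<eta>) * ennreal (k2 M \<eta>) \<partial>arc_measure)"
          by (subst nn_integral_add, measurable, subst nn_integral_cmult, measurable)
        also have "\<dots> = ennreal M + (\<integral>\<^sup>+\<eta>. ennreal (p \<zeta> \<eta>) * ennreal (k2 M \<eta>) \<partial>arc_measure)"
          using int1[OF elim] by simp
        finally show ?case by (simp split: split_indicator)
      qed
    qed
    also have "\<dots> = ennreal M * emeasure arc_measure E + (\<integral>\<^sup>+\<zeta>. (\<integral>\<^sup>+\<eta>. ennreal (p \<zeta> \<eta>) * ennreal (k2 M \<eta>) \<partial>arc_measure) \<partial>arc_measure)"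
      by (subst nn_integral_add) (auto simp: nn_integral_cmult_indicator)
    also have "(\<integral>\<^sup>+\<zeta>. (\<integral>\<^sup>+\<eta>. ennreal (p \<zeta> \<eta>) * ennreal (k2 M \<eta>) \<partial>arc_measure) \<partial>arc_measure)
      = (\<integral>\<^sup>+\<eta>. (\<integral>\<^sup>+\<zeta>. ennreal (p \<zeta> \<eta>) * ennreal (k2 M \<eta>) \<partial>arc_measure) \<partial>arc_measure)"
    proof (rule pair_sigma_finite.Fubini')
      show "pair_sigma_finite arc_measure arc_measure"
        unfolding pair_sigma_finite_def using arc.sigma_finite_measure_axioms by blast
    qed measurable
    also have "\<dots> = (\<integral>\<^sup>+\<eta>. ennreal (k2 M \<eta>) \<partial>arc_measure)"
    proof (rule nn_integral_cong_AE)
      show "AE \<eta> in arc_measure. (\<integral>\<^sup>+\<zeta>. ennreal (p \<zeta> \<eta>) * ennreal (k2 M \<eta>) \<partial>arc_measure) = ennreal (k2 M \<eta>)"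
        using AE_arc_norm
      proof eventually_elim
        case (elim \<eta>)
        have "(\<integral>\<^sup>+\<zeta>. ennreal (p \<zeta> \<eta>) \<partial>arc_measure) = (\<integral>\<^sup>+\<zeta>. ennreal (p \<eta> \<zeta>) \<partial>arc_measure)"
          by (rule nn_integral_cong_AE) (use AE_arc_norm in \<open>eventually_elim, use sym elim in auto\<close>)
        then show ?case using int1[OF elim] by (subst nn_integral_multc) auto
      qed
    qed
    also have "ennreal M * emeasure arc_measure E + \<dots> \<le> ennreal (M * (\<epsilon> / (2 * (M + 1)))) + ennreal (\<epsilon> / 2)"
    proof (rule add_mono[OF _ nk2])
      show "ennreal M * emeasure arc_measure E \<le> ennreal (M * (\<epsilon> / (2 * (M + 1))))"
        unfolding arc.emeasure_eq_measure ennreal_mult''[OF measure_nonneg, symmetric]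
        by (intro ennreal_leI mult_left_mono mE) simp
    qed
    also have "\<dots> \<le> ennreal \<epsilon>"
    proof -
      have "M * (\<epsilon> / (2 * (M + 1))) \<le> \<epsilon> / 2" using eps by (simp add: field_simps)
      then have "M * (\<epsilon> / (2 * (M + 1))) + \<epsilon> / 2 \<le> \<epsilon>" by linarith
      moreover have "0 \<le> M * (\<epsilon> / (2 * (M + 1)))" using eps by simp
      ultimately show ?thesis using eps
        by (metis ennreal_leI ennreal_plus half_gt_zero less_imp_le)
    qed
    finally show "(\<integral>\<^sup>+\<zeta>. ennreal \<bar>Re (herglotz k (of_real r * \<zeta>))\<bar> * indicator E \<zeta> \<partial>arc_measure) \<le> ennreal \<epsilon>" .
  qed
qed

section \<open>Lelong functions along discs in projective space\<close>

lemma proj_rel_refl: "v \<noteq> 0 \<Longrightarrow> proj_rel v v"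
  by (auto simp: proj_rel_def vec_eq_iff intro!: exI[of _ 1])

lemma in_chart_proj_of [simp]: "v \<noteq> 0 \<Longrightarrow> in_chart i (proj_of v) \<longleftrightarrow> v $ i \<noteq> 0"
  by (rule in_chart.abs_eq[OF proj_rel_refl])

lemma chart_coord_proj_of [simp]: "v \<noteq> 0 \<Longrightarrow> chart_coord i j (proj_of v) = v $ j / v $ i"
  by (rule chart_coord.abs_eq[OF proj_rel_refl])

lemma proj_of_eq_iff:
  assumes "v \<noteq> 0" "w \<noteq> 0"
  shows "proj_of v = proj_of w \<longleftrightarrow> (\<exists>c. c \<noteq> 0 \<and> w = c *s v)"
proof -
  have "proj_of v = proj_of w \<longleftrightarrow> proj_rel v w"
    using Quotient_rel[OF Quotient_proj, of v w] proj_rel_refl assms by blast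
  then show ?thesis using assms by (simp add: proj_rel_def)
qed

definition homogenize :: "complex ^ 'n \<Rightarrow> complex ^ 'n option" where
  "homogenize z = (\<chi> i. case i of None \<Rightarrow> 1 | Some j \<Rightarrow> z $ j)"

text \<open>Only meaningful if \<open>w $ None \<noteq> 0\<close>; otherwise it is \<open>0\<close>.\<close>

definition affine_part :: "complex ^ 'n option \<Rightarrow> complex ^ 'n" where
  "affine_part w = (\<chi> i. w $ Some i / w $ None)"

lemma homogenize_None [simp]: "homogenize z $ None = 1" and homogenize_Some [simp]: "homogenize z $ Some i = z $ i"
  by (auto simp: homogenize_def)

lemma homogenize_nonzero [simp]: "homogenize z \<noteq> 0"
proof
  assume "homogenize z = 0"
  then have "homogenize z $ None = 0" by simp
  then show False by simp
qed

lemma affine_embed_homogenize: "affine_embed z = proj_of (homogenize z)"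
  by (simp add: affine_embed_def homogenize_def)

lemma affine_part_homogenize [simp]: "affine_part (homogenize z) = z"
  by (simp add: affine_part_def vec_eq_iff)

lemma affine_part_scale [simp]: "c \<noteq> 0 \<Longrightarrow> affine_part (c *s w) = affine_part w"
  by (simp add: affine_part_def vec_eq_iff)

lemma homogenize_affine_part: "w $ None \<noteq> 0 \<Longrightarrow> w = (w $ None) *s homogenize (affine_part w)"
  by (auto simp: affine_part_def homogenize_def vec_eq_iff split: option.splits)

lemma proj_of_eq_affine_embed_iff:
  fixes w :: "complex ^ 'n::finite option"
  assumes "w \<noteq> 0"
  shows "proj_of w = affine_embed z \<longleftrightarrow> w $ None \<noteq> 0 \<and> affine_part w = z"
proof
  assume "proj_of w = affine_embed z"
  then have "proj_of (homogenize z) = proj_of w" by (simp add: affine_embed_homogenize)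
  then obtain c where "c \<noteq> 0" "w = c *s homogenize z"
    using proj_of_eq_iff[OF homogenize_nonzero assms] by auto
  then show "w $ None \<noteq> 0 \<and> affine_part w = z" by simp
next
  assume w: "w $ None \<noteq> 0 \<and> affine_part w = z"
  then have "proj_of (homogenize z) = proj_of w"
    unfolding proj_of_eq_iff[OF homogenize_nonzero assms] using homogenize_affine_part[of w] by blast
  then show "proj_of w = affine_embed z" by (simp add: affine_embed_homogenize)
qed

lemma proj_of_eq_imp:
  assumes "v \<noteq> 0" "w \<noteq> 0" "proj_of v = proj_of w"
  shows "v $ None = 0 \<longleftrightarrow> w $ None = 0" "affine_part v = affine_part w"
proof -
  obtain c where "c \<noteq> 0" "w = c *s v" using assms proj_of_eq_iff by blast
  then show "v $ None = 0 \<longleftrightarrow> w $ None = 0" "affine_part v = affine_part w" by simp_all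
qed

lemma norm_affine_part:
  "norm (affine_part w) * norm (w $ None) \<le> norm w"
proof (cases "w $ None = 0")
  case False
  have "norm (affine_part w) = sqrt (\<Sum>i\<in>UNIV. (norm (w $ Some i))\<^sup>2) / norm (w $ None)"
    by (simp add: norm_vec_def L2_set_def affine_part_def norm_divide power_divide real_sqrt_divide flip: sum_divide_distrib)
  then have "norm (affine_part w) * norm (w $ None) = sqrt (\<Sum>i\<in>UNIV. (norm (w $ Some i))\<^sup>2)"
    using False by simp
  also have "(\<Sum>i\<in>UNIV. (norm (w $ Some i))\<^sup>2) = (\<Sum>i\<in>range Some. (norm (w $ i))\<^sup>2)"
    by (subst sum.reindex) auto
  also have "sqrt \<dots> \<le> sqrt (\<Sum>i\<in>UNIV. (norm (w $ i))\<^sup>2)"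
    by (intro real_sqrt_le_mono sum_mono2) auto
  also have "\<dots> = norm w" by (simp add: norm_vec_def L2_set_def)
  finally show ?thesis .
qed simp

lemma continuous_on_affine_part:
  assumes "continuous_on A f" "\<And>x. x \<in> A \<Longrightarrow> f x $ None \<noteq> 0"
  shows "continuous_on A (\<lambda>x. affine_part (f x))"
  unfolding affine_part_def using assms by (intro continuous_intros) auto

lemma tendsto_affine_part:
  assumes "(f \<longlongrightarrow> w) F" "w $ None \<noteq> 0"
  shows "((\<lambda>x. affine_part (f x)) \<longlongrightarrow> affine_part w) F"
  unfolding affine_part_def by (intro tendsto_intros assms)

lemma vec_continuous_on:
  fixes F :: "'a::topological_space \<Rightarrow> complex ^ 'm"
  assumes "\<And>i. continuous_on A (\<lambda>t. F t $ i)"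
  shows "continuous_on A F"
  using continuous_on_vec_lambda[of A "\<lambda>i t. F t $ i"] assms by simp

text \<open>The left-hand side is the logarithmically homogeneous function associated with
  \<open>u\<close>. Adding \<open>ln (norm (w $ None))\<close> to \<open>ln (max 1 (norm x))\<close>
  gives the logarithm of the larger of the norms of the zeroth and of the remaining coordinates, so
  the pole at the hyperplane at infinity cancels.\<close>

lemma lelong_growth_homogeneous:
  fixes u :: "complex ^ 'n \<Rightarrow> ereal"
  assumes growth: "\<And>x. u x \<le> ereal (ln (max 1 (norm x)) + C)"
    and w: "norm w \<le> M" "w $ None \<noteq> 0"
  shows "u (affine_part w) + ereal (ln (norm (w $ None))) \<le> ereal (ln M + C)"
proof -
  have wN: "norm (w $ None) \<le> M"
    using w(1) Finite_Cartesian_Product.norm_nth_le[of w None] by (meson order_trans)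
  have "max 1 (norm (affine_part w)) * norm (w $ None) \<le> M"
    using wN w(1) norm_affine_part[of w] by (auto simp: max_def)
  moreover have "0 < max 1 (norm (affine_part w)) * norm (w $ None)"
    using w(2) by (simp add: less_max_iff_disj)
  ultimately have "ln (max 1 (norm (affine_part w)) * norm (w $ None)) \<le> ln M"
    by (intro ln_mono) auto
  then have "ln (max 1 (norm (affine_part w))) + ln (norm (w $ None)) \<le> ln M"
    using w ln_mult[of "max 1 (norm (affine_part w))" "norm (w $ None)"]
    by (auto simp: max_def split: if_splits)
  then have "ln (max 1 (norm (affine_part w))) + C \<le> ln M + C - ln (norm (w $ None))" by simp
  with growth[of "affine_part w"] show ?thesis
    unfolding ereal_add_real_le_iff by (meson ereal_less_eq(3) order_trans)
qed

text \<open>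
  At the poles of \<open>affine_part \<circ> F\<close> the left-hand side is only known to be bounded above; a small
  multiple of \<open>ln (norm (F t $ None))\<close> is added so that they can be cut out.
\<close>

lemma lelong_circle_bound:
  fixes u :: "complex ^ 'n \<Rightarrow> ereal" and F :: "complex \<Rightarrow> complex ^ 'n option"
  assumes psh: "plurisubharmonic u"
    and growth: "\<And>x. u x \<le> ereal (ln (max 1 (norm x)) + C)"
    and hol: "\<And>i. (\<lambda>t. F t $ i) holomorphic_on ball 0 1"
    and M: "\<And>t. norm t < 1 \<Longrightarrow> norm (F t) \<le> M"
    and F0: "F 0 $ None \<noteq> 0" and r: "0 < r" "r < 1"
    and b: "continuous_on (sphere 0 1) b"
    and le: "\<And>\<zeta>. norm \<zeta> = 1 \<Longrightarrow> F (of_real r * \<zeta>) $ None \<noteq> 0 \<Longrightarrow>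
       u (affine_part (F (of_real r * \<zeta>))) + ereal (ln (norm (F (of_real r * \<zeta>) $ None))) \<le> ereal (b \<zeta>)"
  shows "u (affine_part (F 0)) + ereal (ln (norm (F 0 $ None))) \<le> ereal (circle_mean b)"
proof -
  have FN: "norm (F t $ None) \<le> M" if "norm t < 1" for t
    using M[OF that] Finite_Cartesian_Product.norm_nth_le[of "F t" None] by (meson order_trans)
  have Mpos: "M > 0" using FN[of 0] F0 by (smt (verit) norm_zero zero_less_norm_iff)
  have growthF: "u (affine_part (F t)) + ereal (ln (norm (F t $ None))) \<le> ereal (ln M + C)"
    if "norm t < 1" "F t $ None \<noteq> 0" for t
    by (rule lelong_growth_homogeneous[OF growth M[OF that(1)] that(2)])
  have approx: "u (affine_part (F 0)) + ereal (ln (norm (F 0 $ None))) \<le>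
      ereal (circle_mean b + \<epsilon> * (2 + ln M - ln (norm (F 0 $ None))))" if eps: "\<epsilon> > 0" for \<epsilon>
  proof -
    obtain P where P: "P holomorphic_on UNIV" "\<And>z. norm z = 1 \<Longrightarrow> \<bar>Re (P z) - b z\<bar> < \<epsilon>"
      using Re_entire_approximation[OF b eps] by blast
    \<comment> \<open>The added \<open>\<epsilon>\<close> turns the approximation of
      \<open>b\<close> into a majorant that is harmonic in the disc.\<close>
    define q where "q = (\<lambda>t. Re (P (t / of_real r)) + \<epsilon>)"
    have Pc: "continuous_on A P" for A
      using P(1) by (meson holomorphic_on_imp_continuous_on holomorphic_on_subset subset_UNIV)
    have qc: "continuous_on A q" for A
      unfolding q_def using r by (intro continuous_intros continuous_on_compose2[OF Pc[of UNIV]]) auto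
    obtain B where B: "\<And>t. norm t \<le> r \<Longrightarrow> \<bar>q t\<bar> \<le> B"
      using compact_imp_bounded[OF compact_continuous_image[OF qc[of "cball 0 r"] compact_cball]]
      unfolding bounded_iff by (metis image_eqI mem_cball_0 real_norm_def)
    \<comment> \<open>The set with zeroth coordinate below \<open>\<eta>\<close> in modulus is
      removed. The exponent is chosen so that on its edge \<open>\<epsilon> * ln \<eta>\<close>
      outweighs the growth bound \<open>ln M + C\<close> together with \<open>B\<close>; the other
      entry keeps the centre inside.\<close>
    define \<eta> where "\<eta> = min (norm (F 0 $ None) / 2) (exp ((\<epsilon> * ln M - C - ln M - B) / \<epsilon>))"
    have \<eta>: "0 < \<eta>" "\<eta> < norm (F 0 $ None)" using F0 by (auto simp: \<eta>_def min_less_iff_disj)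
    have "ln \<eta> \<le> (\<epsilon> * ln M - C - ln M - B) / \<epsilon>"
      using \<eta>(1) by (metis \<eta>_def ln_exp ln_le_cancel_iff exp_gt_zero min.cobounded2)
    then have \<eta>2: "\<epsilon> * ln \<eta> \<le> \<epsilon> * ln M - C - ln M - B" using eps by (simp add: field_simps)
    define U where "U = {t \<in> ball 0 1. F t $ None \<noteq> 0}"
    define S where "S = {t \<in> cball 0 r. \<eta> \<le> norm (F t $ None)}"
    have cF: "continuous_on (ball 0 1) (\<lambda>t. F t $ i)" for i
      by (rule holomorphic_on_imp_continuous_on[OF hol])
    have oU: "open U"
    proof -
      have "open (ball 0 1 \<inter> (\<lambda>t. F t $ None) -` (- {0}))"
        by (rule continuous_open_preimage[OF cF]) auto
      moreover have "U = ball 0 1 \<inter> (\<lambda>t. F t $ None) -` (- {0})" by (auto simp: U_def)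
      ultimately show ?thesis by metis
    qed
    have cFr: "continuous_on (cball 0 r) (\<lambda>t. norm (F t $ None))"
      using r by (intro continuous_intros continuous_on_subset[OF cF]) auto
    have cS: "compact S"
    proof -
      have "closed (cball 0 r \<inter> (\<lambda>t. norm (F t $ None)) -` {\<eta>..})"
        by (rule continuous_closed_preimage[OF cFr]) auto
      moreover have "S = cball 0 r \<inter> (cball 0 r \<inter> (\<lambda>t. norm (F t $ None)) -` {\<eta>..})" by (auto simp: S_def)
      ultimately show ?thesis by (metis compact_Int_closed compact_cball)
    qed
    have SU: "S \<subseteq> U" using \<eta> r by (auto simp: S_def U_def)
    have interior: "t \<in> interior S" if "norm t < r" "\<eta> < norm (F t $ None)" for t
    proof -
      have "open (ball 0 r \<inter> (\<lambda>t. norm (F t $ None)) -` {\<eta><..})"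
        by (rule continuous_open_preimage) (auto intro: continuous_on_subset[OF cFr])
      moreover have "ball 0 r \<inter> (\<lambda>t. norm (F t $ None)) -` {\<eta><..} \<subseteq> S" by (auto simp: S_def)
      ultimately show ?thesis using that by (auto intro: interiorI)
    qed
    define \<kappa> where "\<kappa> = (\<lambda>t. (1 + \<epsilon>) * ln (norm (F t $ None)) - q t)"
    have main: "u (affine_part (F 0)) + ereal (\<kappa> 0) \<le> ereal (\<epsilon> * ln M)"
    proof (rule psh_maximum_principle[OF psh cS oU SU])
      show "(\<lambda>t. affine_part (F t) $ i) holomorphic_on U" for i
      proof -
        have "(\<lambda>t. F t $ Some i / F t $ None) holomorphic_on U"
          by (intro holomorphic_intros holomorphic_on_subset[OF hol]) (auto simp: U_def)
        then show ?thesis by (simp add: affine_part_def)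
      qed
      show "continuous_on S \<kappa>"
        unfolding \<kappa>_def using \<eta> r
        by (intro continuous_intros qc continuous_on_subset[OF cF]) (auto simp: S_def)
      show "\<exists>d>0. \<exists>g. g holomorphic_on ball t d \<and> (\<forall>s\<in>ball t d. \<kappa> s = Re (g s))" if "t \<in> interior S" for t
      proof -
        have "t \<in> U" using that SU interior_subset by blast
        then obtain d where d: "d > 0" "ball t d \<subseteq> U" using oU open_contains_ball by blast
        have h: "(\<lambda>t. F t $ None) holomorphic_on ball t d"
          by (rule holomorphic_on_subset[OF hol]) (use d in \<open>auto simp: U_def\<close>)
        have nz: "F x $ None \<noteq> 0" if "x \<in> ball t d" for x using d that by (auto simp: U_def)
        have tb: "t \<in> ball t d" using d by simp
        obtain g where g: "g holomorphic_on ball t d" "\<And>x. x \<in> ball t d \<Longrightarrow> exp (g x) = F x $ None"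
          using holomorphic_logarithm_exists[OF convex_ball open_ball h nz tb] by metis
        have "\<kappa> s = Re (of_real (1 + \<epsilon>) * g s - P (s / of_real r) - of_real \<epsilon>)" if "s \<in> ball t d" for s
          by (simp add: \<kappa>_def q_def norm_exp_eq_Re flip: g(2)[OF that])
        moreover have "(\<lambda>s. P (s / of_real r)) holomorphic_on ball t d"
          by (rule holomorphic_on_compose_gen[OF _ P(1), unfolded o_def]) (auto intro!: holomorphic_intros simp: r)
        then have "(\<lambda>s. of_real (1 + \<epsilon>) * g s - P (s / of_real r) - of_real \<epsilon>) holomorphic_on ball t d"
          by (intro holomorphic_intros g)
        ultimately show ?thesis using d(1) by blast
      qed
      show "u (affine_part (F t)) + ereal (\<kappa> t) \<le> ereal (\<epsilon> * ln M)" if t: "t \<in> frontier S" for t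
      proof -
        have "t \<in> S" using t compact_imp_closed[OF cS] frontier_subset_closed by blast
        then have tS: "norm t \<le> r" "\<eta> \<le> norm (F t $ None)" by (auto simp: S_def)
        then have t1: "norm t < 1" and nz: "F t $ None \<noteq> 0" using r \<eta> by auto
        have "t \<notin> interior S" using t by (simp add: frontier_def)
        then consider "norm (F t $ None) = \<eta>" | "norm t = r" using interior[of t] tS by fastforce
        then show ?thesis
        proof cases
          case 1
          have "u (affine_part (F t)) \<le> ereal (ln M + C - ln \<eta>)"
            using growthF[OF t1 nz] 1 by (simp add: ereal_add_real_le_iff)
          also have "ln M + C - ln \<eta> \<le> \<epsilon> * ln M - \<kappa> t"
            using \<eta>2 B[OF tS(1)] unfolding \<kappa>_def 1 by (simp add: algebra_simps)
          finally show ?thesis by (simp add: ereal_add_real_le_iff)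
        next
          case 2
          define \<zeta> where "\<zeta> = t / of_real r"
          have z: "norm \<zeta> = 1" "t = of_real r * \<zeta>" using 2 r by (auto simp: \<zeta>_def norm_divide)
          have "u (affine_part (F t)) \<le> ereal (b \<zeta> - ln (norm (F t $ None)))"
            using le[OF z(1)] nz unfolding z(2)[symmetric] by (simp add: ereal_add_real_le_iff)
          also have "b \<zeta> - ln (norm (F t $ None)) \<le> \<epsilon> * ln M - \<kappa> t"
          proof -
            have "b \<zeta> \<le> q t" using P(2)[OF z(1)] by (simp add: q_def flip: \<zeta>_def)
            moreover have "\<epsilon> * ln (norm (F t $ None)) \<le> \<epsilon> * ln M"
              using FN[OF t1] nz eps Mpos by (intro mult_left_mono) (auto intro: ln_mono)
            ultimately show ?thesis by (simp add: \<kappa>_def algebra_simps)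
          qed
          finally show ?thesis by (simp add: ereal_add_real_le_iff)
        qed
      qed
      show "0 \<in> S" using \<eta> r by (simp add: S_def)
    qed
    have "Re (P 0) = circle_mean (\<lambda>z. Re (P z))"
      by (rule circle_mean_Re_holomorphic[symmetric]) (auto intro: Pc holomorphic_on_subset[OF P(1)])
    also have "\<dots> \<le> circle_mean (\<lambda>z. b z + \<epsilon>)"
      using P(2) by (intro circle_mean_mono continuous_intros b Pc) (auto simp: abs_less_iff less_imp_le algebra_simps)
    also have "\<dots> = circle_mean b + \<epsilon>" by (subst circle_mean_add) (auto intro: b)
    finally have "q 0 \<le> circle_mean b + 2 * \<epsilon>" by (simp add: q_def)
    then have "\<epsilon> * ln M - \<kappa> 0 \<le> circle_mean b + \<epsilon> * (2 + ln M - ln (norm (F 0 $ None))) - ln (norm (F 0 $ None))"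
      by (simp add: \<kappa>_def algebra_simps)
    with main show ?thesis unfolding ereal_add_real_le_iff by (meson ereal_less_eq(3) order_trans)
  qed
  show "u (affine_part (F 0)) + ereal (ln (norm (F 0 $ None))) \<le> ereal (circle_mean b)"
  proof (cases "u (affine_part (F 0))")
    case (real v)
    \<comment> \<open>The error in \<open>approx\<close> is a positive constant times
      \<open>\<epsilon>\<close>, so it can be made any given \<open>e\<close>.\<close>
    let ?c = "2 + ln M - ln (norm (F 0 $ None))"
    have "ln (norm (F 0 $ None)) \<le> ln M" using FN[of 0] F0 Mpos by (auto intro: ln_mono)
    then have c: "?c > 0" by simp
    have "v + ln (norm (F 0 $ None)) \<le> circle_mean b + e" if "e > 0" for e
      using approx[of "e / ?c"] c that real by simp
    then have "v + ln (norm (F 0 $ None)) \<le> circle_mean b" by (rule field_le_epsilon)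
    then show ?thesis by (simp add: real)
  next
    case PInf
    then show ?thesis using plurisubharmonic_less_infty[OF psh, of "affine_part (F 0)"] by simp
  qed simp
qed

section \<open>Comparison of Lelong functions with the disc functional\<close>

lemma bounded_lifting_norm_bound:
  assumes "bounded_lifting F f"
  obtains M where "M \<ge> 1" "\<And>t. norm t < 1 \<Longrightarrow> norm (F t) \<le> M"
proof -
  have "\<exists>B. \<forall>t\<in>ball 0 1. norm (F t $ i) \<le> B" for i
    using assms unfolding bounded_lifting_def bounded_iff by (metis image_eqI)
  then obtain B where B: "\<And>i t. norm t < 1 \<Longrightarrow> norm (F t $ i) \<le> B i" by (metis mem_ball_0)
  have "norm (F t) \<le> max 1 (\<Sum>i\<in>UNIV. B i)" if "norm t < 1" for t
  proof -
    have "norm (F t) \<le> (\<Sum>i\<in>UNIV. norm (F t $ i))"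
      unfolding norm_vec_def by (rule L2_set_le_sum) auto
    also have "\<dots> \<le> (\<Sum>i\<in>UNIV. B i)" by (intro sum_mono B that)
    finally show ?thesis by simp
  qed
  then show ?thesis using that[of "max 1 (\<Sum>i\<in>UNIV. B i)"] by auto
qed

lemma radius_sequence:
  obtains r :: "nat \<Rightarrow> real" where "r \<longlonglongrightarrow> 1" "\<And>j. 0 < r j" "\<And>j. r j < 1"
proof (rule that[of "\<lambda>j. 1 - inverse (real (Suc (Suc j)))"])
  have "(\<lambda>j. 1 - inverse (real (Suc (Suc j)))) \<longlonglongrightarrow> 1 - 0"
    by (intro tendsto_diff tendsto_const LIMSEQ_Suc[OF LIMSEQ_inverse_real_of_nat])
  then show "(\<lambda>j. 1 - inverse (real (Suc (Suc j)))) \<longlonglongrightarrow> 1" by simp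
qed (auto simp: field_simps)

lemma radial_limit:
  assumes nt: "has_nt_limit F \<zeta> w" and \<zeta>: "norm \<zeta> = 1"
    and r: "r \<longlonglongrightarrow> 1" "\<And>j. 0 < r j" "\<And>j. r j < 1"
  shows "(\<lambda>j. F (of_real (r j) * \<zeta>)) \<longlonglongrightarrow> w"
proof -
  \<comment> \<open>Every aperture above 1 contains the radius, along which the distance to
    \<open>\<zeta>\<close> equals \<open>1 - norm z\<close>.\<close>
  have lim: "(F \<longlongrightarrow> w) (at \<zeta> within stolz 2 \<zeta>)" using nt by (auto simp: has_nt_limit_def)
  have mem: "of_real (r j) * \<zeta> \<in> stolz 2 \<zeta>" "of_real (r j) * \<zeta> \<noteq> \<zeta>" for j
  proof -
    have n: "norm (of_real (r j) * \<zeta>) = r j" using r(2)[of j] \<zeta> by (simp add: norm_mult)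
    have e: "of_real (r j) * \<zeta> - \<zeta> = of_real (r j - 1) * \<zeta>" by (simp add: algebra_simps)
    then have "dist (of_real (r j) * \<zeta>) \<zeta> = 1 - r j"
      using r(3)[of j] \<zeta> unfolding dist_norm e norm_mult norm_of_real by simp
    then show "of_real (r j) * \<zeta> \<in> stolz 2 \<zeta>" "of_real (r j) * \<zeta> \<noteq> \<zeta>"
      using n r(2,3)[of j] \<zeta> by (auto simp: stolz_def)
  qed
  have "(\<lambda>j. of_real (r j) * \<zeta>) \<longlonglongrightarrow> of_real 1 * \<zeta>" by (intro tendsto_intros r(1))
  then have "filterlim (\<lambda>j. of_real (r j) * \<zeta>) (at \<zeta> within stolz 2 \<zeta>) sequentially"
    using mem by (auto simp: filterlim_at intro!: always_eventually)
  from filterlim_compose[OF lim this] show ?thesis .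
qed

text \<open>On a circle of radius close to 1 most points lie over \<open>X\<close>, where
  \<open>u \<le> 0\<close> and the inner factor only helps, so that the logarithm of the outer
  factor is a bound. On the rest the growth bound is used; its measure tends to 0, and uniform
  integrability makes its share of the mean negligible.\<close>

theorem lelong_le_disc:
  fixes u :: "complex ^ 'n \<Rightarrow> ereal" and X :: "(complex ^ 'n) set"
  assumes X: "open X" and u: "u \<in> lelong_class" "\<And>x. x \<in> X \<Longrightarrow> u x \<le> 0"
    and f: "f \<in> disc_class X" "f 0 = affine_embed z"
    and F: "bounded_lifting F f" and g: "inner_factor g (\<lambda>t. F t $ None)"
  shows "u z \<le> ereal (- ln (norm (g 0)))"
proof -
  have psh: "plurisubharmonic u" using u(1) by (simp add: lelong_class_def)
  obtain C where growth: "\<And>x. u x \<le> ereal (ln (max 1 (norm x)) + C)"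
    using u(1) by (auto simp: lelong_class_def)
  obtain G where G: "bounded_lifting G f"
    and Gb: "AE \<zeta> in arc_measure. \<exists>w. has_nt_limit G \<zeta> w \<and> w \<noteq> 0 \<and> proj_of w \<in> affine_embed ` X"
    using f(1) by (auto simp: disc_class_def)
  have hF: "(\<lambda>t. F t $ i) holomorphic_on ball 0 1" and hG: "(\<lambda>t. G t $ i) holomorphic_on ball 0 1" for i
    using F G by (auto simp: bounded_lifting_def)
  have FG: "F t \<noteq> 0" "G t \<noteq> 0" "proj_of (F t) = f t" "proj_of (G t) = f t" if "norm t < 1" for t
    using F G that by (auto simp: bounded_lifting_def)
  have eqFG: "F t $ None = 0 \<longleftrightarrow> G t $ None = 0" "affine_part (F t) = affine_part (G t)" if "norm t < 1" for t
    using proj_of_eq_imp[of "F t" "G t"] FG[OF that] by auto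
  have F0: "F 0 $ None \<noteq> 0" "affine_part (F 0) = z"
    using proj_of_eq_affine_embed_iff[of "F 0" z] FG[of 0] f(2) by auto
  obtain M where M: "M \<ge> 1" "\<And>t. norm t < 1 \<Longrightarrow> norm (F t) \<le> M"
    using bounded_lifting_norm_bound[OF F] by blast
  from g obtain h where inner: "inner_function g" and outer: "outer_function h"
    and gh: "\<And>t. norm t < 1 \<Longrightarrow> F t $ None = g t * h t"
    by (auto simp: inner_factor_def)
  from outer obtain c k where c: "norm c = 1" and k: "integrable arc_measure k"
    and hk: "\<And>t. norm t < 1 \<Longrightarrow> h t = c * exp (herglotz k t)"
    by (auto simp: outer_function_def herglotz_def)
  have ginner: "norm (g t) \<le> 1" if "norm t < 1" for t
    using inner that by (auto simp: inner_function_def)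
  have lnh: "ln (norm (h t)) = Re (herglotz k t)" if "norm t < 1" for t
    using c by (simp add: hk[OF that] norm_mult)
  have hnz: "h t \<noteq> 0" if "norm t < 1" for t using hk[OF that] c by auto
  obtain r where rlim: "r \<longlonglongrightarrow> 1" and r: "\<And>j. 0 < r j" "\<And>j. r j < (1::real)"
    using radius_sequence by blast
  \<comment> \<open>\<open>W\<close> is described by \<open>G\<close>, not by \<open>F\<close>: the
    boundary limits of \<open>G\<close> lie over the open set \<open>X\<close>, so almost every
    radius ends in \<open>W\<close>.\<close>
  define W where "W = {t \<in> ball 0 1. G t $ None \<noteq> 0 \<and> affine_part (G t) \<in> X}"
  have oW: "open W"
  proof -
    let ?U = "ball 0 1 \<inter> (\<lambda>t. G t $ None) -` (- {0})"
    have oU: "open ?U"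
      by (rule continuous_open_preimage) (auto intro: holomorphic_on_imp_continuous_on[OF hG])
    have "continuous_on ?U (\<lambda>t. affine_part (G t))"
      by (intro continuous_on_affine_part vec_continuous_on continuous_on_subset[OF holomorphic_on_imp_continuous_on[OF hG]]) auto
    from continuous_open_preimage[OF this oU X] have "open (?U \<inter> (\<lambda>t. affine_part (G t)) -` X)" .
    moreover have "W = ?U \<inter> (\<lambda>t. affine_part (G t)) -` X" by (auto simp: W_def)
    ultimately show ?thesis by metis
  qed
  define E where "E = (\<lambda>j. {\<zeta>. of_real (r j) * \<zeta> \<in> W})"
  have oE: "open (E j)" for j
    unfolding E_def using open_vimage[OF oW, of "\<lambda>\<zeta>. of_real (r j) * \<zeta>"]
    by (auto simp: vimage_def intro!: continuous_intros)
  have [measurable]: "E j \<in> sets borel" "- E j \<in> sets borel" for j using oE[of j] by auto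
  have AE_E: "AE \<zeta> in arc_measure. \<forall>\<^sub>F j in sequentially. \<zeta> \<in> E j"
    using Gb AE_arc_norm
  proof eventually_elim
    case (elim \<zeta>)
    then obtain w where w: "has_nt_limit G \<zeta> w" "w \<noteq> 0" "proj_of w \<in> affine_embed ` X" by blast
    from w(3) obtain x where "x \<in> X" "proj_of w = affine_embed x" by blast
    then have w': "w $ None \<noteq> 0" "affine_part w \<in> X"
      using proj_of_eq_affine_embed_iff[OF w(2), of x] by simp_all
    have lim: "(\<lambda>j. G (of_real (r j) * \<zeta>)) \<longlonglongrightarrow> w"
      by (rule radial_limit[OF w(1) elim(2) rlim r])
    have "\<forall>\<^sub>F j in sequentially. G (of_real (r j) * \<zeta>) $ None \<noteq> 0"
      using tendsto_vec_nth[OF lim, of None] w'(1) by (rule tendsto_imp_eventually_ne)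
    moreover have "\<forall>\<^sub>F j in sequentially. affine_part (G (of_real (r j) * \<zeta>)) \<in> X"
      by (rule topological_tendstoD[OF tendsto_affine_part[OF lim w'(1)] X w'(2)])
    ultimately show ?case
      by eventually_elim (use r elim(2) in \<open>auto simp: E_def W_def norm_mult abs_of_pos\<close>)
  qed
  have meas0: "(\<lambda>j. measure arc_measure (- E j)) \<longlonglongrightarrow> 0"
  proof -
    have "(\<lambda>j. \<integral>\<zeta>. indicator (- E j) \<zeta> \<partial>arc_measure) \<longlonglongrightarrow> (\<integral>\<zeta>. (0::real) \<partial>arc_measure)"
    proof (rule integral_dominated_convergence[where w = "\<lambda>_. 1"])
      show "AE \<zeta> in arc_measure. (\<lambda>j. indicator (- E j) \<zeta> :: real) \<longlonglongrightarrow> 0"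
        using AE_E
        by eventually_elim (auto elim!: eventually_mono intro!: tendsto_eventually)
    qed (auto simp: indicator_def)
    then show ?thesis by simp
  qed
  define C1 where "C1 = ln M + C"
  define L where "L = (\<lambda>j \<zeta>. Re (herglotz k (of_real (r j) * \<zeta>)))"
  \<comment> \<open>As \<open>E j\<close> is open, taking the larger value on its closed complement
    makes \<open>b j\<close> upper semicontinuous on the circle, so it has a continuous majorant of
    nearly the same mean.\<close>
  define b where "b = (\<lambda>j \<zeta>. if \<zeta> \<in> E j then L j \<zeta> else max C1 (L j \<zeta>))"
  have rz: "norm (of_real (r j) * \<zeta>) < 1" if "norm \<zeta> = 1" for j and \<zeta> :: complex
    using r[of j] that by (simp add: norm_mult)
  have holHr: "(\<lambda>\<zeta>. herglotz k (of_real (r j) * \<zeta>)) holomorphic_on ball 0 (1 / r j)" for j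
    by (rule holomorphic_on_compose_gen[OF _ herglotz_holomorphic[OF k], unfolded o_def])
       (use r[of j] in \<open>auto intro!: holomorphic_intros simp: norm_mult field_simps\<close>)
  have cb: "cball (0::complex) 1 \<subseteq> ball 0 (1 / r j)" for j
    using r[of j] by (simp add: cball_subset_ball_iff)
  have Lc: "continuous_on (cball 0 1) (L j)" for j
    unfolding L_def by (intro continuous_intros holomorphic_on_imp_continuous_on holomorphic_on_subset[OF holHr cb])
  then have Lcs: "continuous_on (sphere 0 1) (L j)" for j
    by (rule continuous_on_subset) auto
  have Lmean: "circle_mean (L j) = Re (herglotz k 0)" for j
    unfolding L_def
    using circle_mean_Re_holomorphic[of "\<lambda>\<zeta>. herglotz k (of_real (r j) * \<zeta>)"]
      holomorphic_on_imp_continuous_on[OF holomorphic_on_subset[OF holHr cb, of j]]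
      holomorphic_on_subset[OF holHr order_trans[OF ball_subset_cball cb], of j] by simp
  have bound: "u (affine_part (F (of_real (r j) * \<zeta>))) + ereal (ln (norm (F (of_real (r j) * \<zeta>) $ None))) \<le> ereal (b j \<zeta>)"
    if \<zeta>: "norm \<zeta> = 1" and nz: "F (of_real (r j) * \<zeta>) $ None \<noteq> 0" for j \<zeta>
  proof (cases "\<zeta> \<in> E j")
    case True
    let ?t = "of_real (r j) * \<zeta>"
    have "affine_part (F ?t) \<in> X" using True eqFG(2)[OF rz[OF \<zeta>]] by (simp add: E_def W_def)
    then have "u (affine_part (F ?t)) \<le> 0" by (rule u(2))
    then have "u (affine_part (F ?t)) + ereal (ln (norm (F ?t $ None))) \<le> 0 + ereal (ln (norm (F ?t $ None)))"
      by (rule add_right_mono)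
    also have "ln (norm (F ?t $ None)) \<le> L j \<zeta>"
    proof -
      have "norm (F ?t $ None) \<le> norm (h ?t)"
        unfolding gh[OF rz[OF \<zeta>]] norm_mult using ginner[OF rz[OF \<zeta>]]
        by (simp add: mult_left_le_one_le)
      then have "ln (norm (F ?t $ None)) \<le> ln (norm (h ?t))"
        using nz hnz[OF rz[OF \<zeta>]] by simp
      then show ?thesis using lnh[OF rz[OF \<zeta>]] by (simp add: L_def)
    qed
    finally show ?thesis using True by (simp add: b_def)
  next
    case False
    have "u (affine_part (F (of_real (r j) * \<zeta>))) + ereal (ln (norm (F (of_real (r j) * \<zeta>) $ None))) \<le> ereal C1"
      unfolding C1_def
      by (rule lelong_growth_homogeneous[OF growth M(2)[OF rz[OF \<zeta>]] nz])
    also have "\<dots> \<le> ereal (b j \<zeta>)" using False by (simp add: b_def)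
    finally show ?thesis .
  qed
  have key: "u z + ereal (ln (norm (F 0 $ None))) \<le> ereal (Re (herglotz k 0) + e)" if e: "e > 0" for e
  proof -
    obtain \<delta> where \<delta>: "\<delta> > 0" "\<And>E r. E \<in> sets borel \<Longrightarrow> measure arc_measure E \<le> \<delta> \<Longrightarrow> 0 \<le> r \<Longrightarrow> r < 1 \<Longrightarrow>
       (\<integral>\<^sup>+\<zeta>. ennreal \<bar>Re (herglotz k (of_real r * \<zeta>))\<bar> * indicator E \<zeta> \<partial>arc_measure) \<le> ennreal (e / 3)"
    proof -
      have "e / 3 > 0" using e by simp
      from Poisson_uniformly_integrable[OF k this] that show ?thesis by blast
    qed
    have "\<forall>\<^sub>F j in sequentially. measure arc_measure (- E j) < min \<delta> (e / (3 * (\<bar>C1\<bar> + 1)))"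
      using \<delta>(1) e by (intro order_tendstoD(2)[OF meas0]) (auto simp: add_nonneg_pos)
    then obtain j where j: "measure arc_measure (- E j) < \<delta>" "measure arc_measure (- E j) < e / (3 * (\<bar>C1\<bar> + 1))"
      by (auto simp: eventually_sequentially)
    obtain B where B: "\<And>\<zeta>. norm \<zeta> = 1 \<Longrightarrow> \<bar>L j \<zeta>\<bar> \<le> B"
      using compact_imp_bounded[OF compact_continuous_image[OF Lcs compact_sphere], of j]
      unfolding bounded_iff by (metis image_eqI mem_sphere_0 real_norm_def)
    have bb: "\<bar>b j \<zeta>\<bar> \<le> max \<bar>C1\<bar> B" if "norm \<zeta> = 1" for \<zeta>
      using B[OF that] by (auto simp: b_def max_def abs_if)
    have busc: "\<exists>d>0. \<forall>w. norm w = 1 \<and> dist w \<zeta> < d \<longrightarrow> b j w < y" if \<zeta>: "norm \<zeta> = 1" and y: "b j \<zeta> < y" for \<zeta> y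
    proof (cases "\<zeta> \<in> E j")
      case True
      then have "L j \<zeta> < y" using y by (simp add: b_def)
      then have "\<forall>\<^sub>F w in at \<zeta> within sphere 0 1. L j w < y"
        using Lcs[of j] \<zeta> by (auto simp: continuous_on_def intro: order_tendstoD(2))
      then obtain d where d: "d > 0" "\<And>w. norm w = 1 \<Longrightarrow> w \<noteq> \<zeta> \<Longrightarrow> dist w \<zeta> < d \<Longrightarrow> L j w < y"
        unfolding eventually_at by auto
      obtain d' where d': "d' > 0" "ball \<zeta> d' \<subseteq> E j" using oE[of j] True open_contains_ball by blast
      have "b j w < y" if "norm w = 1" "dist w \<zeta> < min d d'" for w
      proof -
        have "w \<in> E j" using d' that by (auto simp: dist_commute)
        then show ?thesis using d(2)[of w] that \<open>L j \<zeta> < y\<close> by (cases "w = \<zeta>") (auto simp: b_def)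
      qed
      then show ?thesis using d(1) d'(1) by (intro exI[of _ "min d d'"]) auto
    next
      case False
      then have yy: "L j \<zeta> < y" "C1 < y" using y by (auto simp: b_def)
      then have "\<forall>\<^sub>F w in at \<zeta> within sphere 0 1. L j w < y"
        using Lcs[of j] \<zeta> by (auto simp: continuous_on_def intro: order_tendstoD(2))
      then obtain d where d: "d > 0" "\<And>w. norm w = 1 \<Longrightarrow> w \<noteq> \<zeta> \<Longrightarrow> dist w \<zeta> < d \<Longrightarrow> L j w < y"
        unfolding eventually_at by auto
      have "b j w < y" if "norm w = 1" "dist w \<zeta> < d" for w
        using d(2)[of w] that yy by (cases "w = \<zeta>") (auto simp: b_def)
      then show ?thesis using d(1) by blast
    qed
    have e3: "e / 3 > 0" using e by simp
    note U = usc_continuous_majorant[OF bb busc e3]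
    obtain c where c: "continuous_on UNIV c" "\<And>\<zeta>. norm \<zeta> = 1 \<Longrightarrow> b j \<zeta> \<le> c \<zeta>" "circle_mean c \<le> circle_mean (b j) + e / 3"
      using U(2) by blast
    have "u (affine_part (F 0)) + ereal (ln (norm (F 0 $ None))) \<le> ereal (circle_mean c)"
    proof (rule lelong_circle_bound[OF psh growth hF M(2) F0(1) r(1)[of j] r(2)[of j]])
      show "continuous_on (sphere 0 1) c" by (rule continuous_on_subset[OF c(1)]) simp
      show "u (affine_part (F (of_real (r j) * \<zeta>))) + ereal (ln (norm (F (of_real (r j) * \<zeta>) $ None))) \<le> ereal (c \<zeta>)"
        if "norm \<zeta> = 1" "F (of_real (r j) * \<zeta>) $ None \<noteq> 0" for \<zeta>
        using bound[OF that] c(2)[OF that(1)] by (meson ereal_less_eq(3) order_trans)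
    qed
    also have "circle_mean (b j) \<le> Re (herglotz k 0) + 2 * (e / 3)"
    proof -
      \<comment> \<open>\<open>b j\<close> and \<open>L j\<close> agree on \<open>E j\<close>, and
        elsewhere \<open>b j\<close> exceeds \<open>L j\<close> by at most the sum of the moduli of
        \<open>C1\<close> and \<open>L j\<close>.\<close>
      let ?D = "\<lambda>t. indicator (- E j) (cis t) * (\<bar>C1\<bar> + \<bar>L j (cis t)\<bar>)"
      have [measurable]: "cis -` E j \<in> sets borel" "cis -` (- E j) \<in> sets borel"
        using measurable_sets[OF measurable_cis, of "E j"] measurable_sets[OF measurable_cis, of "- E j"] by simp_all
      have [measurable]: "(\<lambda>t. L j (cis t)) \<in> borel_measurable circ" by (rule measurable_compose_cis[OF Lcs])
      have Dint: "integrable circ ?D"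
      proof (rule circ.integrable_const_bound[of _ "\<bar>C1\<bar> + B"])
        show "AE t in circ. norm (?D t) \<le> \<bar>C1\<bar> + B"
        proof (rule AE_I2)
          fix t
          have "\<bar>L j (cis t)\<bar> \<le> B" by (rule B) simp
          moreover have "0 \<le> B" using B[of 1] by simp
          ultimately show "norm (?D t) \<le> \<bar>C1\<bar> + B" by (simp add: indicator_def)
        qed
        show "?D \<in> borel_measurable circ" by measurable
      qed
      have "circle_mean (b j) - circle_mean (L j) = (\<integral>t. b j (cis t) - L j (cis t) \<partial>circ)"
        unfolding circle_mean_def using U(1) integrable_circ[OF Lcs, of j] by simp
      also have "\<dots> \<le> (\<integral>t. ?D t \<partial>circ)"
        by (rule integral_mono) (use U(1) integrable_circ[OF Lcs, of j] Dint in \<open>auto simp: b_def indicator_def\<close>)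
      also have "\<dots> \<le> 2 * (e / 3)"
      proof -
        have D0: "AE t in circ. 0 \<le> ?D t" by auto
        have "ennreal (\<integral>t. ?D t \<partial>circ) = (\<integral>\<^sup>+t. ennreal (?D t) \<partial>circ)"
          by (rule nn_integral_eq_integral[symmetric, OF Dint D0])
        also have "\<dots> = (\<integral>\<^sup>+t. ennreal \<bar>C1\<bar> * indicator (cis -` (- E j)) t + ennreal \<bar>L j (cis t)\<bar> * indicator (- E j) (cis t) \<partial>circ)"
          by (rule nn_integral_cong) (auto simp: indicator_def)
        also have "\<dots> = ennreal \<bar>C1\<bar> * emeasure circ (cis -` (- E j)) + (\<integral>\<^sup>+t. ennreal \<bar>L j (cis t)\<bar> * indicator (- E j) (cis t) \<partial>circ)"
          by (subst nn_integral_add) (auto simp: nn_integral_cmult_indicator)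
        also have "emeasure circ (cis -` (- E j)) = emeasure arc_measure (- E j)"
          unfolding arc_measure_circ by (subst emeasure_distr) auto
        also have "(\<integral>\<^sup>+t. ennreal \<bar>L j (cis t)\<bar> * indicator (- E j) (cis t) \<partial>circ) \<le> ennreal (e / 3)"
        proof -
          have "(\<integral>\<^sup>+t. ennreal \<bar>L j (cis t)\<bar> * indicator (- E j) (cis t) \<partial>circ) =
            (\<integral>\<^sup>+t. ennreal (\<bar>L j (cis t)\<bar> * indicator (sphere 0 1) (cis t)) * indicator (- E j) (cis t) \<partial>circ)"
            by (rule nn_integral_cong) auto
          also have "\<dots> = (\<integral>\<^sup>+\<zeta>. ennreal (\<bar>L j \<zeta>\<bar> * indicator (sphere 0 1) \<zeta>) * indicator (- E j) \<zeta> \<partial>arc_measure)"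
          proof -
            \<comment> \<open>Continuity of \<open>L j\<close> is known on the closed disc only;
              cutting it off outside the circle gives a function that is Borel on the plane.\<close>
            have "(\<lambda>\<zeta>. indicator (sphere 0 1) \<zeta> *\<^sub>R \<bar>L j \<zeta>\<bar>) \<in> borel_measurable borel"
              by (intro borel_measurable_continuous_on_indicator continuous_intros Lcs) simp
            then have [measurable]: "(\<lambda>\<zeta>. \<bar>L j \<zeta>\<bar> * indicator (sphere 0 1) \<zeta>) \<in> borel_measurable borel"
              by (simp add: mult.commute)
            show ?thesis unfolding arc_measure_circ by (subst nn_integral_distr) auto
          qed
          also have "\<dots> = (\<integral>\<^sup>+\<zeta>. ennreal \<bar>L j \<zeta>\<bar> * indicator (- E j) \<zeta> \<partial>arc_measure)"
            by (rule nn_integral_cong_AE) (use AE_arc_norm in \<open>eventually_elim, auto\<close>)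
          also have "\<dots> \<le> ennreal (e / 3)"
            unfolding L_def by (rule \<delta>(2)) (use j r[of j] in auto)
          finally show ?thesis .
        qed
        also have "ennreal \<bar>C1\<bar> * emeasure arc_measure (- E j) \<le> ennreal (e / 3)"
        proof -
          have "\<bar>C1\<bar> * measure arc_measure (- E j) \<le> \<bar>C1\<bar> * (e / (3 * (\<bar>C1\<bar> + 1)))"
            using j(2) by (intro mult_left_mono) auto
          also have "\<dots> \<le> e / 3" using e by (simp add: field_simps)
          finally show ?thesis
            unfolding arc.emeasure_eq_measure ennreal_mult''[OF measure_nonneg, symmetric] by (rule ennreal_leI)
        qed
        finally have "ennreal (\<integral>t. ?D t \<partial>circ) \<le> ennreal (e / 3) + ennreal (e / 3)"
          by (simp add: add_mono)
        also have "\<dots> = ennreal (2 * (e / 3))" using e by (simp flip: ennreal_plus)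
        finally show ?thesis using e by (subst (asm) ennreal_le_iff) auto
      qed
      finally show ?thesis unfolding Lmean by simp
    qed
    then have "circle_mean c \<le> Re (herglotz k 0) + e" using c(3) by linarith
    finally show ?thesis by (simp add: F0(2))
  qed
  have g0: "ln (norm (F 0 $ None)) = ln (norm (g 0)) + Re (herglotz k 0)"
    using gh[of 0] lnh[of 0] hnz[of 0] F0(1) by (simp add: norm_mult ln_mult)
  show ?thesis
  proof (cases "u z")
    case (real v)
    have "v + ln (norm (F 0 $ None)) \<le> Re (herglotz k 0) + e" if "e > 0" for e
      using key[OF that] by (simp add: real)
    then have "v + ln (norm (F 0 $ None)) \<le> Re (herglotz k 0)" by (rule field_le_epsilon)
    then show ?thesis by (simp add: real g0)
  next
    case PInf
    then show ?thesis using plurisubharmonic_less_infty[OF psh, of z] by simp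
  qed simp
qed

corollary siciak_le_envelope:
  assumes "open X"
  shows "siciak_extremal X z \<le> envelope (disc_class X) disc_functional (affine_embed z)"
  unfolding envelope_def
proof (rule INF_greatest)
  fix f assume f: "f \<in> {f \<in> disc_class X. f 0 = affine_embed z}"
  have *: "Sup {ereal (ln (norm (g 0))) | F g. bounded_lifting F f \<and> inner_factor g (\<lambda>z. F z $ None)} \<le> - u z"
    if u: "u \<in> lelong_class" "\<forall>x\<in>X. u x \<le> 0" for u
  proof (rule Sup_least)
    fix s assume "s \<in> {ereal (ln (norm (g 0))) | F g. bounded_lifting F f \<and> inner_factor g (\<lambda>z. F z $ None)}"
    then obtain F g where s: "s = ereal (ln (norm (g 0)))" "bounded_lifting F f" "inner_factor g (\<lambda>z. F z $ None)"
      by blast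
    have "u z \<le> ereal (- ln (norm (g 0)))"
      by (rule lelong_le_disc[OF assms u(1) _ _ _ s(2,3)]) (use u f in auto)
    then show "s \<le> - u z" unfolding s(1) by (cases "u z") auto
  qed
  then have "u z \<le> disc_functional f" if "u \<in> lelong_class" "\<forall>x\<in>X. u x \<le> 0" for u
  proof -
    have "Sup {ereal (ln (norm (g 0))) | F g. bounded_lifting F f \<and> inner_factor g (\<lambda>z. F z $ None)} \<le> - u z"
      by (rule *[OF that])
    then have "- (- u z) \<le> disc_functional f"
      unfolding disc_functional_def by (simp only: ereal_minus_le_minus)
    then show ?thesis by simp
  qed
  then show "siciak_extremal X z \<le> disc_functional f"
    unfolding siciak_extremal_def by (intro SUP_least) auto
qed

section \<open>Disc hulls\<close>

definition entire_map :: "(complex \<Rightarrow> complex ^ 'm) \<Rightarrow> bool" where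
  "entire_map G \<longleftrightarrow> (\<forall>i. (\<lambda>t. G t $ i) holomorphic_on UNIV)"

text \<open>Entire maps can be composed with powers and multiplied by exponentials of entire
  functions without regard to domains. Nothing is lost, since all boundary data are approximated by
  Laurent polynomials.\<close>

definition disc_hull :: "(complex ^ 'm) set \<Rightarrow> (complex ^ 'm) set" where
  "disc_hull V = {G 0 | G. entire_map G \<and> (\<forall>\<zeta>. norm \<zeta> = 1 \<longrightarrow> G \<zeta> \<in> V)}"

definition circled :: "(complex ^ 'm) set \<Rightarrow> bool" where
  "circled V \<longleftrightarrow> (\<forall>c. \<forall>v\<in>V. norm c \<le> 1 \<longrightarrow> c *s v \<in> V)"

lemma entire_map_const [intro]: "entire_map (\<lambda>_. v)"
  by (simp add: entire_map_def)

lemma entire_map_add [intro]: "entire_map F \<Longrightarrow> entire_map G \<Longrightarrow> entire_map (\<lambda>t. F t + G t)"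
  by (auto simp: entire_map_def intro!: holomorphic_intros)

lemma entire_map_smult [intro]: "f holomorphic_on UNIV \<Longrightarrow> entire_map G \<Longrightarrow> entire_map (\<lambda>t. f t *s G t)"
  by (auto simp: entire_map_def intro!: holomorphic_intros)

lemma entire_map_compose:
  assumes "entire_map G" "f holomorphic_on UNIV"
  shows "entire_map (\<lambda>t. G (f t))"
  unfolding entire_map_def
  using holomorphic_on_compose_gen[OF assms(2), unfolded o_def] assms(1) by (auto simp: entire_map_def)

lemma entire_map_continuous: "entire_map G \<Longrightarrow> continuous_on A G"
  by (rule vec_continuous_on)
     (auto simp: entire_map_def intro: continuous_on_subset[OF holomorphic_on_imp_continuous_on])

lemma disc_hullI: "entire_map G \<Longrightarrow> (\<And>\<zeta>. norm \<zeta> = 1 \<Longrightarrow> G \<zeta> \<in> V) \<Longrightarrow> G 0 \<in> disc_hull V"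
  by (auto simp: disc_hull_def)

lemma disc_hullE:
  assumes "v \<in> disc_hull V"
  obtains G where "entire_map G" "\<And>\<zeta>. norm \<zeta> = 1 \<Longrightarrow> G \<zeta> \<in> V" "G 0 = v"
  using assms by (auto simp: disc_hull_def)

lemma subset_disc_hull: "V \<subseteq> disc_hull V"
  using disc_hullI[of "\<lambda>_. v" V for v] by blast

lemma compact_margin:
  fixes K :: "'a::metric_space set"
  assumes "compact K" "open V" "K \<subseteq> V"
  obtains e where "e > 0" "\<And>x y. x \<in> K \<Longrightarrow> dist x y < e \<Longrightarrow> y \<in> V"
proof -
  obtain e where "e > 0" "(\<Union>x\<in>K. ball x e) \<subseteq> V"
    using compact_subset_open_imp_ball_epsilon_subset[OF assms] by blast
  then show ?thesis using that[of e] by (meson UN_I mem_ball subsetD)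
qed

lemma entire_map_image_margin:
  assumes "entire_map G" "open V" "\<And>\<zeta>. norm \<zeta> = 1 \<Longrightarrow> G \<zeta> \<in> V"
  obtains e where "e > 0" "\<And>\<zeta> v. norm \<zeta> = 1 \<Longrightarrow> dist (G \<zeta>) v < e \<Longrightarrow> v \<in> V"
proof -
  have "compact (G ` sphere 0 1)" by (intro compact_continuous_image entire_map_continuous assms) simp
  moreover have "G ` sphere 0 1 \<subseteq> V" using assms(3) by auto
  ultimately obtain e where "e > 0" "\<And>x y. x \<in> G ` sphere 0 1 \<Longrightarrow> dist x y < e \<Longrightarrow> y \<in> V"
    using compact_margin[OF _ assms(2)] by metis
  then show ?thesis using that[of e] by (metis imageI mem_sphere_0)
qed

text \<open>Translating a disc moves its centre by an arbitrary small vector and keeps its compact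
  boundary in the open set.\<close>

lemma open_disc_hull:
  assumes "open V"
  shows "open (disc_hull V)"
  unfolding open_dist
proof
  fix v assume "v \<in> disc_hull V"
  then obtain G where G: "entire_map G" "\<And>\<zeta>. norm \<zeta> = 1 \<Longrightarrow> G \<zeta> \<in> V" "G 0 = v" by (rule disc_hullE) blast
  obtain e where e: "e > 0" "\<And>\<zeta> w. norm \<zeta> = 1 \<Longrightarrow> dist (G \<zeta>) w < e \<Longrightarrow> w \<in> V"
    using entire_map_image_margin[OF G(1) assms G(2)] by blast
  have "w \<in> disc_hull V" if w: "dist w v < e" for w
  proof -
    have "G 0 + (w - v) \<in> disc_hull V"
    proof (rule disc_hullI)
      show "entire_map (\<lambda>t. G t + (w - v))" by (intro entire_map_add G entire_map_const)
      show "G \<zeta> + (w - v) \<in> V" if "norm \<zeta> = 1" for \<zeta>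
        by (rule e(2)[OF that]) (use w in \<open>simp add: dist_norm\<close>, metis norm_minus_commute)
    qed
    then show ?thesis by (simp add: G(3))
  qed
  then show "\<exists>e>0. \<forall>w. dist w v < e \<longrightarrow> w \<in> disc_hull V" using e(1) by blast
qed

lemma circled_disc_hull:
  assumes "circled V"
  shows "circled (disc_hull V)"
  unfolding circled_def
proof (intro allI ballI impI)
  fix c :: complex and v assume v: "v \<in> disc_hull V" and c: "norm c \<le> 1"
  from v obtain G where G: "entire_map G" "\<And>\<zeta>. norm \<zeta> = 1 \<Longrightarrow> G \<zeta> \<in> V" "G 0 = v" by (rule disc_hullE) blast
  have "c *s G 0 \<in> disc_hull V"
    by (rule disc_hullI) (use G assms c in \<open>auto simp: circled_def\<close>)
  then show "c *s v \<in> disc_hull V" by (simp add: G(3))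
qed

text \<open>
  A family of discs \<open>\<eta> \<mapsto> \<Phi> \<zeta> \<eta>\<close> centred at the origin, depending on \<open>\<zeta>\<close> on the circle. In the
  approximation property the factor \<open>\<zeta> ^ l\<close> absorbs the poles that arise from multiplying by
  Laurent polynomials in \<open>\<zeta>\<close>.
\<close>

definition disc_family :: "(complex \<Rightarrow> complex \<Rightarrow> complex ^ 'm) \<Rightarrow> bool" where
  "disc_family \<Phi> \<longleftrightarrow> continuous_on (sphere 0 1 \<times> sphere 0 1) (\<lambda>p. \<Phi> (fst p) (snd p)) \<and>
     (\<forall>e>0. \<forall>l. \<exists>k0. \<forall>k\<ge>k0. \<exists>\<Psi>. entire_map \<Psi> \<and>
        (\<forall>\<zeta>. norm \<zeta> = 1 \<longrightarrow> norm (\<zeta> ^ l *s \<Psi> \<zeta> - \<Phi> \<zeta> (\<zeta> ^ k)) < e))"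

lemma disc_family_bounded:
  assumes "disc_family \<Phi>"
  obtains B where "B > 0" "\<And>\<zeta> \<eta>. norm \<zeta> = 1 \<Longrightarrow> norm \<eta> = 1 \<Longrightarrow> norm (\<Phi> \<zeta> \<eta>) \<le> B"
proof -
  have "bounded ((\<lambda>p. \<Phi> (fst p) (snd p)) ` (sphere 0 1 \<times> sphere 0 1))"
    using assms by (intro compact_imp_bounded compact_continuous_image compact_Times) (auto simp: disc_family_def)
  then obtain B where B: "B > 0" "\<forall>v\<in>(\<lambda>p. \<Phi> (fst p) (snd p)) ` (sphere 0 1 \<times> sphere 0 1). norm v \<le> B"
    unfolding bounded_pos by blast
  have "norm (\<Phi> \<zeta> \<eta>) \<le> B" if "norm \<zeta> = 1" "norm \<eta> = 1" for \<zeta> \<eta>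
    using B(2) that by auto
  then show ?thesis using that[of B] B(1) by blast
qed

lemma disc_family_add:
  assumes "disc_family \<Phi>1" "disc_family \<Phi>2"
  shows "disc_family (\<lambda>\<zeta> \<eta>. \<Phi>1 \<zeta> \<eta> + \<Phi>2 \<zeta> \<eta>)"
  unfolding disc_family_def
proof (intro conjI allI impI)
  show "continuous_on (sphere 0 1 \<times> sphere 0 1) (\<lambda>p. \<Phi>1 (fst p) (snd p) + \<Phi>2 (fst p) (snd p))"
    using assms by (intro continuous_intros) (auto simp: disc_family_def)
  fix e :: real and l :: nat assume "e > 0"
  then have e2: "e / 2 > 0" by simp
  obtain k1 where k1: "\<And>k. k \<ge> k1 \<Longrightarrow> \<exists>\<Psi>. entire_map \<Psi> \<and> (\<forall>\<zeta>. norm \<zeta> = 1 \<longrightarrow> norm (\<zeta> ^ l *s \<Psi> \<zeta> - \<Phi>1 \<zeta> (\<zeta> ^ k)) < e / 2)"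
    using assms(1) e2 unfolding disc_family_def by blast
  obtain k2 where k2: "\<And>k. k \<ge> k2 \<Longrightarrow> \<exists>\<Psi>. entire_map \<Psi> \<and> (\<forall>\<zeta>. norm \<zeta> = 1 \<longrightarrow> norm (\<zeta> ^ l *s \<Psi> \<zeta> - \<Phi>2 \<zeta> (\<zeta> ^ k)) < e / 2)"
    using assms(2) e2 unfolding disc_family_def by blast
  show "\<exists>k0. \<forall>k\<ge>k0. \<exists>\<Psi>. entire_map \<Psi> \<and> (\<forall>\<zeta>. norm \<zeta> = 1 \<longrightarrow> norm (\<zeta> ^ l *s \<Psi> \<zeta> - (\<Phi>1 \<zeta> (\<zeta> ^ k) + \<Phi>2 \<zeta> (\<zeta> ^ k))) < e)"
  proof (intro exI[of _ "max k1 k2"] allI impI)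
    fix k assume k: "max k1 k2 \<le> k"
    obtain \<Psi>1 where \<Psi>1: "entire_map \<Psi>1" "\<And>\<zeta>. norm \<zeta> = 1 \<Longrightarrow> norm (\<zeta> ^ l *s \<Psi>1 \<zeta> - \<Phi>1 \<zeta> (\<zeta> ^ k)) < e / 2"
      using k1[of k] k by auto
    obtain \<Psi>2 where \<Psi>2: "entire_map \<Psi>2" "\<And>\<zeta>. norm \<zeta> = 1 \<Longrightarrow> norm (\<zeta> ^ l *s \<Psi>2 \<zeta> - \<Phi>2 \<zeta> (\<zeta> ^ k)) < e / 2"
      using k2[of k] k by auto
    have "norm (\<zeta> ^ l *s (\<Psi>1 \<zeta> + \<Psi>2 \<zeta>) - (\<Phi>1 \<zeta> (\<zeta> ^ k) + \<Phi>2 \<zeta> (\<zeta> ^ k))) < e" if z: "norm \<zeta> = 1" for \<zeta>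
    proof -
      have eq: "\<zeta> ^ l *s (\<Psi>1 \<zeta> + \<Psi>2 \<zeta>) - (\<Phi>1 \<zeta> (\<zeta> ^ k) + \<Phi>2 \<zeta> (\<zeta> ^ k)) =
        (\<zeta> ^ l *s \<Psi>1 \<zeta> - \<Phi>1 \<zeta> (\<zeta> ^ k)) + (\<zeta> ^ l *s \<Psi>2 \<zeta> - \<Phi>2 \<zeta> (\<zeta> ^ k))"
        by (simp add: vector_add_ldistrib)
      show ?thesis using norm_add_less[OF \<Psi>1(2)[OF z] \<Psi>2(2)[OF z]] by (simp only: eq field_sum_of_halves)
    qed
    then show "\<exists>\<Psi>. entire_map \<Psi> \<and> (\<forall>\<zeta>. norm \<zeta> = 1 \<longrightarrow> norm (\<zeta> ^ l *s \<Psi> \<zeta> - (\<Phi>1 \<zeta> (\<zeta> ^ k) + \<Phi>2 \<zeta> (\<zeta> ^ k))) < e)"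
      using \<Psi>1(1) \<Psi>2(1) by (intro exI[of _ "\<lambda>\<zeta>. \<Psi>1 \<zeta> + \<Psi>2 \<zeta>"]) auto
  qed
qed

lemma disc_family_mult:
  fixes \<theta> :: "complex \<Rightarrow> real"
  assumes \<Phi>: "disc_family \<Phi>" and \<theta>: "continuous_on (sphere 0 1) \<theta>"
  shows "disc_family (\<lambda>\<zeta> \<eta>. of_real (\<theta> \<zeta>) *s \<Phi> \<zeta> \<eta>)"
  unfolding disc_family_def
proof (intro conjI allI impI)
  show "continuous_on (sphere 0 1 \<times> sphere 0 1) (\<lambda>p. of_real (\<theta> (fst p)) *s \<Phi> (fst p) (snd p))"
    using \<Phi> by (intro continuous_intros continuous_on_compose2[OF \<theta>]) (auto simp: disc_family_def)
  fix e :: real and l :: nat assume e: "e > 0"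
  obtain B where B: "B > 0" "\<And>\<zeta> \<eta>. norm \<zeta> = 1 \<Longrightarrow> norm \<eta> = 1 \<Longrightarrow> norm (\<Phi> \<zeta> \<eta>) \<le> B"
    using disc_family_bounded[OF \<Phi>] by blast
  have "e / (2 * B) > 0" using e B by simp
  from Laurent_approximation[OF \<theta> this] obtain Q m where
    Q: "\<And>z. norm z = 1 \<Longrightarrow> norm (poly Q z / z ^ m - of_real (\<theta> z)) < e / (2 * B)" by metis
  have "continuous_on (sphere 0 1) (\<lambda>z. poly Q z / z ^ m)"
    by (intro continuous_intros) auto
  from compact_imp_bounded[OF compact_continuous_image[OF this compact_sphere]]
  obtain A where A0: "A > 0" "\<forall>v\<in>(\<lambda>z. poly Q z / z ^ m) ` sphere 0 1. norm v \<le> A"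
    unfolding bounded_pos by blast
  then have A: "A > 0" "\<And>z. norm z = 1 \<Longrightarrow> norm (poly Q z / z ^ m) \<le> A" by auto
  have "e / (2 * A) > 0" using e A by simp
  \<comment> \<open>The exponent is \<open>l + m\<close>, so that \<open>m\<close> factors
    \<open>\<zeta>\<close> cancel the pole of \<open>poly Q \<zeta> / \<zeta> ^ m\<close> and
    \<open>l\<close> of them remain.\<close>
  then obtain k0 where k0: "\<And>k. k \<ge> k0 \<Longrightarrow> \<exists>\<Psi>. entire_map \<Psi> \<and> (\<forall>\<zeta>. norm \<zeta> = 1 \<longrightarrow> norm (\<zeta> ^ (l + m) *s \<Psi> \<zeta> - \<Phi> \<zeta> (\<zeta> ^ k)) < e / (2 * A))"
    using \<Phi> unfolding disc_family_def by blast
  show "\<exists>k0. \<forall>k\<ge>k0. \<exists>\<Psi>. entire_map \<Psi> \<and> (\<forall>\<zeta>. norm \<zeta> = 1 \<longrightarrow> norm (\<zeta> ^ l *s \<Psi> \<zeta> - of_real (\<theta> \<zeta>) *s \<Phi> \<zeta> (\<zeta> ^ k)) < e)"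
  proof (intro exI[of _ k0] allI impI)
    fix k assume k: "k0 \<le> k"
    obtain \<Psi> where \<Psi>: "entire_map \<Psi>" "\<And>\<zeta>. norm \<zeta> = 1 \<Longrightarrow> norm (\<zeta> ^ (l + m) *s \<Psi> \<zeta> - \<Phi> \<zeta> (\<zeta> ^ k)) < e / (2 * A)"
      using k0[OF k] by blast
    have "norm (\<zeta> ^ l *s (poly Q \<zeta> *s \<Psi> \<zeta>) - of_real (\<theta> \<zeta>) *s \<Phi> \<zeta> (\<zeta> ^ k)) < e" if z: "norm \<zeta> = 1" for \<zeta>
    proof -
      let ?q = "poly Q \<zeta> / \<zeta> ^ m"
      have nz: "\<zeta> \<noteq> 0" using z by auto
      have eq: "\<zeta> ^ l *s (poly Q \<zeta> *s \<Psi> \<zeta>) - of_real (\<theta> \<zeta>) *s \<Phi> \<zeta> (\<zeta> ^ k) =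
        ?q *s (\<zeta> ^ (l + m) *s \<Psi> \<zeta> - \<Phi> \<zeta> (\<zeta> ^ k)) + (?q - of_real (\<theta> \<zeta>)) *s \<Phi> \<zeta> (\<zeta> ^ k)"
        using nz by (simp add: vec_eq_iff field_simps power_add)
      have "norm (\<zeta> ^ l *s (poly Q \<zeta> *s \<Psi> \<zeta>) - of_real (\<theta> \<zeta>) *s \<Phi> \<zeta> (\<zeta> ^ k)) \<le> norm ?q * norm (\<zeta> ^ (l + m) *s \<Psi> \<zeta> - \<Phi> \<zeta> (\<zeta> ^ k)) + norm (?q - of_real (\<theta> \<zeta>)) * norm (\<Phi> \<zeta> (\<zeta> ^ k))"
        unfolding eq norm_vector_smult[symmetric] by (rule norm_triangle_ineq)
      also have "\<dots> \<le> A * norm (\<zeta> ^ (l + m) *s \<Psi> \<zeta> - \<Phi> \<zeta> (\<zeta> ^ k)) + norm (?q - of_real (\<theta> \<zeta>)) * B"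
        using A(2)[OF z] B(2)[OF z, of "\<zeta> ^ k"] z
        by (intro add_mono mult_right_mono mult_left_mono) (auto simp: norm_power)
      also have "\<dots> < A * (e / (2 * A)) + (e / (2 * B)) * B"
        using \<Psi>(2)[OF z] Q[OF z] A(1) B(1)
        by (intro add_strict_mono mult_strict_left_mono mult_strict_right_mono) auto
      also have "\<dots> = e" using A(1) B(1) by simp
      finally show ?thesis .
    qed
    moreover have "entire_map (\<lambda>\<zeta>. poly Q \<zeta> *s \<Psi> \<zeta>)"
      by (intro entire_map_smult \<Psi>(1) holomorphic_intros)
    ultimately show "\<exists>\<Psi>. entire_map \<Psi> \<and> (\<forall>\<zeta>. norm \<zeta> = 1 \<longrightarrow> norm (\<zeta> ^ l *s \<Psi> \<zeta> - of_real (\<theta> \<zeta>) *s \<Phi> \<zeta> (\<zeta> ^ k)) < e)"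
      by (intro exI[of _ "\<lambda>\<zeta>. poly Q \<zeta> *s \<Psi> \<zeta>"]) auto
  qed
qed

lemma entire_map_divide:
  assumes "entire_map F"
  obtains R where "entire_map R" "\<And>t. F t = F 0 + t *s R t"
proof -
  define R where "R = (\<lambda>t. \<chi> i. if t = 0 then deriv (\<lambda>t. F t $ i - F 0 $ i) 0 else (F t $ i - F 0 $ i) / t)"
  have "(\<lambda>t. R t $ i) holomorphic_on UNIV" for i
  proof (rule pole_theorem_0[of "\<lambda>t. F t $ i - F 0 $ i" UNIV 0])
    show "(\<lambda>t. F t $ i - F 0 $ i) holomorphic_on UNIV"
      using assms by (auto simp: entire_map_def intro!: holomorphic_intros)
  qed (auto simp: R_def)
  then have "entire_map R" by (simp add: entire_map_def)
  moreover have "F t = F 0 + t *s R t" for t by (simp add: R_def vec_eq_iff)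
  ultimately show ?thesis using that by blast
qed

text \<open>\<open>F \<eta> - F 0\<close> is divisible by \<open>\<eta>\<close>. At
  \<open>\<eta> = \<zeta> ^ k\<close> with \<open>k \<ge> l\<close> it is divisible by
  \<open>\<zeta> ^ l\<close>, so no approximation error occurs.\<close>

lemma disc_family_entire:
  assumes "entire_map F"
  shows "disc_family (\<lambda>\<zeta> \<eta>. F \<eta> - F 0)"
  unfolding disc_family_def
proof (intro conjI allI impI)
  show "continuous_on (sphere 0 1 \<times> sphere 0 1) (\<lambda>p. F (snd p) - F 0)"
    by (intro continuous_intros continuous_on_compose2[OF entire_map_continuous[OF assms, of UNIV]]) auto
  fix e :: real and l :: nat assume e: "e > 0"
  obtain R where R: "entire_map R" "\<And>t. F t = F 0 + t *s R t" using entire_map_divide[OF assms] by blast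
  have FR: "F t - F 0 = t *s R t" for t using R(2)[of t] by simp
  show "\<exists>k0. \<forall>k\<ge>k0. \<exists>\<Psi>. entire_map \<Psi> \<and> (\<forall>\<zeta>. norm \<zeta> = 1 \<longrightarrow> norm (\<zeta> ^ l *s \<Psi> \<zeta> - (F (\<zeta> ^ k) - F 0)) < e)"
  proof (intro exI[of _ l] allI impI)
    fix k assume k: "l \<le> k"
    have "entire_map (\<lambda>\<zeta>. \<zeta> ^ (k - l) *s R (\<zeta> ^ k))"
      by (intro entire_map_smult entire_map_compose[OF R(1)] holomorphic_intros)
    moreover have "\<zeta> ^ l *s (\<zeta> ^ (k - l) *s R (\<zeta> ^ k)) = F (\<zeta> ^ k) - F 0" for \<zeta>
      unfolding FR using k by (simp add: vector_smult_assoc flip: power_add)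
    ultimately show "\<exists>\<Psi>. entire_map \<Psi> \<and> (\<forall>\<zeta>. norm \<zeta> = 1 \<longrightarrow> norm (\<zeta> ^ l *s \<Psi> \<zeta> - (F (\<zeta> ^ k) - F 0)) < e)"
      using e by (intro exI[of _ "\<lambda>\<zeta>. \<zeta> ^ (k - l) *s R (\<zeta> ^ k)"]) auto
  qed
qed

section \<open>Gluing discs over the circle\<close>

definition good_set :: "(complex ^ 'm) set \<Rightarrow> (complex \<Rightarrow> complex ^ 'm) \<Rightarrow> (complex \<Rightarrow> complex \<Rightarrow> complex ^ 'm) \<Rightarrow> complex set" where
  "good_set V G \<Phi> = {\<zeta>. norm \<zeta> = 1 \<and> (\<forall>\<eta>. norm \<eta> = 1 \<longrightarrow> G \<zeta> + \<Phi> \<zeta> \<eta> \<in> V)}"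

text \<open>The bad points form the projection of a closed subset of the torus. Closedness gives
  measurability and later an upper semicontinuous indicator.\<close>

lemma compact_bad_set:
  assumes "open V" "entire_map G" "disc_family \<Phi>"
  shows "compact (sphere 0 1 - good_set V G \<Phi>)"
proof -
  let ?T = "sphere (0::complex) 1 \<times> sphere (0::complex) 1" and ?f = "\<lambda>p. G (fst p) + \<Phi> (fst p) (snd p)"
  have c: "continuous_on ?T ?f"
    using assms(3)
    by (intro continuous_intros continuous_on_compose2[OF entire_map_continuous[OF assms(2), of UNIV]])
       (auto simp: disc_family_def)
  have "closed (?T \<inter> ?f -` (- V))"
    by (rule continuous_closed_preimage[OF c]) (use assms(1) in \<open>auto intro!: closed_Times\<close>)
  then have "compact (?T \<inter> (?T \<inter> ?f -` (- V)))" by (intro compact_Int_closed compact_Times) auto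
  then have "compact (fst ` (?T \<inter> (?T \<inter> ?f -` (- V))))"
    by (intro compact_continuous_image continuous_intros)
  moreover have "fst ` (?T \<inter> (?T \<inter> ?f -` (- V))) = sphere 0 1 - good_set V G \<Phi>"
    by (force simp: good_set_def image_iff)
  ultimately show ?thesis by simp
qed

text \<open>The bound \<open>M\<close> is chosen before \<open>\<epsilon>\<close>: it determines how
  strongly bad points must be damped, and only afterwards is their measure made small enough to pay
  for that.\<close>

definition fillable :: "(complex ^ 'm) set \<Rightarrow> (complex \<Rightarrow> complex ^ 'm) \<Rightarrow> complex set \<Rightarrow> bool" where
  "fillable V G U \<longleftrightarrow> (\<exists>M. \<forall>\<epsilon>>0. \<exists>\<Phi>. disc_family \<Phi> \<and>
     (\<forall>\<zeta> \<eta>. norm \<zeta> = 1 \<longrightarrow> norm \<eta> = 1 \<longrightarrow> norm (\<Phi> \<zeta> \<eta>) \<le> M) \<and>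
     measure arc_measure (U \<inter> (sphere 0 1 - good_set V G \<Phi>)) < \<epsilon>)"

text \<open>A disc centred at \<open>G \<zeta>0\<close> with boundary in \<open>V\<close> can be
  translated to the centres \<open>G \<zeta>\<close> for all nearby \<open>\<zeta>\<close>, so a
  family constant in \<open>\<zeta>\<close> has no bad points there.\<close>

lemma fillable_ball:
  assumes V: "open V" and G: "entire_map G" and hull: "G \<zeta>0 \<in> disc_hull V"
  shows "\<exists>d>0. fillable V G (ball \<zeta>0 d)"
proof -
  from hull obtain F where F: "entire_map F" "\<And>\<zeta>. norm \<zeta> = 1 \<Longrightarrow> F \<zeta> \<in> V" "F 0 = G \<zeta>0" by (rule disc_hullE) blast
  obtain e where e: "e > 0" "\<And>\<zeta> w. norm \<zeta> = 1 \<Longrightarrow> dist (F \<zeta>) w < e \<Longrightarrow> w \<in> V"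
    using entire_map_image_margin[OF F(1) V F(2)] by blast
  have "isCont G \<zeta>0"
    using entire_map_continuous[OF G, of UNIV] by (simp add: continuous_on_eq_continuous_at)
  then obtain d where d: "d > 0" "\<And>\<zeta>. dist \<zeta> \<zeta>0 < d \<Longrightarrow> dist (G \<zeta>) (G \<zeta>0) < e"
    using e(1) unfolding continuous_at_eps_delta by blast
  obtain M where M: "\<And>\<eta>. norm \<eta> = 1 \<Longrightarrow> norm (F \<eta> - F 0) \<le> M"
    using disc_family_bounded[OF disc_family_entire[OF F(1)]] norm_one by metis
  have "G \<zeta> + (F \<eta> - F 0) \<in> V" if "dist \<zeta> \<zeta>0 < d" "norm \<eta> = 1" for \<zeta> \<eta>
    by (rule e(2)[OF that(2)]) (use d(2)[OF that(1)] in \<open>simp add: dist_norm F(3) algebra_simps norm_minus_commute\<close>)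
  then have "ball \<zeta>0 d \<inter> (sphere 0 1 - good_set V G (\<lambda>\<zeta> \<eta>. F \<eta> - F 0)) = {}"
    by (auto simp: good_set_def dist_commute)
  then have "fillable V G (ball \<zeta>0 d)"
    unfolding fillable_def using M disc_family_entire[OF F(1)]
    by (intro exI[of _ M] allI impI exI[of _ "\<lambda>\<zeta> \<eta>. F \<eta> - F 0"]) auto
  then show ?thesis using d(1) by blast
qed

lemma fillable_empty: "fillable V G {}"
  unfolding fillable_def
  using disc_family_entire[OF entire_map_const[of 0]]
  by (intro exI[of _ 0] allI impI exI[of _ "\<lambda>\<zeta> \<eta>. 0"]) auto

text \<open>The two families are interpolated by a cutoff that is 0 off \<open>U1\<close> and 1 on
  \<open>U1\<close> except in a layer \<open>B m\<close> along its boundary. In the layer the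
  interpolated discs may leave \<open>V\<close>, but the layers shrink to the empty set, so their
  measure tends to 0.\<close>

lemma fillable_Un:
  assumes V: "open V" and G: "entire_map G"
    and U: "open U1" "U1 \<noteq> UNIV" "open U2" and f: "fillable V G U1" "fillable V G U2"
  shows "fillable V G (U1 \<union> U2)"
proof -
  obtain M1 where M1: "\<And>\<epsilon>. \<epsilon> > 0 \<Longrightarrow> \<exists>\<Phi>. disc_family \<Phi> \<and>
     (\<forall>\<zeta> \<eta>. norm \<zeta> = 1 \<longrightarrow> norm \<eta> = 1 \<longrightarrow> norm (\<Phi> \<zeta> \<eta>) \<le> M1) \<and>
     measure arc_measure (U1 \<inter> (sphere 0 1 - good_set V G \<Phi>)) < \<epsilon>"
    using f(1) unfolding fillable_def by blast
  obtain M2 where M2: "\<And>\<epsilon>. \<epsilon> > 0 \<Longrightarrow> \<exists>\<Phi>. disc_family \<Phi> \<and>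
     (\<forall>\<zeta> \<eta>. norm \<zeta> = 1 \<longrightarrow> norm \<eta> = 1 \<longrightarrow> norm (\<Phi> \<zeta> \<eta>) \<le> M2) \<and>
     measure arc_measure (U2 \<inter> (sphere 0 1 - good_set V G \<Phi>)) < \<epsilon>"
    using f(2) unfolding fillable_def by blast
  \<comment> \<open>\<open>infdist\<close> to the empty set is 0 by convention;
    \<open>U1 \<noteq> UNIV\<close> is what makes \<open>\<delta>\<close> positive on
    \<open>U1\<close>.\<close>
  define \<delta> where "\<delta> = (\<lambda>\<zeta>::complex. infdist \<zeta> (- U1))"
  have \<delta>c: "continuous_on A \<delta>" for A unfolding \<delta>_def by (intro continuous_intros)
  have \<delta>0: "\<delta> \<zeta> \<ge> 0" for \<zeta> by (simp add: \<delta>_def infdist_nonneg)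
  have \<delta>U: "\<delta> \<zeta> = 0 \<longleftrightarrow> \<zeta> \<notin> U1" for \<zeta>
    using in_closed_iff_infdist_zero[of "- U1" \<zeta>] U by (auto simp: \<delta>_def)
  define B where "B = (\<lambda>m::nat. {\<zeta>. 0 < \<delta> \<zeta> \<and> m * \<delta> \<zeta> < 1})"
  have [measurable]: "\<delta> \<in> borel_measurable borel" by (intro borel_measurable_continuous_onI \<delta>c)
  have [measurable]: "B m \<in> sets borel" for m unfolding B_def by measurable
  have meas0: "(\<lambda>m. measure arc_measure (B m)) \<longlonglongrightarrow> 0"
  proof -
    have "(\<lambda>m. \<integral>\<zeta>. indicator (B m) \<zeta> \<partial>arc_measure) \<longlonglongrightarrow> (\<integral>\<zeta>. (0::real) \<partial>arc_measure)"
    proof (rule integral_dominated_convergence[where w = "\<lambda>_. 1"])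
      have ev: "\<forall>\<^sub>F m in sequentially. \<zeta> \<notin> B m" for \<zeta>
      proof (cases "\<delta> \<zeta> = 0")
        case False
        then have pos: "\<delta> \<zeta> > 0" using \<delta>0[of \<zeta>] by simp
        obtain m0 :: nat where m0: "1 / \<delta> \<zeta> < m0" using reals_Archimedean2 by blast
        have "\<zeta> \<notin> B m" if "m \<ge> m0" for m
        proof -
          have "1 < m0 * \<delta> \<zeta>" using m0 pos by (simp add: field_simps)
          also have "\<dots> \<le> m * \<delta> \<zeta>" using that pos by (intro mult_right_mono) auto
          finally show ?thesis by (simp add: B_def)
        qed
        then show ?thesis by (auto simp: eventually_sequentially)
      qed (simp add: B_def)
      show "AE \<zeta> in arc_measure. (\<lambda>m. indicator (B m) \<zeta> :: real) \<longlonglongrightarrow> 0"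
      proof (rule AE_I2, rule tendsto_eventually)
        fix \<zeta>
        show "\<forall>\<^sub>F m in sequentially. (indicator (B m) \<zeta> :: real) = 0"
          using ev[of \<zeta>] by eventually_elim simp
      qed
    qed (auto simp: indicator_def)
    then show ?thesis by simp
  qed
  show ?thesis
    unfolding fillable_def
  proof (intro exI[of _ "max M1 M2"] allI impI)
    fix \<epsilon> :: real assume eps: "\<epsilon> > 0"
    then have e3: "\<epsilon> / 3 > 0" by simp
    obtain \<Phi>1 where \<Phi>1: "disc_family \<Phi>1" "\<And>\<zeta> \<eta>. norm \<zeta> = 1 \<Longrightarrow> norm \<eta> = 1 \<Longrightarrow> norm (\<Phi>1 \<zeta> \<eta>) \<le> M1"
      "measure arc_measure (U1 \<inter> (sphere 0 1 - good_set V G \<Phi>1)) < \<epsilon> / 3" using M1[OF e3] by blast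
    obtain \<Phi>2 where \<Phi>2: "disc_family \<Phi>2" "\<And>\<zeta> \<eta>. norm \<zeta> = 1 \<Longrightarrow> norm \<eta> = 1 \<Longrightarrow> norm (\<Phi>2 \<zeta> \<eta>) \<le> M2"
      "measure arc_measure (U2 \<inter> (sphere 0 1 - good_set V G \<Phi>2)) < \<epsilon> / 3" using M2[OF e3] by blast
    obtain m where m: "measure arc_measure (B m) < \<epsilon> / 3"
      using order_tendstoD(2)[OF meas0 e3] by (auto simp: eventually_sequentially)
    define \<theta> where "\<theta> = (\<lambda>\<zeta>. min 1 (m * \<delta> \<zeta>))"
    have \<theta>c: "continuous_on A \<theta>" for A unfolding \<theta>_def by (intro continuous_intros \<delta>c)
    have \<theta>: "0 \<le> \<theta> \<zeta>" "\<theta> \<zeta> \<le> 1" for \<zeta> using \<delta>0[of \<zeta>] by (auto simp: \<theta>_def)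
    define \<Phi> where "\<Phi> = (\<lambda>\<zeta> \<eta>. of_real (\<theta> \<zeta>) *s \<Phi>1 \<zeta> \<eta> + of_real (1 - \<theta> \<zeta>) *s \<Phi>2 \<zeta> \<eta>)"
    have "disc_family \<Phi>"
      unfolding \<Phi>_def by (intro disc_family_add disc_family_mult \<Phi>1 \<Phi>2 continuous_intros \<theta>c)
    moreover have "norm (\<Phi> \<zeta> \<eta>) \<le> max M1 M2" if z: "norm \<zeta> = 1" "norm \<eta> = 1" for \<zeta> \<eta>
    proof -
      have "norm (\<Phi> \<zeta> \<eta>) \<le> \<theta> \<zeta> * norm (\<Phi>1 \<zeta> \<eta>) + (1 - \<theta> \<zeta>) * norm (\<Phi>2 \<zeta> \<eta>)"
        unfolding \<Phi>_def using \<theta>[of \<zeta>]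
        by (intro order_trans[OF norm_triangle_ineq]) (simp add: norm_vector_smult del: of_real_diff)
      also have "\<dots> \<le> \<theta> \<zeta> * max M1 M2 + (1 - \<theta> \<zeta>) * max M1 M2"
        using \<theta>[of \<zeta>] \<Phi>1(2)[OF z] \<Phi>2(2)[OF z] by (intro add_mono mult_left_mono) auto
      also have "\<dots> = max M1 M2" by (simp add: algebra_simps)
      finally show ?thesis .
    qed
    moreover have "measure arc_measure ((U1 \<union> U2) \<inter> (sphere 0 1 - good_set V G \<Phi>)) < \<epsilon>"
    proof -
      let ?A1 = "U1 \<inter> (sphere 0 1 - good_set V G \<Phi>1)" and ?A2 = "U2 \<inter> (sphere 0 1 - good_set V G \<Phi>2)"
      have sets: "?A1 \<in> sets borel" "?A2 \<in> sets borel"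
        using borel_compact[OF compact_bad_set[OF V G \<Phi>1(1)]] borel_compact[OF compact_bad_set[OF V G \<Phi>2(1)]] U
        by auto
      have "(U1 \<union> U2) \<inter> (sphere 0 1 - good_set V G \<Phi>) \<subseteq> ?A1 \<union> ?A2 \<union> B m"
      proof
        fix \<zeta> assume z: "\<zeta> \<in> (U1 \<union> U2) \<inter> (sphere 0 1 - good_set V G \<Phi>)"
        show "\<zeta> \<in> ?A1 \<union> ?A2 \<union> B m"
        proof (rule ccontr)
          assume n: "\<zeta> \<notin> ?A1 \<union> ?A2 \<union> B m"
          have "\<zeta> \<in> good_set V G \<Phi>"
          proof (cases "\<zeta> \<in> U1")
            case True
            then have "\<delta> \<zeta> > 0" using \<delta>U[of \<zeta>] \<delta>0[of \<zeta>] by fastforce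
            then have "\<theta> \<zeta> = 1" using n by (auto simp: \<theta>_def B_def)
            then show ?thesis using n z True by (auto simp: good_set_def \<Phi>_def)
          next
            case False
            then have "\<theta> \<zeta> = 0" using \<delta>U[of \<zeta>] by (auto simp: \<theta>_def)
            then show ?thesis using n z False by (auto simp: good_set_def \<Phi>_def)
          qed
          then show False using z by blast
        qed
      qed
      then have "measure arc_measure ((U1 \<union> U2) \<inter> (sphere 0 1 - good_set V G \<Phi>)) \<le> measure arc_measure (?A1 \<union> ?A2 \<union> B m)"
        using sets by (intro arc.finite_measure_mono) auto
      also have "\<dots> \<le> measure arc_measure (?A1 \<union> ?A2) + measure arc_measure (B m)"
        using sets by (intro measure_Un_le) auto
      also have "\<dots> \<le> measure arc_measure ?A1 + measure arc_measure ?A2 + measure arc_measure (B m)"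
        using sets by (intro add_right_mono measure_Un_le) auto
      also have "\<dots> < \<epsilon>" using \<Phi>1(3) \<Phi>2(3) m by linarith
      finally show ?thesis .
    qed
    ultimately show "\<exists>\<Phi>. disc_family \<Phi> \<and>
     (\<forall>\<zeta> \<eta>. norm \<zeta> = 1 \<longrightarrow> norm \<eta> = 1 \<longrightarrow> norm (\<Phi> \<zeta> \<eta>) \<le> max M1 M2) \<and>
     measure arc_measure ((U1 \<union> U2) \<inter> (sphere 0 1 - good_set V G \<Phi>)) < \<epsilon>" by blast
  qed
qed

lemma fillable_circle:
  assumes V: "open V" and G: "entire_map G" and hull: "\<And>\<zeta>. norm \<zeta> = 1 \<Longrightarrow> G \<zeta> \<in> disc_hull V"
  obtains U where "sphere 0 1 \<subseteq> U" "fillable V G U"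
proof -
  have "\<forall>\<zeta>\<in>sphere 0 1. \<exists>d>0. fillable V G (ball \<zeta> d)"
    using fillable_ball[OF V G hull] by auto
  then obtain d where d: "\<And>\<zeta>. \<zeta> \<in> sphere 0 1 \<Longrightarrow> d \<zeta> > 0 \<and> fillable V G (ball \<zeta> (d \<zeta>))" by metis
  have cover: "sphere 0 1 \<subseteq> (\<Union>\<zeta>\<in>sphere 0 1. ball \<zeta> (d \<zeta>))" using d by auto
  obtain D where D: "D \<subseteq> sphere 0 1" "finite D" "sphere 0 1 \<subseteq> (\<Union>\<zeta>\<in>D. ball \<zeta> (d \<zeta>))"
    by (rule compactE_image[OF compact_sphere _ cover]) auto
  have "fillable V G (\<Union>\<zeta>\<in>D. ball \<zeta> (d \<zeta>))"
    using D(2,1)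
  proof (induction rule: finite_induct)
    case (insert \<zeta> D)
    have "ball \<zeta> (d \<zeta>) \<noteq> UNIV" using bounded_ball[of \<zeta> "d \<zeta>"] not_bounded_UNIV by metis
    then show ?case
      using fillable_Un[OF V G, of "ball \<zeta> (d \<zeta>)" "\<Union>\<zeta>\<in>D. ball \<zeta> (d \<zeta>)"] insert d by auto
  qed (simp add: fillable_empty)
  then show ?thesis using D(3) that by blast
qed

text \<open>
  The discs through the points \<open>G \<zeta>\<close> are glued, except on a set of small measure where the
  glued family leaves \<open>V\<close>. There it is multiplied by a function of small modulus that takes it
  into \<open>ball 0 \<rho>\<close>; this accounts for the loss of the factor \<open>exp (- \<epsilon>)\<close> at the centre.
\<close>

theorem disc_hull_idempotent:
  fixes V :: "(complex ^ 'm) set"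
  assumes V: "open V" "circled V" and \<rho>: "\<rho> > 0" "ball 0 \<rho> \<subseteq> V"
    and G: "entire_map G" and hull: "\<And>\<zeta>. norm \<zeta> = 1 \<Longrightarrow> G \<zeta> \<in> disc_hull V" and eps: "\<epsilon> > 0"
  shows "of_real (exp (- \<epsilon>)) *s G 0 \<in> disc_hull V"
proof -
  obtain U where U: "sphere 0 1 \<subseteq> U" "fillable V G U"
    using fillable_circle[OF V(1) G hull] by blast
  obtain M where M: "\<And>\<epsilon>. \<epsilon> > 0 \<Longrightarrow> \<exists>\<Phi>. disc_family \<Phi> \<and>
     (\<forall>\<zeta> \<eta>. norm \<zeta> = 1 \<longrightarrow> norm \<eta> = 1 \<longrightarrow> norm (\<Phi> \<zeta> \<eta>) \<le> M) \<and>
     measure arc_measure (U \<inter> (sphere 0 1 - good_set V G \<Phi>)) < \<epsilon>"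
    using U(2) unfolding fillable_def by blast
  have "bounded (G ` sphere 0 1)"
    by (intro compact_imp_bounded compact_continuous_image entire_map_continuous G) simp
  then obtain N where N: "\<And>\<zeta>. norm \<zeta> = 1 \<Longrightarrow> norm (G \<zeta>) \<le> N"
    unfolding bounded_iff by (metis image_eqI mem_sphere_0)
  define M' where "M' = \<bar>M\<bar> + \<bar>N\<bar> + 1"
  \<comment> \<open>From \<open>exp lam > lam\<close> it follows that damping by
    \<open>exp (- lam)\<close> takes vectors of norm at most \<open>M'\<close> into the ball. As
    \<open>lam\<close> does not depend on the family, the bad set can be made small relative to
    it.\<close>
  define lam where "lam = M' / \<rho>"
  have M': "M' > 0" by (simp add: M'_def)
  have lam: "lam > 0" using M' \<rho> by (simp add: lam_def)
  have "exp lam > lam" using exp_ge_add_one_self[of lam] by linarith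
  then have "M' < \<rho> * exp lam" using \<rho> by (simp add: lam_def field_simps)
  then have lam2: "exp (- lam) * M' < \<rho>" by (simp add: exp_minus field_simps)
  have "\<epsilon> / (3 * lam) > 0" using eps lam by simp
  from M[OF this] obtain \<Phi> where \<Phi>: "disc_family \<Phi>"
    "\<And>\<zeta> \<eta>. norm \<zeta> = 1 \<Longrightarrow> norm \<eta> = 1 \<Longrightarrow> norm (\<Phi> \<zeta> \<eta>) \<le> M"
    "measure arc_measure (U \<inter> (sphere 0 1 - good_set V G \<Phi>)) < \<epsilon> / (3 * lam)" by blast
  define bad where "bad = sphere 0 1 - good_set V G \<Phi>"
  have bad_eq: "U \<inter> (sphere 0 1 - good_set V G \<Phi>) = bad" using U(1) by (auto simp: bad_def)
  have cbad: "compact bad" unfolding bad_def by (rule compact_bad_set[OF V(1) G \<Phi>(1)])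
  have [measurable]: "bad \<in> sets borel" by (rule borel_compact[OF cbad])
  have mbad: "lam * measure arc_measure bad \<le> \<epsilon> / 3"
    using \<Phi>(3) lam unfolding bad_eq by (simp add: field_simps)
  \<comment> \<open>The required damping exponent. It is upper semicontinuous because
    \<open>bad\<close> is closed, and its mean is at most \<open>\<epsilon> / 3\<close>.\<close>
  define e where "e = (\<lambda>\<zeta>. lam * indicator bad \<zeta> :: real)"
  have e_bd: "\<bar>e \<zeta>\<bar> \<le> lam" for \<zeta> using lam by (simp add: e_def indicator_def)
  have e_usc: "\<exists>d>0. \<forall>w. norm w = 1 \<and> dist w \<zeta> < d \<longrightarrow> e w < y" if "norm \<zeta> = 1" "e \<zeta> < y" for \<zeta> y
  proof (cases "\<zeta> \<in> bad")
    case True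
    then have "lam < y" using that by (simp add: e_def)
    then have "e w < y" for w using e_bd[of w] by linarith
    then show ?thesis by (intro exI[of _ 1]) auto
  next
    case False
    then obtain d where d: "d > 0" "ball \<zeta> d \<subseteq> - bad"
      using compact_imp_closed[OF cbad] open_contains_ball[of "- bad"] by auto
    have "e w < y" if "dist w \<zeta> < d" for w
    proof -
      have "w \<notin> bad" using d(2) that by (auto simp: dist_commute)
      then show ?thesis using \<open>e \<zeta> < y\<close> False by (simp add: e_def)
    qed
    then show ?thesis using d(1) by blast
  qed
  have eps3: "\<epsilon> / 3 > 0" and eps6: "\<epsilon> / 6 > 0" using eps by simp_all
  obtain c where c: "continuous_on UNIV c" "\<And>\<zeta>. norm \<zeta> = 1 \<Longrightarrow> e \<zeta> \<le> c \<zeta>" "circle_mean c \<le> circle_mean e + \<epsilon> / 3"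
    using usc_continuous_majorant(2)[OF e_bd e_usc eps3] by blast
  have cs: "continuous_on (sphere 0 1) c" by (rule continuous_on_subset[OF c(1)]) simp
  have "circle_mean e = integral\<^sup>L arc_measure e"
    unfolding e_def by (rule integral_arc_measure[symmetric]) measurable
  also have "\<dots> = lam * measure arc_measure bad" unfolding e_def by simp
  finally have mean_c: "circle_mean c \<le> 2 * (\<epsilon> / 3)" using c(3) mbad by linarith
  \<comment> \<open>The shift by the size of the error places \<open>Re P\<close> between
    \<open>- c - \<epsilon> / 3\<close> and \<open>- c\<close>. As \<open>c\<close> has mean at most
    \<open>2 * (\<epsilon> / 3)\<close>, the total loss at the centre is at most
    \<open>\<epsilon>\<close>.\<close>
  have "continuous_on (sphere 0 1) (\<lambda>\<zeta>. - c \<zeta> - \<epsilon> / 6)" by (intro continuous_intros cs)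
  from Re_entire_approximation[OF this eps6] obtain P where P: "P holomorphic_on UNIV"
    "\<And>z. norm z = 1 \<Longrightarrow> \<bar>Re (P z) - (- c z - \<epsilon> / 6)\<bar> < \<epsilon> / 6" by blast
  have P1: "Re (P z) \<le> - c z" "- c z - \<epsilon> / 3 \<le> Re (P z)" if "norm z = 1" for z
    using P(2)[OF that] unfolding abs_less_iff by linarith+
  have Pc: "continuous_on A P" for A
    using P(1) by (meson holomorphic_on_imp_continuous_on holomorphic_on_subset subset_UNIV)
  have "Re (P 0) = circle_mean (\<lambda>z. Re (P z))"
    by (rule circle_mean_Re_holomorphic[symmetric]) (auto intro: Pc holomorphic_on_subset[OF P(1)])
  also have "\<dots> \<ge> circle_mean (\<lambda>z. - c z - \<epsilon> / 3)"
    by (intro circle_mean_mono continuous_intros cs Pc P1)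
  also have "circle_mean (\<lambda>z. - c z - \<epsilon> / 3) = 0 - circle_mean c - \<epsilon> / 3"
    using circle_mean_diff[of "\<lambda>_. 0" c] circle_mean_diff[of "\<lambda>z. 0 - c z" "\<lambda>_. \<epsilon> / 3"] cs
    by (simp add: continuous_intros)
  finally have P0: "Re (P 0) \<ge> - \<epsilon>" using mean_c by simp
  have nexpP: "norm (exp (P \<zeta>)) \<le> exp (- e \<zeta>)" if "norm \<zeta> = 1" for \<zeta>
    using P1(1)[OF that] c(2)[OF that] by (simp add: norm_exp_eq_Re)
  have nexpP1: "norm (exp (P \<zeta>)) \<le> 1" if "norm \<zeta> = 1" for \<zeta>
    using nexpP[OF that] lam by (auto simp: e_def indicator_def intro: order_trans split: if_splits)
  define \<Theta> where "\<Theta> = (\<lambda>p. exp (P (fst p)) *s (G (fst p) + \<Phi> (fst p) (snd p)))"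
  have \<Theta>V: "\<Theta> p \<in> V" if pm: "p \<in> sphere 0 1 \<times> sphere 0 1" for p
  proof -
    obtain \<zeta> \<eta> where p: "p = (\<zeta>, \<eta>)" "norm \<zeta> = 1" "norm \<eta> = 1"
      using pm by (cases p) auto
    show ?thesis
    proof (cases "\<zeta> \<in> bad")
      case True
      have "norm (G \<zeta> + \<Phi> \<zeta> \<eta>) \<le> M'"
        using norm_triangle_ineq[of "G \<zeta>" "\<Phi> \<zeta> \<eta>"] N[OF p(2)] \<Phi>(2)[OF p(2,3)] by (simp add: M'_def)
      moreover have "norm (exp (P \<zeta>)) \<le> exp (- lam)" using nexpP[OF p(2)] True by (simp add: e_def)
      ultimately have "norm (\<Theta> p) \<le> exp (- lam) * M'"
        unfolding \<Theta>_def norm_vector_smult p(1) fst_conv snd_conv by (intro mult_mono) auto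
      then show ?thesis using lam2 \<rho>(2) by auto
    next
      case False
      then have "G \<zeta> + \<Phi> \<zeta> \<eta> \<in> V" using p by (auto simp: bad_def good_set_def)
      then have "exp (P \<zeta>) *s (G \<zeta> + \<Phi> \<zeta> \<eta>) \<in> V"
        using V(2) nexpP1[OF p(2)] unfolding circled_def by blast
      then show ?thesis unfolding \<Theta>_def p(1) fst_conv snd_conv .
    qed
  qed
  have "compact (\<Theta> ` (sphere 0 1 \<times> sphere 0 1))"
    unfolding \<Theta>_def using \<Phi>(1)
    by (intro compact_continuous_image compact_Times continuous_intros
        continuous_on_compose2[OF Pc[of UNIV]] continuous_on_compose2[OF entire_map_continuous[OF G, of UNIV]])
       (auto simp: disc_family_def)
  moreover have "\<Theta> ` (sphere 0 1 \<times> sphere 0 1) \<subseteq> V" using \<Theta>V by blast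
  ultimately obtain e0 where e0: "e0 > 0" "\<And>x y. x \<in> \<Theta> ` (sphere 0 1 \<times> sphere 0 1) \<Longrightarrow> dist x y < e0 \<Longrightarrow> y \<in> V"
    using compact_margin[OF _ V(1)] by metis
  \<comment> \<open>The power 1 is taken because \<open>t *s \<Psi> t\<close> vanishes at 0, so the
    glued disc keeps its centre up to the damping factor.\<close>
  obtain k \<Psi> where \<Psi>: "entire_map \<Psi>" "\<And>\<zeta>. norm \<zeta> = 1 \<Longrightarrow> norm (\<zeta> ^ 1 *s \<Psi> \<zeta> - \<Phi> \<zeta> (\<zeta> ^ k)) < e0"
    using \<Phi>(1) e0(1) unfolding disc_family_def by (metis order_refl)
  define D where "D = (\<lambda>t. exp (P t) *s (G t + t *s \<Psi> t))"
  have "D 0 \<in> disc_hull V"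
  proof (rule disc_hullI)
    show "entire_map D"
      unfolding D_def by (intro entire_map_smult entire_map_add G \<Psi>(1) holomorphic_intros P(1))
    fix \<zeta> :: complex assume z: "norm \<zeta> = 1"
    have mem: "\<Theta> (\<zeta>, \<zeta> ^ k) \<in> \<Theta> ` (sphere 0 1 \<times> sphere 0 1)" using z by (auto simp: norm_power)
    have eq: "\<Theta> (\<zeta>, \<zeta> ^ k) - D \<zeta> = - (exp (P \<zeta>) *s (\<zeta> ^ 1 *s \<Psi> \<zeta> - \<Phi> \<zeta> (\<zeta> ^ k)))"
      by (simp add: \<Theta>_def D_def vec_eq_iff algebra_simps)
    have "dist (\<Theta> (\<zeta>, \<zeta> ^ k)) (D \<zeta>) \<le> 1 * norm (\<zeta> ^ 1 *s \<Psi> \<zeta> - \<Phi> \<zeta> (\<zeta> ^ k))"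
      unfolding dist_norm eq norm_minus_cancel norm_vector_smult
      by (intro mult_right_mono nexpP1 z) auto
    also have "\<dots> < e0" using \<Psi>(2)[OF z] by simp
    finally show "D \<zeta> \<in> V" by (rule e0(2)[OF mem])
  qed
  moreover have "D 0 = exp (P 0) *s G 0" by (simp add: D_def)
  \<comment> \<open>The hull is circled, so the surplus in modulus and the phase of
    \<open>exp (P 0)\<close> can be removed together.\<close>
  moreover have "norm (of_real (exp (- \<epsilon>)) / exp (P 0)) \<le> 1"
    using P0 by (simp add: norm_divide norm_exp_eq_Re)
  ultimately have "(of_real (exp (- \<epsilon>)) / exp (P 0)) *s (exp (P 0) *s G 0) \<in> disc_hull V"
    using circled_disc_hull[OF V(2)] unfolding circled_def by metis
  then show ?thesis by (simp add: vector_smult_assoc)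
qed

section \<open>The extremal function and the disc hull\<close>

lemma norm_homogenize_le: "norm (homogenize x) \<le> 1 + norm (x :: complex ^ 'n)"
proof -
  have "(\<Sum>i\<in>UNIV. (norm (homogenize x $ i))\<^sup>2) = 1 + (\<Sum>i\<in>UNIV. (norm (x $ i))\<^sup>2)"
    unfolding UNIV_option_conv by (subst sum.insert) (auto simp: sum.reindex)
  then have "(norm (homogenize x))\<^sup>2 = 1 + (norm x)\<^sup>2"
    by (simp add: norm_vec_def L2_set_def sum_nonneg)
  also have "\<dots> \<le> (1 + norm x)\<^sup>2" by (simp add: power2_eq_square algebra_simps)
  finally show ?thesis by (rule power2_le_imp_le) simp
qed

lemma continuous_on_homogenize [continuous_intros]:
  assumes "continuous_on A f"
  shows "continuous_on A (\<lambda>x. homogenize (f x :: complex ^ 'n))"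
proof (rule vec_continuous_on)
  show "continuous_on A (\<lambda>x. homogenize (f x) $ i)" for i
    using assms by (cases i) (auto intro!: continuous_intros)
qed

lemma entire_map_homogenize_line: "entire_map (\<lambda>t. homogenize (a + t *s b))"
  unfolding entire_map_def
proof
  show "(\<lambda>t. homogenize (a + t *s b) $ i) holomorphic_on UNIV" for i
    by (cases i) (auto intro!: holomorphic_intros)
qed

lemma circled_mono:
  assumes "circled H" "c *s v \<in> H" "norm d \<le> norm c"
  shows "d *s v \<in> H"
proof (cases "c = 0")
  case True
  then show ?thesis using assms by simp
next
  case False
  then have "norm (d / c) \<le> 1" using assms(3) by (simp add: norm_divide)
  then have "(d / c) *s (c *s v) \<in> H" using assms(1,2) unfolding circled_def by blast
  then show ?thesis using False by (simp add: vector_smult_assoc)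
qed

text \<open>
  The logarithmic gauge \<open>E x\<close>, the infimum of all \<open>t\<close> with \<open>exp (- t) *s homogenize x\<close> in the hull,
  belongs to the Lelong class, and idempotency of the hull is its sub-mean value inequality.
\<close>

theorem hull_of_siciak_less:
  fixes X :: "(complex ^ 'n) set"
  assumes V: "open V" "circled V" and \<rho>: "\<rho> > 0" "ball 0 \<rho> \<subseteq> V"
    and V1: "\<And>w. w \<in> V \<Longrightarrow> norm (w $ None) \<le> 1"
    and X: "\<And>x t. x \<in> X \<Longrightarrow> 0 < t \<Longrightarrow> t < 1 \<Longrightarrow> of_real t *s homogenize x \<in> V"
    and less: "siciak_extremal X z < ereal s"
  shows "of_real (exp (- s)) *s homogenize z \<in> disc_hull V"
proof -
  define H where "H = disc_hull V"
  have oH: "open H" and cH: "circled H" unfolding H_def by (intro open_disc_hull circled_disc_hull V)+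
  have VH: "V \<subseteq> H" unfolding H_def by (rule subset_disc_hull)
  define T where "T = (\<lambda>x. {t::real. of_real (exp (- t)) *s homogenize x \<in> H})"
  have T_up: "t' \<in> T x" if "t \<in> T x" "t \<le> t'" for t t' x
    using circled_mono[OF cH, of "of_real (exp (- t))" "homogenize x" "of_real (exp (- t'))"] that by (simp add: T_def)
  \<comment> \<open>The zeroth coordinate of a disc with boundary in \<open>V\<close> is at most 1
    in modulus on the circle and hence at the centre, where it is \<open>exp (- t)\<close>.\<close>
  have T_nonneg: "0 \<le> t" if tT: "t \<in> T x" for t x
  proof -
    obtain G where G: "entire_map G" "\<And>\<zeta>. norm \<zeta> = 1 \<Longrightarrow> G \<zeta> \<in> V" "G 0 = of_real (exp (- t)) *s homogenize x"
      using tT unfolding T_def H_def by (auto elim: disc_hullE)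
    let ?f = "\<lambda>t. G t $ None"
    have hf: "?f holomorphic_on UNIV" using G(1) by (simp add: entire_map_def)
    have cf: "continuous_on A ?f" for A
      using hf by (meson holomorphic_on_imp_continuous_on holomorphic_on_subset subset_UNIV)
    have "circle_mean ?f = ?f 0"
      by (rule circle_mean_holomorphic[OF cf]) (rule holomorphic_on_subset[OF hf], simp)
    moreover have "norm (circle_mean ?f) \<le> circle_mean (\<lambda>\<zeta>. norm (?f \<zeta>))"
      unfolding circle_mean_def by (rule integral_norm_bound)
    moreover have "\<dots> \<le> circle_mean (\<lambda>_. 1)"
      by (rule circle_mean_mono) (use V1 G(2) in \<open>auto intro!: continuous_intros cf\<close>)
    ultimately have "norm (?f 0) \<le> 1" by simp
    then show ?thesis by (simp add: G(3))
  qed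
  have T_mem: "t \<in> T x" if "ln (1 + norm x) - ln \<rho> < t" for t x
  proof -
    have n: "1 + norm x > 0" by (simp add: add_pos_nonneg)
    have "norm (of_real (exp (- t)) *s homogenize x) \<le> exp (- t) * (1 + norm x)"
      by (simp add: norm_vector_smult norm_homogenize_le)
    also have "\<dots> = exp (- t + ln (1 + norm x))" using n by (subst exp_add) simp
    also have "\<dots> < exp (ln \<rho>)" using that by simp
    also have "\<dots> = \<rho>" using \<rho> by simp
    finally have "of_real (exp (- t)) *s homogenize x \<in> ball 0 \<rho>" by simp
    then show ?thesis using \<rho>(2) VH by (auto simp: T_def)
  qed
  define E where "E = (\<lambda>x. Inf (T x))"
  have Tne: "T x \<noteq> {}" for x using T_mem[of x "ln (1 + norm x) - ln \<rho> + 1"] by auto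
  have Tbdd: "bdd_below (T x)" for x using T_nonneg by (intro bdd_belowI[of _ 0]) auto
  have E_le: "E x \<le> t" if "t \<in> T x" for x t unfolding E_def by (rule cInf_lower[OF that Tbdd])
  have E_0: "0 \<le> E x" for x unfolding E_def by (rule cInf_greatest[OF Tne T_nonneg])
  have E_less: "E x < t \<longleftrightarrow> (\<exists>t'<t. t' \<in> T x)" for x t
    unfolding E_def using cInf_less_iff[OF Tne Tbdd, of x t] by auto
  have E_lessD: "t \<in> T x" if "E x < t" for x t using that T_up unfolding E_less by (meson less_imp_le)
  have E_growth: "E x \<le> ln (max 1 (norm x)) + (ln 2 - ln \<rho> + 1)" for x
  proof -
    have "E x \<le> ln (1 + norm x) - ln \<rho> + 1" by (rule E_le[OF T_mem]) simp
    also have "ln (1 + norm x) \<le> ln (2 * max 1 (norm x))"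
      by (rule ln_mono) (auto simp: add_pos_nonneg)
    also have "\<dots> = ln 2 + ln (max 1 (norm x))" by (subst ln_mult) (auto simp: max_def)
    finally show ?thesis by simp
  qed
  have oE: "open {x. E x < c}" for c
  proof -
    have "{x. E x < c} = (\<Union>t\<in>{..<c}. (\<lambda>x. of_real (exp (- t)) *s homogenize x) -` H)"
      by (auto simp: E_less T_def)
    moreover have "open ((\<lambda>x. of_real (exp (- t)) *s homogenize x) -` H)" for t
      by (rule open_vimage[OF oH]) (intro continuous_intros)
    ultimately show ?thesis by auto
  qed
  define u where "u = (\<lambda>x. ereal (E x))"
  have ou: "open {x. u x < c}" for c
    by (cases c) (auto simp: u_def oE)
  have mean: "u a \<le> ereal_integral arc_measure (\<lambda>\<zeta>. u (a + \<zeta> *s b))" for a b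
  proof -
    define e where "e = (\<lambda>\<zeta>. E (a + \<zeta> *s b))"
    have e_bd: "\<bar>e \<zeta>\<bar> \<le> ln (1 + (norm a + norm b)) - ln \<rho> + 1" if "norm \<zeta> = 1" for \<zeta>
    proof -
      have "norm (a + \<zeta> *s b) \<le> norm a + norm b"
        using norm_triangle_ineq[of a "\<zeta> *s b"] that by (simp add: norm_vector_smult)
      then have "ln (1 + norm (a + \<zeta> *s b)) \<le> ln (1 + (norm a + norm b))"
        by (intro ln_mono) (auto simp: add_pos_nonneg)
      moreover have "E (a + \<zeta> *s b) \<le> ln (1 + norm (a + \<zeta> *s b)) - ln \<rho> + 1" by (rule E_le[OF T_mem]) simp
      ultimately show ?thesis using E_0[of "a + \<zeta> *s b"] by (simp add: e_def)
    qed
    have line: "continuous_on UNIV (\<lambda>\<zeta>. a + \<zeta> *s b)" by (intro continuous_intros)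
    have e_usc: "\<exists>d>0. \<forall>w. norm w = 1 \<and> dist w \<zeta> < d \<longrightarrow> e w < y" if "norm \<zeta> = 1" "e \<zeta> < y" for \<zeta> y
    proof -
      have "open ((\<lambda>\<zeta>. a + \<zeta> *s b) -` {x. E x < y})" by (rule open_vimage[OF oE line])
      moreover have "\<zeta> \<in> (\<lambda>\<zeta>. a + \<zeta> *s b) -` {x. E x < y}" using that by (simp add: e_def)
      ultimately obtain d where "d > 0" "ball \<zeta> d \<subseteq> (\<lambda>\<zeta>. a + \<zeta> *s b) -` {x. E x < y}"
        unfolding open_contains_ball by blast
      then show ?thesis by (intro exI[of _ d]) (auto simp: e_def dist_commute subset_iff)
    qed
    have int: "integrable circ (\<lambda>t. e (cis t))"
      by (rule usc_continuous_majorant(1)[OF e_bd e_usc zero_less_one])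
    have "(\<lambda>\<zeta>. u (a + \<zeta> *s b)) \<in> borel_measurable borel"
      by (rule measurable_compose[OF _ borel_measurable_usc[OF ou]])
         (intro borel_measurable_continuous_onI continuous_intros)
    then have "ereal_integral arc_measure (\<lambda>\<zeta>. u (a + \<zeta> *s b)) = ereal_integral circ (\<lambda>t. ereal (e (cis t)))"
      by (simp add: ereal_integral_arc_measure u_def e_def)
    also have "\<dots> = ereal (circle_mean e)"
      unfolding circle_mean_def by (rule ereal_integral_real[OF int])
    finally have rhs: "ereal_integral arc_measure (\<lambda>\<zeta>. u (a + \<zeta> *s b)) = ereal (circle_mean e)" .
    have "E a \<le> circle_mean e + \<epsilon>" if "\<epsilon> > 0" for \<epsilon>
    proof -
      \<comment> \<open>One share is lost in the continuous majorant, two in the approximation by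
        \<open>P\<close> and one in the idempotency of the hull.\<close>
      define \<delta> where "\<delta> = \<epsilon> / 4"
      have \<delta>: "\<delta> > 0" using that by (simp add: \<delta>_def)
      obtain c where c: "continuous_on UNIV c" "\<And>\<zeta>. norm \<zeta> = 1 \<Longrightarrow> e \<zeta> \<le> c \<zeta>" "circle_mean c \<le> circle_mean e + \<delta>"
        using usc_continuous_majorant(2)[OF e_bd e_usc \<delta>] by blast
      have cs: "continuous_on (sphere 0 1) c" by (rule continuous_on_subset[OF c(1)]) simp
      have "continuous_on (sphere 0 1) (\<lambda>\<zeta>. c \<zeta> + \<delta>)" by (intro continuous_intros cs)
      from Re_entire_approximation[OF this \<delta>] obtain P where P: "P holomorphic_on UNIV"
        "\<And>z. norm z = 1 \<Longrightarrow> \<bar>Re (P z) - (c z + \<delta>)\<bar> < \<delta>" by blast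
      have P1: "c z < Re (P z)" "Re (P z) \<le> c z + 2 * \<delta>" if "norm z = 1" for z
        using P(2)[OF that] unfolding abs_less_iff by linarith+
      have Pc: "continuous_on A P" for A
        using P(1) by (meson holomorphic_on_imp_continuous_on holomorphic_on_subset subset_UNIV)
      have "Re (P 0) = circle_mean (\<lambda>z. Re (P z))"
        by (rule circle_mean_Re_holomorphic[symmetric]) (auto intro: Pc holomorphic_on_subset[OF P(1)])
      also have "\<dots> \<le> circle_mean (\<lambda>z. c z + 2 * \<delta>)"
        by (intro circle_mean_mono continuous_intros cs Pc P1)
      also have "\<dots> = circle_mean c + 2 * \<delta>" by (subst circle_mean_add) (auto intro: cs)
      finally have P0: "Re (P 0) \<le> circle_mean e + 3 * \<delta>" using c(3) by simp
      \<comment> \<open>A scaling factor without zeros, chosen to be small enough on the circle for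
        the scaled points to lie in the hull; its modulus at 0 is given by the mean of
        \<open>Re P\<close>.\<close>
      define G where "G = (\<lambda>t. exp (- P t) *s homogenize (a + t *s b))"
      have "of_real (exp (- \<delta>)) *s G 0 \<in> H"
        unfolding H_def
      proof (rule disc_hull_idempotent[OF V \<rho> _ _ \<delta>])
        show "entire_map G" unfolding G_def by (intro entire_map_smult entire_map_homogenize_line holomorphic_intros P(1))
        fix \<zeta> :: complex assume z: "norm \<zeta> = 1"
        have "Re (P \<zeta>) \<in> T (a + \<zeta> *s b)"
          using P1(1)[OF z] c(2)[OF z] by (intro E_lessD) (simp add: e_def)
        then show "G \<zeta> \<in> disc_hull V"
          using circled_mono[OF cH, of "of_real (exp (- Re (P \<zeta>)))" "homogenize (a + \<zeta> *s b)" "exp (- P \<zeta>)"]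
          by (simp add: G_def T_def H_def norm_exp_eq_Re)
      qed
      then have "(of_real (exp (- \<delta>)) * exp (- P 0)) *s homogenize a \<in> H" by (simp add: G_def vector_smult_assoc)
      from circled_mono[OF cH this, of "of_real (exp (- (\<delta> + Re (P 0))))"]
      have "\<delta> + Re (P 0) \<in> T a" by (simp add: T_def norm_mult norm_exp_eq_Re flip: exp_add)
      then have "E a \<le> \<delta> + Re (P 0)" by (rule E_le)
      then show ?thesis using P0 by (simp add: \<delta>_def)
    qed
    then have "E a \<le> circle_mean e" by (rule field_le_epsilon)
    then show ?thesis unfolding rhs by (simp add: u_def)
  qed
  have "u \<in> lelong_class"
    unfolding lelong_class_def plurisubharmonic_def
    using ou mean E_growth by (auto simp: u_def)
  moreover have "u x \<le> 0" if "x \<in> X" for x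
  proof -
    have "E x \<le> 0 + t" if "t > 0" for t
      using X[OF \<open>x \<in> X\<close>, of "exp (- t)"] that VH by (intro E_le) (auto simp: T_def)
    then have "E x \<le> 0" by (rule field_le_epsilon)
    then show ?thesis by (simp add: u_def zero_ereal_def)
  qed
  ultimately have "u z \<le> siciak_extremal X z"
    unfolding siciak_extremal_def by (intro SUP_upper) auto
  then have "E z < s" using less by (simp add: u_def) (metis ereal_less_eq(3) leD leI order_le_less_trans less_ereal.simps(1))
  then show ?thesis using E_lessD by (simp add: T_def H_def)
qed

section \<open>Boundary behaviour of inner and outer functions\<close>

text \<open>
  Cauchy's formula for the powers \<open>g ^ m\<close> bounds them by \<open>1 / (1 - norm z)\<close>, which forces
  \<open>norm (g z) \<le> 1\<close>.
\<close>

lemma norm_le_1_if_boundary_le_1: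
  assumes hol: "g holomorphic_on ball 0 1" and M: "\<And>z. norm z < 1 \<Longrightarrow> norm (g z) \<le> M"
    and bd: "AE \<zeta> in arc_measure. \<exists>w. has_nt_limit g \<zeta> w \<and> norm w \<le> 1"
    and z: "norm z < 1"
  shows "norm (g z) \<le> 1"
proof (rule ccontr)
  assume "\<not> norm (g z) \<le> 1"
  then have big: "norm (g z) > 1" by simp
  obtain r where r: "r \<longlonglongrightarrow> 1" "\<And>j. 0 < r j" "\<And>j. r j < (1::real)" using radius_sequence by blast
  have gc: "continuous_on (ball 0 1) g" by (rule holomorphic_on_imp_continuous_on[OF hol])
  have "norm (g z) ^ m \<le> 1 / (1 - norm z)" for m
  proof -
    define f where "f = (\<lambda>j t. g (of_real (r j) * t) ^ m)"
    have fh: "f j holomorphic_on ball 0 (1 / r j)" for j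
      unfolding f_def
      by (intro holomorphic_on_power holomorphic_on_compose_gen[OF _ hol, unfolded o_def])
         (use r(2)[of j] in \<open>auto intro!: holomorphic_intros simp: norm_mult field_simps\<close>)
    have cb: "cball (0::complex) 1 \<subseteq> ball 0 (1 / r j)" for j
      using r(2,3)[of j] by (simp add: cball_subset_ball_iff)
    have fc: "continuous_on (cball 0 1) (f j)" for j
      by (rule holomorphic_on_imp_continuous_on[OF holomorphic_on_subset[OF fh cb]])
    have fc': "continuous_on (sphere 0 1) (f j)" for j
      by (rule continuous_on_subset[OF fc]) auto
    \<comment> \<open>With the maximum the integrands tend to 1 whatever the boundary modulus below
      1 is.\<close>
    have "(\<lambda>j. circle_mean (\<lambda>\<zeta>. max 1 (norm (f j \<zeta>)))) \<longlonglongrightarrow> (\<integral>t. 1 \<partial>circ)"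
      unfolding circle_mean_def
    proof (rule integral_dominated_convergence[where w = "\<lambda>_. max 1 (\<bar>M\<bar> ^ m)"])
      show "(\<lambda>t. max 1 (norm (f j (cis t)))) \<in> borel_measurable circ" for j
        by (rule measurable_compose_cis) (intro continuous_intros fc')
      have "AE t in circ. \<exists>w. has_nt_limit g (cis t) w \<and> norm w \<le> 1"
        using bd unfolding arc_measure_circ by (rule AE_distrD[OF measurable_cis_circ])
      then show "AE t in circ. (\<lambda>j. max 1 (norm (f j (cis t)))) \<longlonglongrightarrow> 1"
      proof eventually_elim
        case (elim t)
        then obtain w where w: "has_nt_limit g (cis t) w" "norm w \<le> 1" by blast
        have "(\<lambda>j. max 1 (norm (g (of_real (r j) * cis t) ^ m))) \<longlonglongrightarrow> max 1 (norm (w ^ m))"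
          by (intro tendsto_intros radial_limit[OF w(1) _ r]) simp
        moreover have "max 1 (norm (w ^ m)) = 1"
          using power_le_one[OF norm_ge_zero w(2), of m] by (simp add: norm_power max_absorb1)
        ultimately show ?case by (simp add: f_def)
      qed
      show "AE t in circ. norm (max 1 (norm (f j (cis t)))) \<le> max 1 (\<bar>M\<bar> ^ m)" for j
      proof (rule AE_I2)
        fix t
        have "norm (g (of_real (r j) * cis t)) \<le> \<bar>M\<bar>"
          using M[of "of_real (r j) * cis t"] r(2,3)[of j] by (simp add: norm_mult)
        then have "norm (f j (cis t)) \<le> \<bar>M\<bar> ^ m" by (simp add: f_def norm_power power_mono)
        then show "norm (max 1 (norm (f j (cis t)))) \<le> max 1 (\<bar>M\<bar> ^ m)" by auto
      qed
    qed auto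
    then have lim: "(\<lambda>j. circle_mean (\<lambda>\<zeta>. max 1 (norm (f j \<zeta>)))) \<longlonglongrightarrow> 1" by simp
    have bound: "norm (f j z) \<le> circle_mean (\<lambda>\<zeta>. max 1 (norm (f j \<zeta>))) / (1 - norm z)" for j
    proof -
      have "f j z = circle_mean (\<lambda>\<zeta>. f j \<zeta> * \<zeta> / (\<zeta> - z))"
        by (rule circle_mean_Cauchy[symmetric, OF fc _ z])
           (rule holomorphic_on_subset[OF fh order_trans[OF ball_subset_cball cb]])
      then have "norm (f j z) \<le> circle_mean (\<lambda>\<zeta>. norm (f j \<zeta> * \<zeta> / (\<zeta> - z)))"
        unfolding circle_mean_def using integral_norm_bound by metis
      also have "\<dots> \<le> circle_mean (\<lambda>\<zeta>. max 1 (norm (f j \<zeta>)) / (1 - norm z))"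
      proof (rule circle_mean_mono)
        show "continuous_on (sphere 0 1) (\<lambda>\<zeta>. norm (f j \<zeta> * \<zeta> / (\<zeta> - z)))"
          using z by (intro continuous_intros fc') auto
        show "continuous_on (sphere 0 1) (\<lambda>\<zeta>. max 1 (norm (f j \<zeta>)) / (1 - norm z))"
          using z by (intro continuous_intros fc') auto
        fix \<zeta> :: complex assume "norm \<zeta> = 1"
        then show "norm (f j \<zeta> * \<zeta> / (\<zeta> - z)) \<le> max 1 (norm (f j \<zeta>)) / (1 - norm z)"
          using z norm_triangle_ineq2[of \<zeta> z] by (auto simp: norm_mult norm_divide intro!: frac_le)
      qed
      also have "\<dots> = circle_mean (\<lambda>\<zeta>. max 1 (norm (f j \<zeta>))) / (1 - norm z)"
        unfolding circle_mean_def by simp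
      finally show ?thesis .
    qed
    have "(\<lambda>j. norm (f j z)) \<longlonglongrightarrow> norm (g (of_real 1 * z) ^ m)"
      unfolding f_def
    proof (intro tendsto_intros)
      have "(\<lambda>j. of_real (r j) * z) \<longlonglongrightarrow> of_real 1 * z" by (intro tendsto_intros r(1))
      then show "(\<lambda>j. g (of_real (r j) * z)) \<longlonglongrightarrow> g (of_real 1 * z)"
      proof (rule continuous_on_tendsto_compose[OF gc])
        have "norm (of_real (r j) * z) < 1" for j
          using z r(2,3)[of j] by (simp add: norm_mult mult_left_le_one_le le_less_trans[of _ "norm z"])
        then show "\<forall>\<^sub>F j in sequentially. of_real (r j) * z \<in> ball 0 1" by simp
      qed (use z in simp)
    qed
    moreover have "(\<lambda>j. circle_mean (\<lambda>\<zeta>. max 1 (norm (f j \<zeta>))) / (1 - norm z)) \<longlonglongrightarrow> 1 / (1 - norm z)"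
      using z by (intro tendsto_intros lim) auto
    ultimately have "norm (g (of_real 1 * z) ^ m) \<le> 1 / (1 - norm z)"
      using bound by (intro LIMSEQ_le) auto
    then show ?thesis by (simp add: norm_power)
  qed
  moreover obtain m where "1 / (1 - norm z) < norm (g z) ^ m"
    using real_arch_pow[OF big] by blast
  ultimately show False by (meson not_le)
qed

text \<open>Splitting off the value of \<open>k\<close> at a boundary point leaves a density that
  vanishes there and tames the singularity of the kernel.\<close>

lemma herglotz_shift:
  assumes "integrable arc_measure k" "norm z < 1"
  shows "herglotz k z = of_real x + herglotz (\<lambda>\<zeta>. k \<zeta> - x) z"
proof -
  have i: "integrable arc_measure (\<lambda>\<zeta>. k \<zeta> - x)" using assms(1) by simp
  have i1: "integrable arc_measure (\<lambda>\<zeta>. (\<zeta> + z) / (\<zeta> - z))"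
    using herglotz_integrable[of "\<lambda>_. 1" z] assms(2) by simp
  have "herglotz k z = (\<integral>\<zeta>. of_real x * ((\<zeta> + z) / (\<zeta> - z)) + (\<zeta> + z) / (\<zeta> - z) * of_real (k \<zeta> - x) \<partial>arc_measure)"
    unfolding herglotz_def by (intro Bochner_Integration.integral_cong) (auto simp: algebra_simps diff_divide_distrib)
  also have "\<dots> = (\<integral>\<zeta>. of_real x * ((\<zeta> + z) / (\<zeta> - z)) \<partial>arc_measure) + herglotz (\<lambda>\<zeta>. k \<zeta> - x) z"
    unfolding herglotz_def
    by (intro Bochner_Integration.integral_add integrable_mult_right i1 herglotz_integrable i assms(2))
  also have "(\<integral>\<zeta>. of_real x * ((\<zeta> + z) / (\<zeta> - z)) \<partial>arc_measure) = of_real x"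
    by (simp only: integral_mult_right_zero integral_herglotz_kernel[OF assms(2)] mult_1_right)
  finally show ?thesis .
qed

text \<open>For two points of the circle the kernel is purely imaginary, and at coinciding points
  division by zero gives 0. Hence the boundary modulus of an outer function comes only from the
  constant split off by \<open>herglotz_shift\<close>.\<close>

lemma Re_herglotz_boundary_kernel:
  assumes "norm \<zeta> = 1" "norm z = 1"
  shows "Re ((\<zeta> + z) / (\<zeta> - z) * of_real x) = 0"
  unfolding Re_mult_real Re_herglotz_kernel[OF assms(1)] using assms(2) by simp

text \<open>In a Stolz region the distance to the boundary point is controlled by the denominator of
  the kernel, so a density that is Lipschitz at \<open>\<zeta>0\<close> and vanishes there
  compensates the pole.\<close>

lemma stolz_dist_bound:
  assumes "z \<in> stolz \<alpha> \<zeta>0" "norm \<zeta> = 1" "\<alpha> > 1"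
  shows "norm (\<zeta> - \<zeta>0) \<le> (1 + \<alpha>) * norm (\<zeta> - z)"
proof -
  have z: "norm z < 1" "norm (z - \<zeta>0) < \<alpha> * (1 - norm z)" using assms(1) by (auto simp: stolz_def dist_norm)
  have "1 - norm z \<le> norm (\<zeta> - z)" using norm_triangle_ineq2[of \<zeta> z] assms(2) by simp
  then have "norm (z - \<zeta>0) \<le> \<alpha> * norm (\<zeta> - z)"
    using z(2) assms(3) by (smt (verit) mult_left_mono)
  moreover have "norm (\<zeta> - \<zeta>0) \<le> norm (\<zeta> - z) + norm (z - \<zeta>0)"
    using norm_triangle_ineq[of "\<zeta> - z" "z - \<zeta>0"] by simp
  ultimately show ?thesis by (simp add: algebra_simps)
qed

text \<open>After \<open>k \<zeta>0\<close> is split off, the Lipschitz bound dominates the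
  integrands uniformly in each Stolz region, and dominated convergence gives the limit. The limiting
  integral is purely imaginary.\<close>

lemma outer_nt_limit:
  assumes k: "integrable arc_measure k" and \<zeta>0: "norm \<zeta>0 = 1"
    and lip: "AE \<zeta> in arc_measure. \<bar>k \<zeta> - k \<zeta>0\<bar> \<le> L * norm (\<zeta> - \<zeta>0)"
    and L0: "L \<ge> 0"
  shows "\<exists>w. has_nt_limit (\<lambda>z. exp (herglotz k z)) \<zeta>0 w \<and> norm w = exp (k \<zeta>0)"
proof -
  have [measurable]: "k \<in> borel_measurable borel"
    using borel_measurable_integrable[OF k] by (simp cong: measurable_cong_sets)
  define k1 where "k1 = (\<lambda>\<zeta>. k \<zeta> - k \<zeta>0)"
  have [measurable]: "k1 \<in> borel_measurable borel" unfolding k1_def by measurable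
  define c where "c = (\<integral>\<zeta>. (\<zeta> + \<zeta>0) / (\<zeta> - \<zeta>0) * of_real (k1 \<zeta>) \<partial>arc_measure)"
  have cint: "integrable arc_measure (\<lambda>\<zeta>. (\<zeta> + \<zeta>0) / (\<zeta> - \<zeta>0) * of_real (k1 \<zeta>))"
  proof (rule arc.integrable_const_bound[of _ "2 * L"])
    show "AE \<zeta> in arc_measure. norm ((\<zeta> + \<zeta>0) / (\<zeta> - \<zeta>0) * of_real (k1 \<zeta>)) \<le> 2 * L"
      using lip AE_arc_norm
    proof eventually_elim
      case (elim \<zeta>)
      show ?case
      proof (cases "\<zeta> = \<zeta>0")
        case True
        then show ?thesis using L0 by (simp add: k1_def)
      next
        case False
        then have n: "norm (\<zeta> - \<zeta>0) > 0" by simp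
        have "norm (\<zeta> + \<zeta>0) \<le> 2" using norm_triangle_ineq[of \<zeta> \<zeta>0] elim \<zeta>0 by simp
        then have "norm (\<zeta> + \<zeta>0) * \<bar>k1 \<zeta>\<bar> \<le> 2 * (L * norm (\<zeta> - \<zeta>0))"
          using elim(1) by (intro mult_mono) (auto simp: k1_def)
        then have "norm (\<zeta> + \<zeta>0) * \<bar>k1 \<zeta>\<bar> / norm (\<zeta> - \<zeta>0) \<le> 2 * L"
          using n by (simp add: pos_divide_le_eq mult.assoc)
        then show ?thesis by (simp only: norm_mult norm_divide norm_of_real times_divide_eq_left)
      qed
    qed
    show "(\<lambda>\<zeta>. (\<zeta> + \<zeta>0) / (\<zeta> - \<zeta>0) * of_real (k1 \<zeta>)) \<in> borel_measurable arc_measure" by measurable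
  qed
  have Rec: "Re c = 0"
  proof -
    have "Re c = (\<integral>\<zeta>. Re ((\<zeta> + \<zeta>0) / (\<zeta> - \<zeta>0) * of_real (k1 \<zeta>)) \<partial>arc_measure)"
      unfolding c_def by (rule integral_Re[symmetric, OF cint])
    also have "\<dots> = (\<integral>\<zeta>. 0 \<partial>arc_measure)"
    proof (rule integral_cong_AE)
      show "AE \<zeta> in arc_measure. Re ((\<zeta> + \<zeta>0) / (\<zeta> - \<zeta>0) * of_real (k1 \<zeta>)) = 0"
        using AE_arc_norm by eventually_elim (rule Re_herglotz_boundary_kernel[OF _ \<zeta>0])
    qed measurable
    finally show ?thesis by simp
  qed
  have "has_nt_limit (\<lambda>z. exp (herglotz k z)) \<zeta>0 (exp (of_real (k \<zeta>0) + c))"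
    unfolding has_nt_limit_def
  proof (intro allI impI)
    fix \<alpha> :: real assume \<alpha>: "\<alpha> > 1"
    show "((\<lambda>z. exp (herglotz k z)) \<longlongrightarrow> exp (of_real (k \<zeta>0) + c)) (at \<zeta>0 within stolz \<alpha> \<zeta>0)"
      unfolding tendsto_at_iff_sequentially comp_def
    proof (intro allI impI)
      fix X assume X: "\<forall>i. X i \<in> stolz \<alpha> \<zeta>0 - {\<zeta>0}" and Xl: "X \<longlonglongrightarrow> \<zeta>0"
      have X1: "norm (X i) < 1" for i using X[rule_format, of i] by (auto simp: stolz_def)
      have "(\<lambda>i. herglotz k1 (X i)) \<longlonglongrightarrow> c"
        unfolding herglotz_def c_def
      proof (rule integral_dominated_convergence[where w = "\<lambda>_. 2 * L * (1 + \<alpha>)"])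
        show "AE \<zeta> in arc_measure. (\<lambda>i. (\<zeta> + X i) / (\<zeta> - X i) * of_real (k1 \<zeta>)) \<longlonglongrightarrow> (\<zeta> + \<zeta>0) / (\<zeta> - \<zeta>0) * of_real (k1 \<zeta>)"
        proof (rule AE_I2)
          fix \<zeta>
          show "(\<lambda>i. (\<zeta> + X i) / (\<zeta> - X i) * of_real (k1 \<zeta>)) \<longlonglongrightarrow> (\<zeta> + \<zeta>0) / (\<zeta> - \<zeta>0) * of_real (k1 \<zeta>)"
          proof (cases "\<zeta> = \<zeta>0")
            \<comment> \<open>Here the density is 0, so both sides vanish although the kernel itself
              has no limit.\<close>
            case True
            then show ?thesis by (simp add: k1_def)
          next
            case False
            then show ?thesis by (intro tendsto_intros Xl) auto
          qed
        qed
        show "AE \<zeta> in arc_measure. norm ((\<zeta> + X i) / (\<zeta> - X i) * of_real (k1 \<zeta>)) \<le> 2 * L * (1 + \<alpha>)" for i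
          using lip AE_arc_norm
        proof eventually_elim
          case (elim \<zeta>)
          have n: "norm (\<zeta> - X i) > 0" using elim X1[of i] by auto
          have "norm (\<zeta> + X i) \<le> 2" using norm_triangle_ineq[of \<zeta> "X i"] elim X1[of i] by simp
          moreover have "\<bar>k1 \<zeta>\<bar> \<le> L * ((1 + \<alpha>) * norm (\<zeta> - X i))"
            using elim(1) stolz_dist_bound[of "X i" \<alpha> \<zeta>0 \<zeta>] X elim(2) \<alpha> L0
            unfolding k1_def by (smt (verit) DiffD1 mult_left_mono)
          ultimately have "norm (\<zeta> + X i) * \<bar>k1 \<zeta>\<bar> \<le> 2 * (L * ((1 + \<alpha>) * norm (\<zeta> - X i)))"
            by (intro mult_mono) auto
          then have "norm (\<zeta> + X i) * \<bar>k1 \<zeta>\<bar> / norm (\<zeta> - X i) \<le> 2 * L * (1 + \<alpha>)"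
            using n by (simp only: pos_divide_le_eq mult.assoc)
          then show ?case by (simp only: norm_mult norm_divide norm_of_real times_divide_eq_left)
        qed
      qed (use arc.integrable_const in auto)
      then have "(\<lambda>i. exp (of_real (k \<zeta>0) + herglotz k1 (X i))) \<longlonglongrightarrow> exp (of_real (k \<zeta>0) + c)"
        by (intro tendsto_intros)
      moreover have "herglotz k (X i) = of_real (k \<zeta>0) + herglotz k1 (X i)" for i
        unfolding k1_def by (rule herglotz_shift[OF k X1])
      ultimately show "(\<lambda>i. exp (herglotz k (X i))) \<longlonglongrightarrow> exp (of_real (k \<zeta>0) + c)" by simp
    qed
  qed
  moreover have "norm (exp (of_real (k \<zeta>0) + c)) = exp (k \<zeta>0)" by (simp add: norm_exp_eq_Re Rec)
  ultimately show ?thesis by blast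
qed

section \<open>Construction of a disc over \<open>X\<close> from a point of the hull\<close>

lemma vec_differentiable_on:
  fixes F :: "'a::real_normed_vector \<Rightarrow> complex ^ 'm"
  assumes "\<And>i. (\<lambda>t. F t $ i) differentiable_on S"
  shows "F differentiable_on S"
  unfolding differentiable_on_def
proof
  fix x assume x: "x \<in> S"
  show "F differentiable at x within S"
  proof (rule differentiable_componentwise_within[THEN iffD2], rule ballI)
    fix b :: "complex ^ 'm" assume "b \<in> Basis"
    then obtain i c where b: "b = axis i c" by (auto simp: Basis_vec_def)
    have "(\<lambda>t. F t $ i) differentiable at x within S" using assms x by (auto simp: differentiable_on_def)
    then have "(\<lambda>t. F t $ i \<bullet> c) differentiable at x within S"
      by (simp add: differentiable_def) (metis has_derivative_inner_left)
    then show "(\<lambda>t. F t \<bullet> b) differentiable at x within S" by (simp add: b inner_axis)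
  qed
qed

definition unit_cone :: "(complex ^ 'n) set \<Rightarrow> (complex ^ 'n option) set" where
  "unit_cone X = {w. w $ None \<noteq> 0 \<and> affine_part w \<in> X \<and> norm (w $ None) < 1}"

lemma open_unit_cone:
  fixes X :: "(complex ^ 'n) set"
  assumes "open X"
  shows "open (unit_cone X)"
proof -
  let ?U = "{w :: complex ^ 'n option. w $ None \<noteq> 0 \<and> norm (w $ None) < 1}"
  have "open ((\<lambda>w :: complex ^ 'n option. w $ None) -` (ball 0 1 - {0}))"
    by (rule open_vimage) (auto intro!: continuous_intros)
  moreover have "(\<lambda>w :: complex ^ 'n option. w $ None) -` (ball 0 1 - {0}) = ?U" by auto
  ultimately have oU: "open ?U" by simp
  have "continuous_on ?U affine_part"
    by (rule continuous_on_affine_part[OF continuous_on_id]) auto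
  from continuous_open_preimage[OF this oU assms] have "open (?U \<inter> affine_part -` X)" .
  moreover have "unit_cone X = ?U \<inter> affine_part -` X" by (auto simp: unit_cone_def)
  ultimately show ?thesis by simp
qed

lemma unit_cone_scale: "w \<in> unit_cone X \<Longrightarrow> c \<noteq> 0 \<Longrightarrow> norm c \<le> 1 \<Longrightarrow> c *s w \<in> unit_cone X"
  by (auto simp: unit_cone_def norm_mult intro: le_less_trans[OF mult_left_le_one_le])

text \<open>Setting the zeroth coordinate to 0 leaves the cone and moves the point only by the
  modulus of that coordinate. Margins in the cone thus become lower bounds for the zeroth
  coordinate.\<close>

lemma unit_cone_ball_None:
  fixes X :: "(complex ^ 'n) set"
  assumes "ball w r \<subseteq> unit_cone X"
  shows "r \<le> norm (w $ None)"
proof (rule ccontr)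
  assume "\<not> ?thesis"
  then have less: "norm (w $ None) < r" by simp
  define v where "v = w - axis None (w $ None)"
  have "norm (axis None (w $ None) :: complex ^ 'n option) \<le> (\<Sum>i\<in>UNIV. norm ((axis None (w $ None) :: complex ^ 'n option) $ i))"
    unfolding norm_vec_def by (rule L2_set_le_sum) simp
  also have "\<dots> = (\<Sum>i\<in>(UNIV :: 'n option set). if i = None then norm (w $ None) else 0)"
    by (intro sum.cong) (auto simp: axis_def)
  also have "\<dots> = norm (w $ None)" by simp
  finally have "norm (axis None (w $ None) :: complex ^ 'n option) \<le> norm (w $ None)" .
  then have "v \<in> ball w r" using less by (simp add: v_def dist_norm)
  then have "v $ None \<noteq> 0" using assms by (auto simp: unit_cone_def)
  then show False by (simp add: v_def axis_def)
qed

lemma circled_ball_Un_unit_cone: "\<rho> > 0 \<Longrightarrow> circled (ball 0 \<rho> \<union> unit_cone X)"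
  unfolding circled_def
proof (intro allI ballI impI)
  fix c :: complex and v assume \<rho>: "\<rho> > 0" and v: "v \<in> ball 0 \<rho> \<union> unit_cone X" and c: "norm c \<le> 1"
  show "c *s v \<in> ball 0 \<rho> \<union> unit_cone X"
  proof (cases "v \<in> ball 0 \<rho>")
    case True
    have "norm (c *s v) \<le> norm v" using c by (simp add: norm_vector_smult mult_left_le_one_le)
    then show ?thesis using True by simp
  next
    case False
    then show ?thesis using v c \<rho> unit_cone_scale[of v X c] by (cases "c = 0") auto
  qed
qed

text \<open>The image of a finite measure has at most countably many atoms, and an open interval is
  uncountable.\<close>

lemma ex_null_level:
  fixes f :: "complex \<Rightarrow> real"
  assumes [measurable]: "f \<in> borel_measurable borel" and "a < b"
  obtains c where "a < c" "c < b" "measure arc_measure {\<zeta>. f \<zeta> = c} = 0"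
proof -
  interpret D: finite_measure "distr arc_measure borel f"
    by (rule arc.finite_measure_distr) simp
  have "\<exists>c\<in>{a<..<b} - {x. measure (distr arc_measure borel f) {x} \<noteq> 0}. True"
    using open_minus_countable[OF D.countable_support, of "{a<..<b}"] assms(2) by auto
  then obtain c where c: "a < c" "c < b" "measure (distr arc_measure borel f) {c} = 0" by auto
  have "measure arc_measure {\<zeta>. f \<zeta> = c} = 0"
    using c(3) by (subst (asm) measure_distr) (auto simp: vimage_def)
  then show ?thesis using that c by blast
qed

text \<open>
  On the part of the circle where \<open>G\<close> is small it need not lie over \<open>X\<close>. Let \<open>a\<close> be the outer
  function with modulus \<open>1\<close> there and \<open>\<delta>\<close> elsewhere. Then \<open>G t + a t * t *s p\<close> has the same centre;
  on the boundary it is close to \<open>G\<close> or, up to a unimodular factor, to \<open>p\<close>. For generic \<open>p\<close> it has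
  no zeros. The level \<open>\<rho>'\<close> is chosen such that the jump set \<open>N\<close> of \<open>a\<close> is null, and off \<open>N\<close>
  everything extends analytically across the circle, so that the inner and outer factors of the
  zeroth component have nontangential limits without an appeal to Fatou's theorem.
\<close>

theorem disc_of_hull:
  fixes X :: "(complex ^ 'n) set"
  assumes X: "open X" and \<rho>: "\<rho> > 0" and p0: "ball p0 (3 * \<rho>) \<subseteq> unit_cone X"
    and hull: "of_real (exp (- s)) *s homogenize z \<in> disc_hull (ball 0 \<rho> \<union> unit_cone X)"
  shows "\<exists>f\<in>disc_class X. f 0 = affine_embed z \<and> disc_functional f \<le> ereal s"
proof -
  obtain G where G: "entire_map G" "\<And>\<zeta>. norm \<zeta> = 1 \<Longrightarrow> G \<zeta> \<in> ball 0 \<rho> \<union> unit_cone X"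
    and G0: "G 0 = of_real (exp (- s)) *s homogenize z"
    using hull by (rule disc_hullE) blast
  have oC: "open (unit_cone X)" by (rule open_unit_cone[OF X])
  have Gc: "continuous_on A G" for A by (rule entire_map_continuous[OF G(1)])
  have Gh: "(\<lambda>t. G t $ i) holomorphic_on A" for i A
    using G(1) unfolding entire_map_def by (meson holomorphic_on_subset subset_UNIV)

  \<comment> \<open>The part of the circle that \<open>G\<close> does not map into the cone is
    compact and is mapped into the open ball. The room between \<open>m\<close> and
    \<open>\<rho>\<close> is needed to choose a level \<open>\<rho>'\<close> that is hit on a null
    set only.\<close>
  obtain m where m: "0 \<le> m" "m < \<rho>" "\<And>\<zeta>. norm \<zeta> = 1 \<Longrightarrow> G \<zeta> \<notin> unit_cone X \<Longrightarrow> norm (G \<zeta>) \<le> m"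
  proof (cases "\<forall>\<zeta>. norm \<zeta> = 1 \<longrightarrow> G \<zeta> \<in> unit_cone X")
    case True
    then show ?thesis using that[of 0] \<rho> by auto
  next
    case False
    define K where "K = sphere 0 1 \<inter> G -` (- unit_cone X)"
    have "closed K"
      unfolding K_def by (rule continuous_closed_preimage[OF Gc]) (use oC in auto)
    then have "compact (sphere 0 1 \<inter> K)" by (intro compact_Int_closed) simp
    moreover have "sphere 0 1 \<inter> K = K" by (auto simp: K_def)
    ultimately have K: "compact K" by simp
    have ne: "K \<noteq> {}" using False by (auto simp: K_def)
    have "continuous_on K (\<lambda>\<zeta>. norm (G \<zeta>))" by (intro continuous_intros Gc)
    from continuous_attains_sup[OF K ne this] obtain \<zeta>1 where
      z1: "\<zeta>1 \<in> K" "\<forall>\<zeta>\<in>K. norm (G \<zeta>) \<le> norm (G \<zeta>1)" by blast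
    show ?thesis
    proof (rule that[of "norm (G \<zeta>1)"])
      show "norm (G \<zeta>1) < \<rho>" using z1(1) G(2)[of \<zeta>1] by (auto simp: K_def)
    qed (use z1(2) in \<open>auto simp: K_def\<close>)
  qed
  have "(\<lambda>\<zeta>. norm (G \<zeta>)) \<in> borel_measurable borel"
    by (intro borel_measurable_continuous_onI continuous_intros Gc)
  from ex_null_level[OF this m(2)] obtain \<rho>' where \<rho>': "m < \<rho>'" "\<rho>' < \<rho>"
    "measure arc_measure {\<zeta>. norm (G \<zeta>) = \<rho>'} = 0" by blast
  define N where "N = {\<zeta>. norm (G \<zeta>) = \<rho>'}"
  have cN: "closed N"
  proof -
    have "closed ((\<lambda>\<zeta>. norm (G \<zeta>)) -` {\<rho>'})" by (auto intro!: closed_vimage continuous_intros Gc)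
    then show ?thesis by (simp add: N_def vimage_def)
  qed
  have [measurable]: "N \<in> sets borel" using cN by auto
  have AE_N: "AE \<zeta> in arc_measure. \<zeta> \<notin> N"
  proof (rule AE_not_in)
    show "N \<in> null_sets arc_measure"
      using \<rho>'(3) by (intro null_setsI) (simp_all add: arc.emeasure_eq_measure flip: N_def)
  qed
  define K1 where "K1 = {\<zeta>. norm \<zeta> = 1 \<and> \<rho>' \<le> norm (G \<zeta>)}"
  have "compact K1"
  proof -
    have "closed ((\<lambda>\<zeta>. norm (G \<zeta>)) -` {\<rho>'..})" by (auto intro!: closed_vimage continuous_intros Gc)
    then have "compact (sphere 0 1 \<inter> (\<lambda>\<zeta>. norm (G \<zeta>)) -` {\<rho>'..})" by (intro compact_Int_closed) auto
    moreover have "sphere 0 1 \<inter> (\<lambda>\<zeta>. norm (G \<zeta>)) -` {\<rho>'..} = K1" by (auto simp: K1_def)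
    ultimately show ?thesis by simp
  qed
  then have "compact (G ` K1)" by (intro compact_continuous_image Gc)
  moreover have "G ` K1 \<subseteq> unit_cone X" using m(3) \<rho>'(1) by (fastforce simp: K1_def)
  ultimately obtain \<gamma> where \<gamma>: "\<gamma> > 0" "\<And>v w. v \<in> G ` K1 \<Longrightarrow> dist v w < \<gamma> \<Longrightarrow> w \<in> unit_cone X"
    using compact_margin[OF _ oC] by metis
  define R where "R = norm p0 + \<rho>"
  \<comment> \<open>\<open>R\<close> bounds the norm of every \<open>p\<close> within
    \<open>\<rho>\<close> of \<open>p0\<close>, so the perturbation uses at most half of the margin
    \<open>\<gamma>\<close> where \<open>G\<close> is large.\<close>
  define \<delta> where "\<delta> = \<gamma> / (2 * R)"
  have np0: "R > 0" using \<rho> by (simp add: R_def add_nonneg_pos)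
  have \<delta>: "\<delta> > 0" "\<delta> * R = \<gamma> / 2" using \<gamma>(1) np0 by (auto simp: \<delta>_def)

  define \<kappa> where "\<kappa> = (\<lambda>\<zeta>. if \<rho>' \<le> norm (G \<zeta>) then ln \<delta> else 0)"
  have \<kappa>m [measurable]: "\<kappa> \<in> borel_measurable borel"
  proof -
    have [measurable]: "(\<lambda>\<zeta>. norm (G \<zeta>)) \<in> borel_measurable borel"
      by (intro borel_measurable_continuous_onI continuous_intros Gc)
    show ?thesis unfolding \<kappa>_def by measurable
  qed
  have \<kappa>i: "integrable arc_measure (\<lambda>\<zeta>. \<kappa> \<zeta> - x)" for x
  proof (rule arc.integrable_const_bound[of _ "\<bar>ln \<delta>\<bar> + \<bar>x\<bar>"])
    show "AE \<zeta> in arc_measure. norm (\<kappa> \<zeta> - x) \<le> \<bar>ln \<delta>\<bar> + \<bar>x\<bar>" by (auto simp: \<kappa>_def)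
  qed measurable
  have \<kappa>i0: "integrable arc_measure \<kappa>" using \<kappa>i[of 0] by simp
  \<comment> \<open>The density jumps only where \<open>norm (G \<zeta>)\<close> equals
    \<open>\<rho>'\<close>. The radius \<open>2 * d\<close> is the one required by
    \<open>herglotz_has_derivative\<close>.\<close>
  have \<kappa>_const: "\<exists>d>0. \<forall>\<zeta>. dist \<zeta> \<zeta>0 < 2 * d \<longrightarrow> \<kappa> \<zeta> = \<kappa> \<zeta>0 \<and> \<zeta> \<notin> N" if "\<zeta>0 \<notin> N" for \<zeta>0
  proof -
    have iso: "isCont (\<lambda>\<zeta>. norm (G \<zeta>)) \<zeta>0"
      using Gc[of UNIV] by (intro continuous_intros) (simp add: continuous_on_eq_continuous_at)
    have pos: "\<bar>norm (G \<zeta>0) - \<rho>'\<bar> > 0" using that by (simp add: N_def)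
    obtain e where e: "e > 0" "\<And>\<zeta>. dist \<zeta> \<zeta>0 < e \<Longrightarrow> dist (norm (G \<zeta>)) (norm (G \<zeta>0)) < \<bar>norm (G \<zeta>0) - \<rho>'\<bar>"
      using iso[unfolded continuous_at_eps_delta, rule_format, OF pos] by metis
    have key: "\<kappa> \<zeta> = \<kappa> \<zeta>0 \<and> \<zeta> \<notin> N" if "dist \<zeta> \<zeta>0 < e" for \<zeta>
      using e(2)[OF that] by (auto simp: \<kappa>_def N_def dist_real_def abs_if split: if_splits)
    show ?thesis
    proof (intro exI[of _ "e / 2"] conjI allI impI)
      fix \<zeta> assume "dist \<zeta> \<zeta>0 < 2 * (e / 2)"
      then have "dist \<zeta> \<zeta>0 < e" by simp
      from key[OF this] show "\<kappa> \<zeta> = \<kappa> \<zeta>0" "\<zeta> \<notin> N" by blast+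
    qed (use e(1) in simp)
  qed
  define a where "a = (\<lambda>t. exp (herglotz \<kappa> t))"
  \<comment> \<open>Equal to \<open>a\<close> inside the disc. For \<open>\<zeta>0\<close> off
    \<open>N\<close> the remaining density vanishes near \<open>\<zeta>0\<close>, so
    \<open>ext \<zeta>0\<close> is differentiable at \<open>\<zeta>0\<close>, also on the circle;
    \<open>as\<close> collects these boundary values of \<open>a\<close>.\<close>
  define ext where "ext = (\<lambda>\<zeta>0 t. exp (of_real (\<kappa> \<zeta>0) + herglotz (\<lambda>\<zeta>. \<kappa> \<zeta> - \<kappa> \<zeta>0) t))"
  define as where "as = (\<lambda>\<zeta>. ext \<zeta> \<zeta>)"
  have a_hol: "a holomorphic_on ball 0 1"
    unfolding a_def by (intro holomorphic_intros herglotz_holomorphic \<kappa>i0)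
  have a_ext: "a t = ext \<zeta>0 t" if "norm t < 1" for t \<zeta>0
    unfolding a_def ext_def by (simp only: herglotz_shift[OF \<kappa>i0 that, of "\<kappa> \<zeta>0"])
  have away: "AE \<zeta> in arc_measure. \<kappa> \<zeta> - \<kappa> \<zeta>0 \<noteq> 0 \<longrightarrow> 2 * d \<le> norm (\<zeta> - \<zeta>0)"
    if "\<forall>\<zeta>. dist \<zeta> \<zeta>0 < 2 * d \<longrightarrow> \<kappa> \<zeta> = \<kappa> \<zeta>0 \<and> \<zeta> \<notin> N" for d \<zeta>0
  proof (rule AE_I2, rule impI)
    fix \<zeta> assume "\<kappa> \<zeta> - \<kappa> \<zeta>0 \<noteq> 0"
    then have "\<kappa> \<zeta> \<noteq> \<kappa> \<zeta>0" by simp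
    then have "\<not> dist \<zeta> \<zeta>0 < 2 * d" using that by blast
    then show "2 * d \<le> norm (\<zeta> - \<zeta>0)" by (simp add: dist_norm)
  qed
  have ext_deriv: "\<exists>D. (ext \<zeta>0 has_field_derivative D) (at \<zeta>0)" if zN: "\<zeta>0 \<notin> N" for \<zeta>0
  proof -
    obtain d where d: "d > 0" "\<forall>\<zeta>. dist \<zeta> \<zeta>0 < 2 * d \<longrightarrow> \<kappa> \<zeta> = \<kappa> \<zeta>0 \<and> \<zeta> \<notin> N" using \<kappa>_const[OF zN] by blast
    obtain D where D: "(herglotz (\<lambda>\<zeta>. \<kappa> \<zeta> - \<kappa> \<zeta>0) has_field_derivative D) (at \<zeta>0)"
      using herglotz_has_derivative[OF \<kappa>i d(1) away[OF d(2)]] by blast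
    show ?thesis
      unfolding ext_def by (rule exI) (rule derivative_eq_intros refl D)+
  qed
  have as_ext: "\<exists>d>0. \<forall>\<zeta>. dist \<zeta> \<zeta>0 < d \<longrightarrow> as \<zeta> = ext \<zeta>0 \<zeta> \<and> \<zeta> \<notin> N" if zN: "\<zeta>0 \<notin> N" for \<zeta>0
  proof -
    obtain d where d: "d > 0" "\<forall>\<zeta>. dist \<zeta> \<zeta>0 < 2 * d \<longrightarrow> \<kappa> \<zeta> = \<kappa> \<zeta>0 \<and> \<zeta> \<notin> N" using \<kappa>_const[OF zN] by blast
    show ?thesis
    proof (intro exI[of _ d] conjI allI impI)
      fix \<zeta> assume "dist \<zeta> \<zeta>0 < d"
      then have "dist \<zeta> \<zeta>0 < 2 * d" using d(1) by simp
      then have k: "\<kappa> \<zeta> = \<kappa> \<zeta>0" and N: "\<zeta> \<notin> N" using d(2) by blast+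
      show "as \<zeta> = ext \<zeta>0 \<zeta>" unfolding as_def ext_def k ..
      show "\<zeta> \<notin> N" by (rule N)
    qed (rule d(1))
  qed
  have norm_as: "norm (as \<zeta>0) = exp (\<kappa> \<zeta>0)" if z: "norm \<zeta>0 = 1" "\<zeta>0 \<notin> N" for \<zeta>0
  proof -
    obtain d where d: "d > 0" "\<forall>\<zeta>. dist \<zeta> \<zeta>0 < 2 * d \<longrightarrow> \<kappa> \<zeta> = \<kappa> \<zeta>0 \<and> \<zeta> \<notin> N" using \<kappa>_const[OF z(2)] by blast
    have d2: "2 * d > 0" using d by simp
    have "Re (herglotz (\<lambda>\<zeta>. \<kappa> \<zeta> - \<kappa> \<zeta>0) \<zeta>0) = (\<integral>\<zeta>. Re ((\<zeta> + \<zeta>0) / (\<zeta> - \<zeta>0) * of_real (\<kappa> \<zeta> - \<kappa> \<zeta>0)) \<partial>arc_measure)"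
      unfolding herglotz_def
      by (rule integral_Re[symmetric, OF herglotz_kernel_integrable[OF \<kappa>i d2 away[OF d(2)]]])
    also have "\<dots> = (\<integral>\<zeta>. 0 \<partial>arc_measure)"
    proof (rule integral_cong_AE)
      show "AE \<zeta> in arc_measure. Re ((\<zeta> + \<zeta>0) / (\<zeta> - \<zeta>0) * of_real (\<kappa> \<zeta> - \<kappa> \<zeta>0)) = 0"
        using AE_arc_norm by eventually_elim (rule Re_herglotz_boundary_kernel[OF _ z(1)])
    qed measurable
    finally show ?thesis by (simp add: as_def ext_def norm_exp_eq_Re)
  qed

  have anz: "a t \<noteq> 0" for t by (simp add: a_def)
  \<comment> \<open>A zero at \<open>t \<noteq> 0\<close> means that \<open>p\<close> is the value
    of \<open>- G t / (a t * t)\<close>. This map goes from real dimension 2 to at least 4, so its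
    image is negligible and misses a point of the ball. At \<open>t = 0\<close> the value is
    \<open>G 0\<close>, which is not 0.\<close>
  obtain p where p: "dist p0 p < \<rho>" "\<And>t. norm t < 1 \<Longrightarrow> G t + (a t * t) *s p \<noteq> 0"
  proof -
    let ?S = "ball 0 1 - {0::complex}" and ?f = "\<lambda>t. (- 1 / (a t * t)) *s G t"
    have "?f differentiable_on ?S"
    proof (rule vec_differentiable_on)
      fix i
      have "(\<lambda>t. - 1 / (a t * t) * G t $ i) holomorphic_on ?S"
        using anz by (intro holomorphic_intros Gh holomorphic_on_subset[OF a_hol]) auto
      then have "(\<lambda>t. ?f t $ i) holomorphic_on ?S" by simp
      then show "(\<lambda>t. ?f t $ i) differentiable_on ?S"
        by (rule holomorphic_on_imp_differentiable_on)
    qed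
    moreover have "DIM(complex) < DIM(complex ^ 'n option)"
      by (simp add: card_UNIV_option)
    ultimately have neg: "negligible (?f ` ?S)" by (intro negligible_differentiable_image_lowdim)
    have "\<not> ball p0 \<rho> \<subseteq> ?f ` ?S"
      using negligible_subset[OF neg, of "ball p0 \<rho>"] open_not_negligible[of "ball p0 \<rho>"] \<rho> by auto
    then obtain p where p: "p \<in> ball p0 \<rho>" "p \<notin> ?f ` ?S" by blast
    show ?thesis
    proof (rule that[of p])
      show "dist p0 p < \<rho>" using p(1) by simp
      fix t :: complex assume t: "norm t < 1"
      show "G t + (a t * t) *s p \<noteq> 0"
      proof (cases "t = 0")
        case True
        then show ?thesis by (simp add: G0 vec_eq_iff) (metis homogenize_None one_neq_zero)
      next
        case False
        show ?thesis
        proof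
          assume "G t + (a t * t) *s p = 0"
          then have "G t = - ((a t * t) *s p)" by (simp add: eq_neg_iff_add_eq_0)
          then have "?f t = p" using anz[of t] False by (simp add: vec_eq_iff)
          then show False using p(2) t False by (auto simp: image_iff)
        qed
      qed
    qed
  qed
  have normp: "norm p \<le> R"
    using p(1) norm_triangle_ineq2[of p p0] by (simp add: R_def dist_norm norm_minus_commute)
  have pball: "ball p (2 * \<rho>) \<subseteq> unit_cone X"
  proof
    fix w assume "w \<in> ball p (2 * \<rho>)"
    then have "dist p0 w < 3 * \<rho>" using p(1) dist_triangle[of p0 w p] by simp
    then show "w \<in> unit_cone X" using p0 by auto
  qed

  define F where "F = (\<lambda>t. G t + (a t * t) *s p)"
  define Fs where "Fs = (\<lambda>\<zeta>. G \<zeta> + (as \<zeta> * \<zeta>) *s p)"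
  \<comment> \<open>Where \<open>G\<close> is large its zeroth coordinate is at least
    \<open>\<gamma>\<close>, of which the perturbation takes at most half; elsewhere the boundary
    point is a unimodular multiple of the centre of a ball of radius \<open>\<rho>\<close> in the
    cone.\<close>
  define c0 where "c0 = min (\<gamma> / 2) \<rho>"
  have c0: "c0 > 0" using \<gamma>(1) \<rho> by (simp add: c0_def)
  have Fs_cone: "Fs \<zeta> \<in> unit_cone X" "c0 \<le> norm (Fs \<zeta> $ None)" if z: "norm \<zeta> = 1" "\<zeta> \<notin> N" for \<zeta>
  proof -
    have "Fs \<zeta> \<in> unit_cone X \<and> c0 \<le> norm (Fs \<zeta> $ None)"
    proof (cases "\<rho>' \<le> norm (G \<zeta>)")
      case True
      then have K: "G \<zeta> \<in> G ` K1" using z by (auto simp: K1_def)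
      have "norm (as \<zeta>) = \<delta>" using norm_as[OF z] True \<delta> by (simp add: \<kappa>_def)
      then have "norm ((as \<zeta> * \<zeta>) *s p) \<le> \<delta> * R"
        using z(1) normp \<delta>(1) by (simp add: norm_vector_smult norm_mult mult_left_mono)
      then have d: "norm ((as \<zeta> * \<zeta>) *s p) \<le> \<gamma> / 2" using \<delta>(2) by simp
      have "Fs \<zeta> \<in> unit_cone X"
        by (rule \<gamma>(2)[OF K]) (use d \<gamma>(1) in \<open>simp add: Fs_def dist_norm\<close>)
      moreover have "\<gamma> \<le> norm (G \<zeta> $ None)"
        by (rule unit_cone_ball_None[of _ _ X]) (use \<gamma>(2)[OF K] in auto)
      moreover have "norm (((as \<zeta> * \<zeta>) *s p) $ None) \<le> \<gamma> / 2"
        using d Finite_Cartesian_Product.norm_nth_le[of "(as \<zeta> * \<zeta>) *s p" None] by linarith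
      moreover have "norm (G \<zeta> $ None) - norm (((as \<zeta> * \<zeta>) *s p) $ None) \<le> norm (Fs \<zeta> $ None)"
        using norm_diff_ineq[of "G \<zeta> $ None" "((as \<zeta> * \<zeta>) *s p) $ None"] by (simp add: Fs_def)
      ultimately show ?thesis by (auto simp: c0_def)
    next
      case False
      define c where "c = as \<zeta> * \<zeta>"
      have c: "norm c = 1" using norm_as[OF z] False z(1) by (simp add: c_def \<kappa>_def norm_mult)
      then have cnz: "c \<noteq> 0" by auto
      define w where "w = p + (1 / c) *s G \<zeta>"
      have Fw: "Fs \<zeta> = c *s w"
      proof -
        have "Fs \<zeta> = G \<zeta> + c *s p" by (simp add: Fs_def c_def)
        then show ?thesis using cnz by (simp add: w_def vec_eq_iff field_simps)
      qed
      have "norm ((1 / c) *s G \<zeta>) < \<rho>" using False \<rho>'(2) c by (simp add: norm_vector_smult norm_divide)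
      then have dw: "dist p w < \<rho>" by (simp add: w_def dist_norm)
      have wb: "ball w \<rho> \<subseteq> unit_cone X"
      proof
        fix v assume "v \<in> ball w \<rho>"
        then have "dist p v < 2 * \<rho>" using dw dist_triangle[of p v w] by simp
        then show "v \<in> unit_cone X" using pball by auto
      qed
      have "w \<in> unit_cone X" using wb \<rho> by auto
      then have "Fs \<zeta> \<in> unit_cone X" unfolding Fw using unit_cone_scale[OF _ cnz] c by simp
      moreover have "\<rho> \<le> norm (Fs \<zeta> $ None)"
        using unit_cone_ball_None[OF wb] c by (simp add: Fw norm_mult)
      ultimately show ?thesis by (auto simp: c0_def)
    qed
    then show "Fs \<zeta> \<in> unit_cone X" "c0 \<le> norm (Fs \<zeta> $ None)" by auto
  qed
  have F_nt: "has_nt_limit F \<zeta>0 (Fs \<zeta>0)" if z: "norm \<zeta>0 = 1" "\<zeta>0 \<notin> N" for \<zeta>0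
    unfolding has_nt_limit_def
  proof (intro allI impI)
    fix \<alpha> :: real
    obtain D where "(ext \<zeta>0 has_field_derivative D) (at \<zeta>0)" using ext_deriv[OF z(2)] by blast
    then have "isCont (ext \<zeta>0) \<zeta>0" by (rule DERIV_isCont)
    then have e: "(ext \<zeta>0 \<longlongrightarrow> ext \<zeta>0 \<zeta>0) (at \<zeta>0 within stolz \<alpha> \<zeta>0)"
      unfolding isCont_def by (rule tendsto_within_subset) simp
    have g: "(G \<longlongrightarrow> G \<zeta>0) (at \<zeta>0 within stolz \<alpha> \<zeta>0)"
      using Gc[of UNIV] unfolding continuous_on_def by (auto intro: tendsto_within_subset)
    have "((\<lambda>t. G t + (ext \<zeta>0 t * t) *s p) \<longlongrightarrow> G \<zeta>0 + (ext \<zeta>0 \<zeta>0 * \<zeta>0) *s p) (at \<zeta>0 within stolz \<alpha> \<zeta>0)"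
      unfolding vector_scalar_mult_def by (intro tendsto_intros e g)
    moreover have "\<forall>\<^sub>F t in at \<zeta>0 within stolz \<alpha> \<zeta>0. G t + (ext \<zeta>0 t * t) *s p = F t"
      unfolding eventually_at_filter
      by (intro always_eventually allI impI) (auto simp: stolz_def F_def a_ext[of _ \<zeta>0])
    ultimately show "(F \<longlongrightarrow> Fs \<zeta>0) (at \<zeta>0 within stolz \<alpha> \<zeta>0)"
      unfolding Fs_def as_def by (rule Lim_transform_eventually)
  qed
  have Fhol: "(\<lambda>t. F t $ i) holomorphic_on ball 0 1" for i
    unfolding F_def by (auto intro!: holomorphic_intros Gh a_hol)
  have Fnz: "F t \<noteq> 0" if "norm t < 1" for t using p(2)[OF that] by (simp add: F_def)
  have Re_herglotz_\<kappa>: "Re (herglotz \<kappa> t) \<le> \<bar>ln \<delta>\<bar>" if t: "norm t < 1" for t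
  proof -
    have t2: "(norm t)\<^sup>2 \<le> 1" using t by (simp add: power_le_one)
    have i1: "integrable arc_measure (\<lambda>_. \<bar>ln \<delta>\<bar>)" by simp
    have "Re (herglotz \<kappa> t) \<le> Re (herglotz (\<lambda>_. \<bar>ln \<delta>\<bar>) t)"
      unfolding Re_herglotz(1)[OF \<kappa>i0 t] Re_herglotz(1)[OF i1 t]
      using t2 by (intro integral_mono Re_herglotz(2) \<kappa>i0 i1 t mult_left_mono) (auto simp: \<kappa>_def)
    also have "herglotz (\<lambda>_. \<bar>ln \<delta>\<bar>) t = of_real \<bar>ln \<delta>\<bar>"
      using herglotz_shift[OF i1 t, of "\<bar>ln \<delta>\<bar>"] by (simp add: herglotz_def)
    finally show ?thesis by simp
  qed
  have Fbd: "bounded ((\<lambda>t. F t $ i) ` ball 0 1)" for i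
  proof -
    have "bounded ((\<lambda>t. G t $ i) ` cball 0 1)"
      by (intro compact_imp_bounded compact_continuous_image continuous_intros Gc) simp
    then obtain B where B: "\<And>t. norm t \<le> 1 \<Longrightarrow> norm (G t $ i) \<le> B"
      unfolding bounded_iff by (metis image_eqI mem_cball_0)
    have "norm (F t $ i) \<le> B + exp \<bar>ln \<delta>\<bar> * norm (p $ i)" if t: "norm t < 1" for t
    proof -
      have "norm (a t * t) \<le> exp \<bar>ln \<delta>\<bar> * 1"
        unfolding norm_mult using Re_herglotz_\<kappa>[OF t] t by (intro mult_mono) (auto simp: a_def norm_exp_eq_Re)
      then have "norm (a t * t * p $ i) \<le> exp \<bar>ln \<delta>\<bar> * norm (p $ i)"
        unfolding norm_mult[of "a t * t"] by (intro mult_right_mono) auto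
      then show ?thesis
        using B[of t] t norm_triangle_ineq[of "G t $ i" "a t * t * p $ i"] by (simp add: F_def)
    qed
    then show ?thesis unfolding bounded_iff by (intro exI[of _ "B + exp \<bar>ln \<delta>\<bar> * norm (p $ i)"]) auto
  qed
  define f where "f = (\<lambda>t. proj_of (F t))"
  have lift: "bounded_lifting F f"
    using Fhol Fbd Fnz by (auto simp: bounded_lifting_def f_def)
  have F0: "F 0 = of_real (exp (- s)) *s homogenize z" by (simp add: F_def G0)
  have f0: "f 0 = affine_embed z"
    unfolding f_def using Fnz[of 0] by (subst proj_of_eq_affine_embed_iff) (simp_all add: F0)
  have disc: "analytic_disc f"
    unfolding analytic_disc_def
  proof
    fix w :: complex assume w: "w \<in> ball 0 1"
    then have "F w \<noteq> 0" using Fnz by simp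
    then obtain i where i: "F w $ i \<noteq> 0" by (auto simp: vec_eq_iff)
    let ?U = "ball 0 1 \<inter> (\<lambda>t. F t $ i) -` (- {0})"
    have oU: "open ?U"
      by (rule continuous_open_preimage) (auto intro: holomorphic_on_imp_continuous_on[OF Fhol])
    have "(\<lambda>t. chart_coord i j (f t)) holomorphic_on ?U" for j
    proof -
      have "(\<lambda>t. F t $ j / F t $ i) holomorphic_on ?U"
        by (intro holomorphic_intros holomorphic_on_subset[OF Fhol]) auto
      then show ?thesis
        by (rule holomorphic_transform) (auto simp: f_def Fnz)
    qed
    then show "\<exists>i U. open U \<and> w \<in> U \<and> U \<subseteq> ball 0 1 \<and> (\<forall>t\<in>U. in_chart i (f t)) \<and>
        (\<forall>j. (\<lambda>t. chart_coord i j (f t)) holomorphic_on U)"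
      using oU w i by (intro exI[of _ i] exI[of _ ?U]) (auto simp: f_def Fnz)
  qed
  have "AE \<zeta> in arc_measure. \<exists>w. has_nt_limit F \<zeta> w \<and> w \<noteq> 0 \<and> proj_of w \<in> affine_embed ` X"
    using AE_N AE_arc_norm
  proof eventually_elim
    case (elim \<zeta>)
    have c: "Fs \<zeta> \<in> unit_cone X" using Fs_cone(1) elim by blast
    then have nz: "Fs \<zeta> \<noteq> 0" by (auto simp: unit_cone_def)
    have "proj_of (Fs \<zeta>) = affine_embed (affine_part (Fs \<zeta>))"
      using proj_of_eq_affine_embed_iff[OF nz] c by (simp add: unit_cone_def)
    then have "proj_of (Fs \<zeta>) \<in> affine_embed ` X" using c by (auto simp: unit_cone_def)
    then show ?case using F_nt nz elim by blast
  qed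
  then have in_class: "f \<in> disc_class X" using disc f0 lift by (auto simp: disc_class_def)

  define q where "q = (\<lambda>t. F t $ None)"
  define qs where "qs = (\<lambda>\<zeta>. Fs \<zeta> $ None)"
  have qs: "c0 \<le> norm (qs \<zeta>)" "norm (qs \<zeta>) < 1" if "norm \<zeta> = 1" "\<zeta> \<notin> N" for \<zeta>
    using Fs_cone[OF that] by (auto simp: qs_def unit_cone_def)
  have qs_deriv: "\<exists>D Q d. d > 0 \<and> (Q has_field_derivative D) (at \<zeta>0) \<and> (\<forall>\<zeta>. dist \<zeta> \<zeta>0 < d \<longrightarrow> qs \<zeta> = Q \<zeta> \<and> \<zeta> \<notin> N)"
    if z: "\<zeta>0 \<notin> N" for \<zeta>0
  proof -
    obtain D where D: "(ext \<zeta>0 has_field_derivative D) (at \<zeta>0)" using ext_deriv[OF z] by blast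
    obtain d where d: "d > 0" "\<forall>\<zeta>. dist \<zeta> \<zeta>0 < d \<longrightarrow> as \<zeta> = ext \<zeta>0 \<zeta> \<and> \<zeta> \<notin> N" using as_ext[OF z] by blast
    have "((\<lambda>t. G t $ None) has_field_derivative deriv (\<lambda>t. G t $ None) \<zeta>0) (at \<zeta>0)"
      by (rule holomorphic_derivI[OF Gh[of None UNIV]]) auto
    from DERIV_add[OF this DERIV_cmult_right[OF DERIV_mult[OF D DERIV_ident]]]
    obtain D' where D': "((\<lambda>t. G t $ None + ext \<zeta>0 t * t * p $ None) has_field_derivative D') (at \<zeta>0)" by blast
    show ?thesis
      using d D' by (intro exI[of _ D'] exI[of _ "\<lambda>t. G t $ None + ext \<zeta>0 t * t * p $ None"] exI[of _ d])
        (auto simp: qs_def Fs_def)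
  qed
  have qs_cont: "continuous_on (sphere 0 1 - N) qs"
    unfolding continuous_on_eq_continuous_within
  proof
    fix \<zeta>0 assume "\<zeta>0 \<in> sphere 0 1 - N"
    then obtain D Q d where Q: "d > 0" "(Q has_field_derivative D) (at \<zeta>0)" "\<forall>\<zeta>. dist \<zeta> \<zeta>0 < d \<longrightarrow> qs \<zeta> = Q \<zeta> \<and> \<zeta> \<notin> N"
      using qs_deriv by blast
    have "continuous (at \<zeta>0 within sphere 0 1 - N) Q"
      using DERIV_isCont[OF Q(2)] continuous_at_imp_continuous_within by blast
    then show "continuous (at \<zeta>0 within sphere 0 1 - N) qs"
      by (rule continuous_transform_within[OF _ Q(1)]) (use Q \<open>\<zeta>0 \<in> _\<close> in auto)
  qed
  \<comment> \<open>The logarithm of the boundary modulus of the zeroth component. The value 0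
    elsewhere keeps \<open>k\<close> bounded and nonpositive on the whole plane.\<close>
  define k where "k = (\<lambda>\<zeta>. indicator (sphere 0 1 - N) \<zeta> *\<^sub>R ln (norm (qs \<zeta>)))"
  have qs_nz: "qs \<zeta> \<noteq> 0" if "norm \<zeta> = 1" "\<zeta> \<notin> N" for \<zeta> using qs(1)[OF that] c0 by auto
  have [measurable]: "k \<in> borel_measurable borel"
    unfolding k_def
    by (intro borel_measurable_continuous_on_indicator continuous_intros qs_cont) (use qs_nz in auto)
  have k_bd: "ln c0 \<le> k \<zeta>" "k \<zeta> \<le> 0" if "norm \<zeta> = 1" "\<zeta> \<notin> N" for \<zeta>
    using qs[OF that] c0 that qs_nz[OF that] by (auto simp: k_def)
  have k_eq: "k \<zeta> = ln (norm (qs \<zeta>))" if "norm \<zeta> = 1" "\<zeta> \<notin> N" for \<zeta>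
    using that by (simp add: k_def)
  have k_le0: "k \<zeta> \<le> 0" for \<zeta>
    using k_bd(2)[of \<zeta>] by (cases "norm \<zeta> = 1 \<and> \<zeta> \<notin> N") (auto simp: k_def)
  have k_abs: "\<bar>k \<zeta>\<bar> \<le> \<bar>ln c0\<bar>" for \<zeta>
  proof (cases "norm \<zeta> = 1 \<and> \<zeta> \<notin> N")
    case True
    then show ?thesis using k_bd[of \<zeta>] by auto
  qed (auto simp: k_def)
  have ki: "integrable arc_measure k"
    by (rule arc.integrable_const_bound[of _ "\<bar>ln c0\<bar>"]) (use k_abs in auto)
  define h where "h = (\<lambda>t. exp (herglotz k t))"
  define g where "g = (\<lambda>t. q t / h t)"
  have hnz: "h t \<noteq> 0" for t by (simp add: h_def)
  have ghol: "g holomorphic_on ball 0 1"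
    unfolding g_def h_def q_def by (intro holomorphic_intros Fhol herglotz_holomorphic ki) simp
  have h_nt: "\<exists>w. has_nt_limit h \<zeta>0 w \<and> norm w = exp (k \<zeta>0)" if z: "norm \<zeta>0 = 1" "\<zeta>0 \<notin> N" for \<zeta>0
  proof -
    obtain D Q d where Q: "d > 0" "(Q has_field_derivative D) (at \<zeta>0)" "\<And>\<zeta>. dist \<zeta> \<zeta>0 < d \<Longrightarrow> qs \<zeta> = Q \<zeta> \<and> \<zeta> \<notin> N"
      using qs_deriv[OF z(2)] by blast
    obtain d' where d': "d' > 0" "\<And>\<zeta>. norm (\<zeta> - \<zeta>0) < d' \<Longrightarrow> norm (Q \<zeta> - Q \<zeta>0 - D * (\<zeta> - \<zeta>0)) \<le> 1 * norm (\<zeta> - \<zeta>0)"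
      using Q(2) unfolding has_field_derivative_def has_derivative_at_alt using zero_less_one by blast
    define e where "e = min d d'"
    \<comment> \<open>Near \<open>\<zeta>0\<close> the derivative of \<open>Q\<close> and the lower
      bound \<open>c0\<close> control the logarithm; at distance at least \<open>e\<close> the crude
      bound \<open>2 * \<bar>ln c0\<bar>\<close> is divided by \<open>e\<close>.\<close>
    define L where "L = max ((norm D + 1) / c0) (2 * \<bar>ln c0\<bar> / e)"
    have e: "e > 0" using Q(1) d'(1) by (simp add: e_def)
    have Lbound: "\<bar>k \<zeta> - k \<zeta>0\<bar> \<le> L * norm (\<zeta> - \<zeta>0)" if \<zeta>: "norm \<zeta> = 1" "\<zeta> \<notin> N" for \<zeta>
    proof (cases "norm (\<zeta> - \<zeta>0) < e")
      case True
      have "norm (qs \<zeta> - qs \<zeta>0) = norm (Q \<zeta> - Q \<zeta>0)"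
        using Q(3)[of \<zeta>] Q(3)[of \<zeta>0] True Q(1) by (simp add: dist_norm e_def)
      also have "\<dots> \<le> norm (D * (\<zeta> - \<zeta>0)) + 1 * norm (\<zeta> - \<zeta>0)"
        using d'(2)[of \<zeta>] True norm_triangle_ineq[of "Q \<zeta> - Q \<zeta>0 - D * (\<zeta> - \<zeta>0)" "D * (\<zeta> - \<zeta>0)"]
        by (simp add: e_def)
      also have "\<dots> = (norm D + 1) * norm (\<zeta> - \<zeta>0)" by (simp add: norm_mult distrib_right)
      finally have q1: "norm (qs \<zeta> - qs \<zeta>0) \<le> (norm D + 1) * norm (\<zeta> - \<zeta>0)" .
      have ln_lip: "ln x - ln y \<le> \<bar>x - y\<bar> / c0" if "c0 \<le> x" "c0 \<le> y" for x y
      proof -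
        have "ln x - ln y = ln (x / y)" using that c0 by (simp add: ln_div)
        also have "\<dots> \<le> x / y - 1" using that c0 by (intro ln_le_minus_one) simp
        also have "\<dots> = (x - y) / y" using that c0 by (simp add: field_simps)
        also have "\<dots> \<le> \<bar>x - y\<bar> / c0" using that c0 by (intro frac_le) auto
        finally show ?thesis .
      qed
      have "\<bar>k \<zeta> - k \<zeta>0\<bar> \<le> \<bar>norm (qs \<zeta>) - norm (qs \<zeta>0)\<bar> / c0"
        unfolding k_eq[OF \<zeta>] k_eq[OF z]
        using ln_lip[OF qs(1)[OF \<zeta>] qs(1)[OF z]] ln_lip[OF qs(1)[OF z] qs(1)[OF \<zeta>]] by (simp add: abs_le_iff abs_minus_commute)
      also have "\<dots> \<le> (norm D + 1) * norm (\<zeta> - \<zeta>0) / c0"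
        using norm_triangle_ineq3[of "qs \<zeta>" "qs \<zeta>0"] q1 c0 by (intro divide_right_mono) auto
      also have "\<dots> = (norm D + 1) / c0 * norm (\<zeta> - \<zeta>0)" by simp
      also have "\<dots> \<le> L * norm (\<zeta> - \<zeta>0)" by (intro mult_right_mono) (auto simp: L_def)
      finally show ?thesis .
    next
      case False
      have "\<bar>k \<zeta> - k \<zeta>0\<bar> \<le> 2 * \<bar>ln c0\<bar>" using k_abs[of \<zeta>] k_abs[of \<zeta>0] by linarith
      also have "\<dots> = 2 * \<bar>ln c0\<bar> / e * e" using e by simp
      also have "\<dots> \<le> L * norm (\<zeta> - \<zeta>0)" using False e by (intro mult_mono) (auto simp: L_def le_max_iff_disj)
      finally show ?thesis .
    qed
    show ?thesis
      unfolding h_def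
    proof (rule outer_nt_limit[OF ki z(1)])
      show "AE \<zeta> in arc_measure. \<bar>k \<zeta> - k \<zeta>0\<bar> \<le> L * norm (\<zeta> - \<zeta>0)"
        using AE_N AE_arc_norm by eventually_elim (rule Lbound)
      show "L \<ge> 0" using e by (simp add: L_def le_max_iff_disj)
    qed
  qed
  have g_nt: "\<exists>w. has_nt_limit g \<zeta> w \<and> norm w = 1" if z: "norm \<zeta> = 1" "\<zeta> \<notin> N" for \<zeta>
  proof -
    obtain w where w: "has_nt_limit h \<zeta> w" "norm w = exp (k \<zeta>)" using h_nt[OF z] by blast
    have wnz: "w \<noteq> 0" using w(2) by auto
    have "has_nt_limit g \<zeta> (qs \<zeta> / w)"
      using F_nt[OF z] w(1) wnz unfolding has_nt_limit_def g_def q_def qs_def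
      by (auto intro!: tendsto_intros)
    moreover have "norm (qs \<zeta> / w) = 1"
      using w(2) qs_nz[OF z] by (simp add: norm_divide k_eq[OF z])
    ultimately show ?thesis by blast
  qed
  have AE_g: "AE \<zeta> in arc_measure. \<exists>w. has_nt_limit g \<zeta> w \<and> norm w = 1"
    using AE_N AE_arc_norm by eventually_elim (rule g_nt)
  have "\<exists>B. \<forall>t. norm t < 1 \<longrightarrow> norm (g t) \<le> B"
  proof -
    obtain B where B: "\<And>t. norm t < 1 \<Longrightarrow> norm (q t) \<le> B"
      using Fbd[of None] unfolding bounded_iff q_def by (metis image_eqI mem_ball_0)
    have "norm (g t) \<le> B * exp \<bar>ln c0\<bar>" if t: "norm t < 1" for t
    proof -
      have t2: "(norm t)\<^sup>2 \<le> 1" using t by (simp add: power_le_one)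
      have i1: "integrable arc_measure (\<lambda>_. - \<bar>ln c0\<bar>)" by simp
      have "Re (herglotz (\<lambda>_. - \<bar>ln c0\<bar>) t) \<le> Re (herglotz k t)"
        unfolding Re_herglotz(1)[OF ki t] Re_herglotz(1)[OF i1 t]
      proof (intro integral_mono Re_herglotz(2) ki i1 t mult_left_mono)
        show "- \<bar>ln c0\<bar> \<le> k \<zeta>" for \<zeta> using k_abs[of \<zeta>] by linarith
      qed (use t2 in auto)
      moreover have "herglotz (\<lambda>_. - \<bar>ln c0\<bar>) t = of_real (- \<bar>ln c0\<bar>)"
        using herglotz_shift[OF i1 t, of "- \<bar>ln c0\<bar>"] by (simp add: herglotz_def)
      ultimately have "exp (- \<bar>ln c0\<bar>) \<le> norm (h t)" by (simp add: h_def norm_exp_eq_Re)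
      then have "norm (q t) / norm (h t) \<le> B / exp (- \<bar>ln c0\<bar>)"
        using B[OF t] by (intro frac_le) (auto intro: order_trans[OF norm_ge_zero])
      then show ?thesis by (simp add: g_def norm_divide exp_minus field_simps)
    qed
    then show ?thesis by blast
  qed
  then obtain B where B: "\<And>t. norm t < 1 \<Longrightarrow> norm (g t) \<le> B" by blast
  have AE_g': "AE \<zeta> in arc_measure. \<exists>w. has_nt_limit g \<zeta> w \<and> norm w \<le> 1"
    using AE_g by eventually_elim auto
  have g1: "norm (g t) \<le> 1" if "norm t < 1" for t
    by (rule norm_le_1_if_boundary_le_1[OF ghol B AE_g' that])
  have inner: "inner_function g" using ghol g1 AE_g by (simp add: inner_function_def)
  have "outer_function h"
    unfolding outer_function_def using ki
    by (intro exI[of _ 1] exI[of _ k]) (simp add: h_def herglotz_def)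
  then have fac: "inner_factor g (\<lambda>t. F t $ None)"
    unfolding inner_factor_def using inner hnz by (intro conjI exI[of _ h]) (auto simp: g_def q_def)
  have "- s \<le> ln (norm (g 0))"
  proof -
    have q0: "norm (q 0) = exp (- s)" by (simp add: q_def F0 norm_mult)
    \<comment> \<open>In the cone the zeroth coordinate has modulus below 1, so the outer factor is
      at most 1 in modulus at 0 and the inner factor retains at least
      \<open>exp (- s)\<close>.\<close>
    have "integral\<^sup>L arc_measure k \<le> integral\<^sup>L arc_measure (\<lambda>_. 0)"
      using ki k_le0 by (intro integral_mono) auto
    then have "Re (herglotz k 0) \<le> 0" unfolding Re_herglotz_0[OF ki] by simp
    then have "norm (h 0) \<le> 1" by (simp add: h_def norm_exp_eq_Re)
    then have "exp (- s) / 1 \<le> norm (g 0)"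
      unfolding g_def norm_divide q0 using hnz[of 0] by (intro divide_left_mono) auto
    then have "ln (exp (- s)) \<le> ln (norm (g 0))" by (intro ln_mono) (auto intro: less_le_trans[OF exp_gt_zero])
    then show ?thesis by simp
  qed
  then have "ereal (- s) \<le> Sup {ereal (ln (norm (g 0))) | F g. bounded_lifting F f \<and> inner_factor g (\<lambda>z. F z $ None)}"
    using lift fac by (intro Sup_upper2[of "ereal (ln (norm (g 0)))"]) auto
  then have "- Sup {ereal (ln (norm (g 0))) | F g. bounded_lifting F f \<and> inner_factor g (\<lambda>z. F z $ None)} \<le> - ereal (- s)"
    by (simp only: ereal_minus_le_minus)
  then have "disc_functional f \<le> ereal s" by (simp add: disc_functional_def)
  then show ?thesis using in_class f0 by blast
qed

theorem theorem1:
  fixes X :: "(complex ^ 'n) set" and z :: "complex ^ 'n"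
  assumes "open X"
  shows "siciak_extremal X z = envelope (disc_class X) disc_functional (affine_embed z)"
proof (rule antisym[OF siciak_le_envelope[OF assms]])
  show "envelope (disc_class X) disc_functional (affine_embed z) \<le> siciak_extremal X z"
  proof (cases "X = {}")
    case True
    \<comment> \<open>No point constrains the competitors, so all constants compete and the extremal
      function is infinite.\<close>
    have const: "(\<lambda>_ :: complex ^ 'n. ereal c) \<in> lelong_class" for c :: real
    proof -
      have "ereal_integral arc_measure (\<lambda>_. ereal c) = ereal c"
        using ereal_integral_real[of arc_measure "\<lambda>_. c"] by simp
      then have "plurisubharmonic (\<lambda>_ :: complex ^ 'n. ereal c)"
        by (auto simp: plurisubharmonic_def)
      moreover have "ereal c \<le> ereal (ln (max 1 (norm x)) + \<bar>c\<bar>)" for x :: "complex ^ 'n"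
      proof -
        have "0 \<le> ln (max 1 (norm x))" by (rule ln_ge_zero) simp
        then show ?thesis using abs_ge_self[of c] unfolding ereal_less_eq by linarith
      qed
      ultimately show ?thesis by (auto simp: lelong_class_def)
    qed
    have "ereal c \<le> siciak_extremal X z" for c :: real
      unfolding siciak_extremal_def using const[of c] True by (intro SUP_upper2[of "\<lambda>_. ereal c"]) auto
    then have "siciak_extremal X z = \<infinity>" by (rule ereal_top)
    then show ?thesis by simp
  next
    case False
    then obtain x0 where x0: "x0 \<in> X" by blast
    \<comment> \<open>Any scalar of modulus strictly between 0 and 1 puts the lift of
      \<open>x0\<close> into the cone.\<close>
    define p0 where "p0 = (1 / 2 :: complex) *s homogenize x0"
    have "p0 \<in> unit_cone X" using x0 by (simp add: p0_def unit_cone_def)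
    then obtain r where r: "r > 0" "ball p0 r \<subseteq> unit_cone X"
      using open_unit_cone[OF assms] open_contains_ball by blast
    \<comment> \<open>A third of \<open>r\<close>, since \<open>disc_of_hull\<close> asks for a ball
      of radius \<open>3 * \<rho>\<close> in the cone; at most 1, so that the zeroth coordinate is
      bounded by 1 on all of \<open>?V\<close>.\<close>
    define \<rho> where "\<rho> = min (r / 3) 1"
    have \<rho>: "\<rho> > 0" "\<rho> \<le> 1" "ball p0 (3 * \<rho>) \<subseteq> unit_cone X"
      using r by (auto simp: \<rho>_def min_def subset_iff split: if_splits)
    let ?V = "ball 0 \<rho> \<union> unit_cone X"
    have V: "open ?V" "circled ?V" "ball 0 \<rho> \<subseteq> ?V"
      using open_unit_cone[OF assms] circled_ball_Un_unit_cone[OF \<rho>(1)] by auto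
    have V1: "norm (w $ None) \<le> 1" if "w \<in> ?V" for w
      using that \<rho>(2) Finite_Cartesian_Product.norm_nth_le[of w None] by (auto simp: unit_cone_def)
    have VX: "of_real t *s homogenize x \<in> ?V" if "x \<in> X" "0 < t" "t < 1" for x t
      using that by (simp add: unit_cone_def)
    show ?thesis
    proof (rule dense_ge)
      fix y assume y: "siciak_extremal X z < y"
      obtain s where s: "siciak_extremal X z < ereal s" "ereal s \<le> y"
        using ereal_dense2[OF y] by (metis order_less_imp_le)
      have "of_real (exp (- s)) *s homogenize z \<in> disc_hull ?V"
        by (rule hull_of_siciak_less[OF V(1,2) \<rho>(1) V(3) V1 VX s(1)])
      then obtain f where f: "f \<in> disc_class X" "f 0 = affine_embed z" "disc_functional f \<le> ereal s"
        using disc_of_hull[OF assms \<rho>(1,3)] by blast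
      have "envelope (disc_class X) disc_functional (affine_embed z) \<le> disc_functional f"
        unfolding envelope_def using f by (intro INF_lower) auto
      then show "envelope (disc_class X) disc_functional (affine_embed z) \<le> y"
        using f(3) s(2) by (meson order_trans)
    qed
  qed
qed

end
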